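(* Let $f \in L^2(ds)\cap L^1(ds)$. Let $\{f_n\}$ be a sequence of step functions which approximates $f$ both in $L^2(ds)$ and in $L^1(ds)$. Then $$\int_0^\infty f_n(s)\,dX_s \longrightarrow \int_0^\infty f(s)\,dX_s \quad (n\to\infty)\quad \text{locally in } \mathscr{W}\text{-measure}.$$
   Context: Path space. $\Omega = C([0,\infty)\to\mathbb{R})$, $X=(X_s)_{s\ge 0}$ is the coordinate process on $\Omega$, and $\mathcal{F}_\infty=\sigma(X_s:s\ge 0)$. Measures. $\Pi^{(u)}$ ($u>0$) is the law on $C([0,u]\to\mathbb{R})$ of the Brownian bridge from $0$ to $0$ of length $u$. $R^+$ is the law on $(\Omega,\mathcal{F}_\infty)$ of the 3-dimensional Bessel process starting from $0$, $R^-$ is the law of $(-X_t)$ under $R^+$, and $R=\frac{R^++R^-}{2}$. For $u>0$, $X^{(u)}=(X_t:0\le t\le u)$ and $Y=(Y_t:t\ge0)$, the concatenation $X^{(u)}\bullet Y$ is the path with $(X^{(u)}\bullet Y)_t = X_t$ if $0\le t<u$; $=Y_{t-u}$ if $t\ge u$ and $X_u=Y_0$; $=X_u$ if $t\ge u$ and $X_u\ne Y_0$. $\Pi^{(u)}\bullet R$ is the law on $(\Omega,\mathcal{F}_\infty)$ of $X^{(u)}\bullet Y$ under the product measure $\Pi^{(u)}(dX^{(u)})\otimes R(dY)$. The $\sigma$-finite measure $\mathscr{W}$ on $(\Omega,\mathcal{F}_\infty)$ is $$\mathscr{W}=\int_0^\infty \frac{du}{\sqrt{2\pi u}}\,\left(\Pi^{(u)}\bullet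 R\right).$$ Functions. $L^p(ds)$ denotes $L^p([0,\infty),ds)$ with real-valued functions. A step function is a function $f=\sum_{k=1}^n c_k 1_{[t_{k-1},t_k)}$ with $n\in\mathbb{N}$, $c_k\in\mathbb{R}$, $0=t_0<t_1<\cdots<t_n<\infty$; for it, $\int_0^\infty f(s)\,dX_s:=\sum_{k=1}^n c_k(X_{t_k}-X_{t_{k-1}})$. Convergence. Measurable functionals $Z_n$ converge to a measurable functional $Z$ locally in $\mathscr{W}$-measure if for every $\varepsilon>0$ and every $A\in\mathcal{F}_\infty$ with $\mathscr{W}(A)<\infty$, $\mathscr{W}(A\cap\{|Z_n-Z|\ge\varepsilon\})\to0$. Wiener integral under $\mathscr{W}$. For $f\in L^2(ds)\cap L^1\left(\frac{ds}{1+\sqrt{s}}\right)$, where $L^1\left(\frac{ds}{1+\sqrt{s}}\right)=\{f:\int_0^\infty|f(s)|\frac{ds}{1+\sqrt{s}}<\infty\}\supset L^1(ds)$, the random variable $\int_0^\infty f(s)\,dX_s$ is defined (up to $\mathscr{W}$-null sets) as the limit locally in $\mathscr{W}$-measure of $\int_0^\infty h_n(s)\,dX_s$ for any sequence $\{h_n\}$ of step functions with $\int_0^\infty|h_n-f|^2ds+\int_0^\infty|h_n-f|\frac{ds}{1+\sqrt{s}}\to0$; this limit exists and does not depend on the choice of $\{h_n\}$. *)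

theory Defs
  imports "HOL-Probability.Probability"
begin

section \<open>Path space\<close>

text \<open>
  \<open>path_space I\<close> is \<open>C(I \<rightarrow> \<real>)\<close> with the \<open>\<sigma>\<close>-algebra generated by the coordinate maps (see
  \<open>sets_path_space\<close> below). Paths are extensional functions, so that values outside \<open>I\<close> carry
  no information.
\<close>

definition path_space :: "real set \<Rightarrow> (real \<Rightarrow> real) measure" where
  "path_space I = restrict_space (\<Pi>\<^sub>M t\<in>I. borel) {w. continuous_on I w}"

abbreviation \<Omega> :: "(real \<Rightarrow> real) measure" where
  "\<Omega> \<equiv> path_space {0..}"

lemma space_path_space: "space (path_space I) = {w \<in> extensional I. continuous_on I w}"
  by (auto simp: path_space_def space_restrict_space space_PiM PiE_def)

lemma sets_path_space:
  "sets (path_space I) =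
     sigma_sets (space (path_space I))
       {(\<lambda>w. w s) -` B \<inter> space (path_space I) | s B. s \<in> I \<and> B \<in> sets borel}"
  (is "_ = sigma_sets ?S ?G")
proof
  have G: "?G \<subseteq> Pow ?S" by auto
  have "(\<lambda>w. w) \<in> measurable (sigma ?S ?G) (restrict_space (\<Pi>\<^sub>M t\<in>I. borel) {w. continuous_on I w})"
  proof (intro measurable_restrict_space2 measurable_PiM_single')
    fix i assume i: "i \<in> I"
    show "(\<lambda>w. w i) \<in> borel_measurable (sigma ?S ?G)"
    proof (rule measurableI)
      fix A :: "real set" assume "A \<in> sets borel"
      with i have "(\<lambda>w. w i) -` A \<inter> ?S \<in> ?G" by blast
      then show "(\<lambda>w. w i) -` A \<inter> space (sigma ?S ?G) \<in> sets (sigma ?S ?G)"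
        using G by (simp add: sigma_sets.Basic)
    qed simp
  qed (use G in \<open>auto simp: space_path_space PiE_def Pi_def\<close>)
  then have M: "(\<lambda>w. w) \<in> measurable (sigma ?S ?G) (path_space I)"
    by (simp add: path_space_def)
  show "sets (path_space I) \<subseteq> sigma_sets ?S ?G"
  proof
    fix A assume A: "A \<in> sets (path_space I)"
    then have "A \<subseteq> ?S" by (rule sets.sets_into_space)
    then have "(\<lambda>w. w) -` A \<inter> ?S = A" by auto
    with measurable_sets[OF M A] G show "A \<in> sigma_sets ?S ?G" by simp
  qed
next
  have "(\<lambda>w. w s) \<in> borel_measurable (path_space I)" if "s \<in> I" for s
    unfolding path_space_def
    using that by (intro measurable_restrict_space1 measurable_component_singleton)
  then show "sigma_sets ?S ?G \<subseteq> sets (path_space I)"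
    by (intro sets.sigma_sets_subset) (auto intro: measurable_sets)
qed

section \<open>The measure \<open>\<W>\<close>\<close>

text \<open>
  All laws below are images of Wiener measure, which is a probability measure on \<open>\<Omega>\<close> uniquely
  determined by the following property.
\<close>

definition wiener_measure :: "(real \<Rightarrow> real) measure \<Rightarrow> bool" where
  "wiener_measure P \<longleftrightarrow>
     prob_space P \<and> sets P = sets \<Omega> \<and>
     (AE w in P. w 0 = 0) \<and>
     (\<forall>s t. 0 \<le> s \<and> s < t \<longrightarrow>
        distributed P lborel (\<lambda>w. w t - w s) (normal_density 0 (sqrt (t - s)))) \<and>
     (\<forall>n (t :: nat \<Rightarrow> real). 0 \<le> t 0 \<and> (\<forall>k<n. t k < t (Suc k)) \<longrightarrow>
        prob_space.indep_vars P (\<lambda>_. borel) (\<lambda>k w. w (t (Suc k)) - w (t k)) {..<n})"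

text \<open>The Brownian bridge from \<open>0\<close> to \<open>0\<close> of length \<open>u\<close>, as \<open>B\<^sub>t - (t / u) B\<^sub>u\<close>.\<close>

definition bridge_law :: "(real \<Rightarrow> real) measure \<Rightarrow> real \<Rightarrow> (real \<Rightarrow> real) measure" where
  "bridge_law P u =
     distr P (path_space {0..u}) (\<lambda>w. \<lambda>t\<in>{0..u}. w t - t / u * w u)"

text \<open>The 3-dimensional Bessel process from \<open>0\<close>, as the modulus of a 3-dimensional Brownian motion.\<close>

definition bessel3_law :: "(real \<Rightarrow> real) measure \<Rightarrow> (real \<Rightarrow> real) measure" where
  "bessel3_law P =
     distr (P \<Otimes>\<^sub>M (P \<Otimes>\<^sub>M P)) \<Omega>
       (\<lambda>(a, b, c). \<lambda>t\<in>{0..}. sqrt ((a t)\<^sup>2 + (b t)\<^sup>2 + (c t)\<^sup>2))"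

definition neg_bessel3_law :: "(real \<Rightarrow> real) measure \<Rightarrow> (real \<Rightarrow> real) measure" where
  "neg_bessel3_law P = distr (bessel3_law P) \<Omega> (\<lambda>w. \<lambda>t\<in>{0..}. - w t)"

definition sym_bessel3_law :: "(real \<Rightarrow> real) measure \<Rightarrow> (real \<Rightarrow> real) measure" where
  "sym_bessel3_law P =
     measure_of (space \<Omega>) (sets \<Omega>)
       (\<lambda>A. (emeasure (bessel3_law P) A + emeasure (neg_bessel3_law P) A) / 2)"

definition concat_path :: "real \<Rightarrow> (real \<Rightarrow> real) \<Rightarrow> (real \<Rightarrow> real) \<Rightarrow> real \<Rightarrow> real" where
  "concat_path u x y =
     (\<lambda>t\<in>{0..}. if t < u then x t else if x u = y 0 then y (t - u) else x u)"

definition bridge_bessel_law :: "(real \<Rightarrow> real) measure \<Rightarrow> real \<Rightarrow> (real \<Rightarrow> real) measure" where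
  "bridge_bessel_law P u =
     distr (bridge_law P u \<Otimes>\<^sub>M sym_bessel3_law P) \<Omega> (\<lambda>(x, y). concat_path u x y)"

definition \<W> :: "(real \<Rightarrow> real) measure \<Rightarrow> (real \<Rightarrow> real) measure" where
  "\<W> P =
     measure_of (space \<Omega>) (sets \<Omega>)
       (\<lambda>A. \<integral>\<^sup>+u\<in>{0<..}. ennreal (1 / sqrt (2 * pi * u)) * emeasure (bridge_bessel_law P u) A \<partial>lborel)"

section \<open>Integrals of step functions\<close>

text \<open>Only the values of \<open>f\<close> on \<open>{0..}\<close> matter.\<close>

definition step_repr :: "(real \<Rightarrow> real) \<Rightarrow> nat \<Rightarrow> (nat \<Rightarrow> real) \<Rightarrow> (nat \<Rightarrow> real) \<Rightarrow> bool" where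
  "step_repr f n c t \<longleftrightarrow>
     t 0 = 0 \<and> (\<forall>k<n. t k < t (Suc k)) \<and>
     (\<forall>s\<ge>0. f s = (\<Sum>k=1..n. c k * indicator {t (k - 1)..<t k} s))"

definition step_function :: "(real \<Rightarrow> real) \<Rightarrow> bool" where
  "step_function f \<longleftrightarrow> (\<exists>n c t. step_repr f n c t)"

definition step_integral :: "(real \<Rightarrow> real) \<Rightarrow> (real \<Rightarrow> real) \<Rightarrow> real" where
  "step_integral f w =
     (THE v. \<exists>n c t. step_repr f n c t \<and> v = (\<Sum>k=1..n. c k * (w (t k) - w (t (k - 1)))))"

text \<open>
  The value does not depend on the representation: it is determined by the jumps of \<open>f\<close>.
\<close>

lemma step_repr_nonneg:
  assumes "step_repr f n c t" "k \<le> n"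
  shows "0 \<le> t k"
  using assms(2)
proof (induction k)
  case 0
  then show ?case using assms(1) by (simp add: step_repr_def)
next
  case (Suc k)
  then have "0 \<le> t k" "t k < t (Suc k)"
    using assms(1) by (auto simp: step_repr_def)
  then show ?case by linarith
qed

lemma step_repr_jump:
  assumes r: "step_repr f n c t" and s: "0 \<le> s"
    and l: "0 < s \<Longrightarrow> (f \<longlongrightarrow> l) (at_left s)" "s = 0 \<Longrightarrow> l = 0"
  shows "f s - l = (\<Sum>k=1..n. c k * (of_bool (s = t (k - 1)) - of_bool (s = t k)))"
proof -
  have tk: "0 \<le> t (k - 1)" "t (k - 1) < t k" if "k \<in> {1..n}" for k
  proof -
    show "0 \<le> t (k - 1)" using that step_repr_nonneg[OF r, of "k - 1"] by auto
    have "k - 1 < n" "Suc (k - 1) = k" using that by auto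
    then show "t (k - 1) < t k" using r unfolding step_repr_def by metis
  qed
  have fs: "f s = (\<Sum>k=1..n. c k * indicator {t (k - 1)..<t k} s)" if "0 \<le> s" for s
    using r that by (simp add: step_repr_def)
  show ?thesis
  proof (cases "s = 0")
    case True
    have "indicator {t (k - 1)..<t k} s = (of_bool (s = t (k - 1)) - of_bool (s = t k) :: real)"
      if "k \<in> {1..n}" for k
      using tk[OF that] True by (auto simp: indicator_def)
    then show ?thesis using l(2) True fs[OF s] by simp
  next
    case False
    with s have s0: "0 < s" by simp
    have lim: "((indicator {a..<b} :: real \<Rightarrow> real) \<longlongrightarrow> indicator {a<..b} s) (at_left s)"
      if "a < b" for a b
    proof (rule tendsto_eventually)
      consider "s \<le> a" | "a < s" "s \<le> b" | "b < s" by linarith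
      then show "\<forall>\<^sub>F x in at_left s. (indicator {a..<b} x :: real) = indicator {a<..b} s"
      proof cases
        case 1
        show ?thesis
          using eventually_at_left_real[of "s - 1" s] 1 by (auto elim!: eventually_mono)
      next
        case 2
        then show ?thesis
          using eventually_at_left_real[of a s] by (auto elim!: eventually_mono)
      next
        case 3
        then show ?thesis
          using eventually_at_left_real[of b s] by (auto elim!: eventually_mono)
      qed
    qed
    have "((\<lambda>x. \<Sum>k=1..n. c k * indicator {t (k - 1)..<t k} x) \<longlongrightarrow>
        (\<Sum>k=1..n. c k * indicator {t (k - 1)<..t k} s)) (at_left s)"
      by (intro tendsto_intros lim tk)
    moreover have "\<forall>\<^sub>F x in at_left s. (\<Sum>k=1..n. c k * indicator {t (k - 1)..<t k} x) = f x"
      using eventually_at_left_real[OF s0] by eventually_elim (simp add: fs)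
    ultimately have "(f \<longlongrightarrow> (\<Sum>k=1..n. c k * indicator {t (k - 1)<..t k} s)) (at_left s)"
      by (rule Lim_transform_eventually)
    then have "l = (\<Sum>k=1..n. c k * indicator {t (k - 1)<..t k} s)"
      using l(1)[OF s0] tendsto_unique trivial_limit_at_left_real by blast
    then have "f s - l =
        (\<Sum>k=1..n. c k * (indicator {t (k - 1)..<t k} s - indicator {t (k - 1)<..t k} s))"
      by (simp add: fs[OF s] sum_subtractf right_diff_distrib)
    also have "\<dots> = (\<Sum>k=1..n. c k * (of_bool (s = t (k - 1)) - of_bool (s = t k)))"
      by (intro sum.cong refl arg_cong2[where f = "(*)"])
         (use tk in \<open>fastforce simp: indicator_def\<close>)
    finally show ?thesis .
  qed
qed

lemma step_repr_left_limit:
  assumes r: "step_repr f n c t" and s: "0 < s"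
  shows "\<exists>l. (f \<longlongrightarrow> l) (at_left s)"
proof -
  have lim: "\<exists>l. ((indicator {a..<b} :: real \<Rightarrow> real) \<longlongrightarrow> l) (at_left s)" for a b
  proof -
    consider "s \<le> a" | "a < s" "s \<le> b" | "a < s" "b < s" by linarith
    then have "\<exists>l. \<forall>\<^sub>F x in at_left s. (indicator {a..<b} x :: real) = l"
    proof cases
      case 1
      then have "\<forall>\<^sub>F x in at_left s. (indicator {a..<b} x :: real) = 0"
        using eventually_at_left_real[of "s - 1" s] by (auto elim!: eventually_mono)
      then show ?thesis by blast
    next
      case 2
      then have "\<forall>\<^sub>F x in at_left s. (indicator {a..<b} x :: real) = 1"
        using eventually_at_left_real[of a s] by (auto elim!: eventually_mono)
      then show ?thesis by blast
    next
      case 3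
      then have "\<forall>\<^sub>F x in at_left s. (indicator {a..<b} x :: real) = 0"
        using eventually_at_left_real[of b s] by (auto elim!: eventually_mono)
      then show ?thesis by blast
    qed
    then show ?thesis using tendsto_eventually by (elim exE) (rule exI)
  qed
  then obtain L where L:
    "\<And>a b. ((indicator {a..<b} :: real \<Rightarrow> real) \<longlongrightarrow> L a b) (at_left s)"
    by metis
  have "((\<lambda>x. \<Sum>k=1..n. c k * indicator {t (k - 1)..<t k} x) \<longlongrightarrow>
      (\<Sum>k=1..n. c k * L (t (k - 1)) (t k))) (at_left s)"
    by (intro tendsto_intros L)
  moreover have "\<forall>\<^sub>F x in at_left s. (\<Sum>k=1..n. c k * indicator {t (k - 1)..<t k} x) = f x"
    using eventually_at_left_real[OF s]
    by eventually_elim (use r in \<open>simp add: step_repr_def\<close>)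
  ultimately have "(f \<longlongrightarrow> (\<Sum>k=1..n. c k * L (t (k - 1)) (t k))) (at_left s)"
    by (rule Lim_transform_eventually)
  then show ?thesis by blast
qed

lemma step_integral_eq:
  assumes r: "step_repr f n c t"
  shows "step_integral f w = (\<Sum>k=1..n. c k * (w (t k) - w (t (k - 1))))"
proof -
  have indep: "(\<Sum>k=1..n. c k * (w (t k) - w (t (k - 1)))) =
      (\<Sum>k=1..n'. c' k * (w (t' k) - w (t' (k - 1))))"
    if r': "step_repr f n' c' t'" for n' c' t'
  proof -
    define S where "S = t ` {0..n} \<union> t' ` {0..n'}"
    have S: "finite S" "\<And>s. s \<in> S \<Longrightarrow> 0 \<le> s"
      using step_repr_nonneg[OF r] step_repr_nonneg[OF r'] by (auto simp: S_def)
    have *: "(\<Sum>k=1..m. d k * (w (q k) - w (q (k - 1)))) =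
        - (\<Sum>s\<in>S. (\<Sum>k=1..m. d k * (of_bool (s = q (k - 1)) - of_bool (s = q k))) * w s)"
      if q: "q ` {0..m} \<subseteq> S" for m q and d :: "nat \<Rightarrow> real"
    proof -
      have pt: "(\<Sum>s\<in>S. of_bool (s = a) * w s) = w a" if "a \<in> S" for a
        using S(1) that by (subst sum.remove[of _ a]) (auto intro!: sum.neutral)
      have "(\<Sum>s\<in>S. (\<Sum>k=1..m. d k * (of_bool (s = q (k - 1)) - of_bool (s = q k))) * w s)
          = (\<Sum>k=1..m. \<Sum>s\<in>S. d k * (of_bool (s = q (k - 1)) - of_bool (s = q k)) * w s)"
        unfolding sum_distrib_right by (rule sum.swap)
      also have "\<dots> = (\<Sum>k=1..m. d k *
          ((\<Sum>s\<in>S. of_bool (s = q (k - 1)) * w s) - (\<Sum>s\<in>S. of_bool (s = q k) * w s)))"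
        by (simp add: sum_distrib_left sum_subtractf algebra_simps)
      also have "\<dots> = (\<Sum>k=1..m. d k * (w (q (k - 1)) - w (q k)))"
      proof (intro sum.cong refl)
        fix k assume "k \<in> {1..m}"
        then have "q (k - 1) \<in> S" "q k \<in> S" using q by auto
        then show "d k * ((\<Sum>s\<in>S. of_bool (s = q (k - 1)) * w s) - (\<Sum>s\<in>S. of_bool (s = q k) * w s))
            = d k * (w (q (k - 1)) - w (q k))"
          by (simp only: pt)
      qed
      finally show ?thesis by (simp add: sum_negf[symmetric] algebra_simps)
    qed
    have "(\<Sum>k=1..n. c k * (of_bool (s = t (k - 1)) - of_bool (s = t k))) =
        (\<Sum>k=1..n'. c' k * (of_bool (s = t' (k - 1)) - of_bool (s = t' k)))" if "s \<in> S" for s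
    proof -
      obtain l where "0 < s \<Longrightarrow> (f \<longlongrightarrow> l) (at_left s)" "s = 0 \<Longrightarrow> l = 0"
        using step_repr_left_limit[OF r, of s] by (cases "0 < s") auto
      with S(2)[OF that] show ?thesis
        using step_repr_jump[OF r, of s l] step_repr_jump[OF r', of s l] by simp
    qed
    then show ?thesis
      by (subst (1 2) *) (auto simp: S_def)
  qed
  show ?thesis
    unfolding step_integral_def
  proof (rule the_equality)
    show "\<exists>n' c' t'. step_repr f n' c' t' \<and>
        (\<Sum>k=1..n. c k * (w (t k) - w (t (k - 1)))) = (\<Sum>k=1..n'. c' k * (w (t' k) - w (t' (k - 1))))"
      using r by blast
  next
    fix v
    assume "\<exists>n' c' t'. step_repr f n' c' t' \<and> v = (\<Sum>k=1..n'. c' k * (w (t' k) - w (t' (k - 1))))"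
    then obtain n' c' t' where "step_repr f n' c' t'"
      and v: "v = (\<Sum>k=1..n'. c' k * (w (t' k) - w (t' (k - 1))))"
      by (elim exE conjE)
    from indep[OF this(1)] v show "v = (\<Sum>k=1..n. c k * (w (t k) - w (t (k - 1))))"
      by (simp only:)
  qed
qed

section \<open>The Wiener integral under a measure on path space\<close>

text \<open>The measure \<open>ds\<close> on \<open>[0,\<infinity>)\<close>.\<close>

abbreviation ds :: "real measure" where
  "ds \<equiv> lebesgue_on {0..}"

definition converges_locally_in_measure ::
    "'a measure \<Rightarrow> (nat \<Rightarrow> 'a \<Rightarrow> real) \<Rightarrow> ('a \<Rightarrow> real) \<Rightarrow> bool" where
  "converges_locally_in_measure M Z Z' \<longleftrightarrow>
     (\<forall>n. Z n \<in> borel_measurable M) \<and> Z' \<in> borel_measurable M \<and>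
     (\<forall>\<epsilon>>0. \<forall>A\<in>sets M. emeasure M A < \<infinity> \<longrightarrow>
        (\<lambda>n. emeasure M (A \<inter> {w \<in> space M. \<bar>Z n w - Z' w\<bar> \<ge> \<epsilon>})) \<longlonglongrightarrow> 0)"

definition L1_tendsto :: "real measure \<Rightarrow> (nat \<Rightarrow> real \<Rightarrow> real) \<Rightarrow> (real \<Rightarrow> real) \<Rightarrow> bool" where
  "L1_tendsto \<mu> h f \<longleftrightarrow> (\<lambda>n. \<integral>\<^sup>+s. ennreal \<bar>h n s - f s\<bar> \<partial>\<mu>) \<longlonglongrightarrow> 0"

definition L2_tendsto :: "real measure \<Rightarrow> (nat \<Rightarrow> real \<Rightarrow> real) \<Rightarrow> (real \<Rightarrow> real) \<Rightarrow> bool" where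
  "L2_tendsto \<mu> h f \<longleftrightarrow> (\<lambda>n. \<integral>\<^sup>+s. ennreal (\<bar>h n s - f s\<bar>\<^sup>2) \<partial>\<mu>) \<longlonglongrightarrow> 0"

text \<open>
  The random variable \<open>\<integral> f(s) dX\<^sub>s\<close>, determined up to null sets, for
  \<open>f \<in> L\<^sup>2(ds) \<inter> L\<^sup>1(ds / (1 + \<surd>s))\<close>: a version of the common limit of the integrals of all
  approximating sequences of step functions.
\<close>

definition wiener_integral ::
    "(real \<Rightarrow> real) measure \<Rightarrow> (real \<Rightarrow> real) \<Rightarrow> (real \<Rightarrow> real) \<Rightarrow> real" where
  "wiener_integral M f =
     (SOME Z. Z \<in> borel_measurable M \<and>
        (\<forall>h. (\<forall>n. step_function (h n)) \<and> L2_tendsto ds h f \<and>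
             L1_tendsto (density ds (\<lambda>s. ennreal (1 / (1 + sqrt s)))) h f \<longrightarrow>
           converges_locally_in_measure M (\<lambda>n. step_integral (h n)) Z))"

end

theory Submission
  imports Defs
begin

text \<open>
  Under \<open>\<Pi>\<^sup>(\<^sup>u\<^sup>) \<bullet> R\<close> the integral of a step function \<open>g\<close> splits at time \<open>u\<close>. The bridge part is a
  Wiener integral, bounded in \<open>L\<^sup>2\<close>, minus \<open>(B\<^sub>u / u) \<integral>\<^sub>0\<^sup>u g\<close>. For the Bessel part, the Doob decomposition
  of \<open>\<bar>B\<bar>\<close> at the jump times of \<open>g\<close> gives a martingale transform bounded in \<open>L\<^sup>2\<close> by the norm of \<open>g\<close>, and a
  compensator whose mean is a multiple of \<open>\<integral> \<bar>g r\<bar> d\<surd>(r - u)\<close>. The latter may be infinite in the limit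
  for an individual \<open>u\<close>, but by Tonelli its integral over \<open>u \<in> (0, U)\<close> is at most a constant times
  \<open>\<integral> \<bar>g s\<bar> ds / (1 + \<surd>s)\<close>. Hence the integrals of a fast approximating sequence converge almost surely
  for almost every \<open>u\<close>, to a limit that does not depend on \<open>u\<close>; dominated convergence in \<open>u\<close> turns this
  into convergence in \<open>\<W>\<close>-measure on sets of finite measure, and a subsequence argument treats an
  arbitrary approximating sequence.
\<close>

section \<open>Martingale transforms of independent increments\<close>

text \<open>The obstacle is the Bessel part: it is not a martingale, so an L2 isometry cannot
  control it, and its mean grows like the square root of elapsed time. For fixed \<open>u\<close>
  the resulting drift bound is too singular at \<open>r = u\<close>; averaging over the starting
  time helps, because the integral of \<open>1 / (2 * sqrt (r - u))\<close> over \<open>u\<close> in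
  (0, U) is \<open>sqrt r - sqrt (r - U)\<close> for \<open>r > U\<close>, of order
  \<open>U / (2 * sqrt r)\<close>. This is where the weight \<open>1 / (1 + sqrt s)\<close> comes
  from. The centred parts are turned from L2 into L1 bounds by \<open>|x| <= d + x^2 / d\<close>;
  squared norms of order \<open>(1/4)^n\<close> and \<open>d = (1/2)^n\<close> give a summable
  series, hence the rates in \<open>fast_approx\<close>. The limit is taken as the pathwise
  \<open>lim\<close> along one fast sequence: it is measurable and does not mention
  \<open>u\<close>. Since \<open>wiener_integral\<close> is a \<open>SOME\<close>, one random
  variable must first be shown to serve all approximating sequences; the theorem then reads off this
  property, L1(ds) convergence being stronger than weighted convergence because the weight is at
  most 1.\<close>

lemma (in prob_space) nn_integral_indep_var:
  assumes ind: "indep_var S X T Y" and F[measurable]: "F \<in> borel_measurable (S \<Otimes>\<^sub>M T)"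
  shows "(\<integral>\<^sup>+\<omega>. F (X \<omega>, Y \<omega>) \<partial>M) = (\<integral>\<^sup>+\<omega>. (\<integral>\<^sup>+\<omega>'. F (X \<omega>, Y \<omega>') \<partial>M) \<partial>M)"
proof -
  have XY[measurable]: "X \<in> measurable M S" "Y \<in> measurable M T"
    and D: "distr M S X \<Otimes>\<^sub>M distr M T Y = distr M (S \<Otimes>\<^sub>M T) (\<lambda>x. (X x, Y x))"
    using ind unfolding indep_var_distribution_eq by auto
  interpret Y: prob_space "distr M T Y" by (rule prob_space_distr) simp
  have "(\<integral>\<^sup>+\<omega>. F (X \<omega>, Y \<omega>) \<partial>M) = (\<integral>\<^sup>+z. F z \<partial>(distr M S X \<Otimes>\<^sub>M distr M T Y))"
    unfolding D by (subst nn_integral_distr) auto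
  also have "\<dots> = (\<integral>\<^sup>+x. (\<integral>\<^sup>+y. F (x, y) \<partial>distr M T Y) \<partial>distr M S X)"
    by (subst Y.nn_integral_fst[symmetric]) auto
  also have "\<dots> = (\<integral>\<^sup>+\<omega>. (\<integral>\<^sup>+y. F (X \<omega>, y) \<partial>distr M T Y) \<partial>M)"
    by (subst nn_integral_distr) (auto intro!: Y.borel_measurable_nn_integral)
  also have "\<dots> = (\<integral>\<^sup>+\<omega>. (\<integral>\<^sup>+\<omega>'. F (X \<omega>, Y \<omega>') \<partial>M) \<partial>M)"
  proof (rule nn_integral_cong)
    fix \<omega> assume "\<omega> \<in> space M"
    then have [measurable]: "X \<omega> \<in> space S" by (rule measurable_space[OF XY(1)])
    show "(\<integral>\<^sup>+y. F (X \<omega>, y) \<partial>distr M T Y) = (\<integral>\<^sup>+\<omega>'. F (X \<omega>, Y \<omega>') \<partial>M)"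
      by (subst nn_integral_distr) auto
  qed
  finally show ?thesis .
qed

text \<open>Conditioning on the past in elementary form: the next variable is replaced by an
  independent copy \<open>\<omega>'\<close>. The past is kept as a whole tuple, so that
  \<open>F\<close> may depend on every earlier increment and not only on their sum.\<close>

lemma (in prob_space) nn_integral_indep_past:
  fixes N :: "'b measure" and Y :: "nat \<Rightarrow> 'a \<Rightarrow> 'b"
  assumes ind: "indep_vars (\<lambda>_. N) Y {..<n}" and m: "m < n"
    and F[measurable]: "F \<in> borel_measurable (PiM {..<m} (\<lambda>_. N) \<Otimes>\<^sub>M N)"
  defines "X \<equiv> \<lambda>\<omega>. \<lambda>i\<in>{..<m}. Y i \<omega>"
  shows "X \<in> measurable M (PiM {..<m} (\<lambda>_. N))"
    and "(\<integral>\<^sup>+\<omega>. F (X \<omega>, Y m \<omega>) \<partial>M) = (\<integral>\<^sup>+\<omega>. (\<integral>\<^sup>+\<omega>'. F (X \<omega>, Y m \<omega>') \<partial>M) \<partial>M)"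
proof -
  have ind': "indep_var (PiM {..<m} (\<lambda>_. N)) X (PiM {m} (\<lambda>_. N)) (\<lambda>\<omega>. \<lambda>i\<in>{m}. Y i \<omega>)"
    unfolding X_def using m by (intro indep_var_restrict[OF ind]) auto
  then show "X \<in> measurable M (PiM {..<m} (\<lambda>_. N))" by (rule indep_var_rv1)
  have "(\<lambda>z. F (fst z, snd z m)) \<in> borel_measurable (PiM {..<m} (\<lambda>_. N) \<Otimes>\<^sub>M PiM {m} (\<lambda>_. N))"
    by measurable
  from nn_integral_indep_var[OF ind' this]
  show "(\<integral>\<^sup>+\<omega>. F (X \<omega>, Y m \<omega>) \<partial>M) = (\<integral>\<^sup>+\<omega>. (\<integral>\<^sup>+\<omega>'. F (X \<omega>, Y m \<omega>') \<partial>M) \<partial>M)"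
    by simp
qed

text \<open>The cross term vanishes after centring, and the variance is at most the second moment
  about any point. The point \<open>a\<close> is left free because a Lipschitz function is
  controlled about its value before the increment.\<close>

lemma (in prob_space) nn_integral_centered_square_le:
  fixes g :: "'a \<Rightarrow> real"
  assumes g: "random_variable borel g" and int: "integrable M (\<lambda>\<omega>. (g \<omega> - a)\<^sup>2)"
  shows "(\<integral>\<^sup>+\<omega>. ennreal ((s + c * (g \<omega> - expectation g))\<^sup>2) \<partial>M)
    \<le> ennreal (s\<^sup>2 + c\<^sup>2 * expectation (\<lambda>\<omega>. (g \<omega> - a)\<^sup>2))"
proof -
  note [measurable] = g
  have 1: "integrable M (\<lambda>\<omega>. g \<omega> - a)"
    using int by (rule square_integrable_imp_integrable[rotated]) simp
  have ig: "integrable M g"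
    using Bochner_Integration.integrable_add[OF 1, of "\<lambda>_. a"] by simp
  define h where "h \<omega> = g \<omega> - a" for \<omega>
  define e where "e = expectation h"
  have ih: "integrable M h" "integrable M (\<lambda>\<omega>. (h \<omega>)\<^sup>2)" using 1 int by (simp_all add: h_def[abs_def])
  have eg: "expectation g = e + a" using ig by (simp add: e_def h_def[abs_def] prob_space)
  have eq: "(s + c * (g \<omega> - expectation g))\<^sup>2 = c\<^sup>2 * (h \<omega>)\<^sup>2 + (2 * s * c - 2 * c\<^sup>2 * e) * h \<omega> + (s - c * e)\<^sup>2" for \<omega>
    by (simp add: eg h_def power2_eq_square algebra_simps)
  have "(\<integral>\<^sup>+\<omega>. ennreal ((s + c * (g \<omega> - expectation g))\<^sup>2) \<partial>M) = ennreal (expectation (\<lambda>\<omega>. (s + c * (g \<omega> - expectation g))\<^sup>2))"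
  proof (rule nn_integral_eq_integral)
    show "integrable M (\<lambda>\<omega>. (s + c * (g \<omega> - expectation g))\<^sup>2)"
      unfolding eq using ih by simp
  qed simp
  also have "expectation (\<lambda>\<omega>. (s + c * (g \<omega> - expectation g))\<^sup>2) =
      c\<^sup>2 * expectation (\<lambda>\<omega>. (h \<omega>)\<^sup>2) + (2 * s * c - 2 * c\<^sup>2 * e) * e + (s - c * e)\<^sup>2"
    unfolding eq using ih by (simp add: e_def prob_space)
  also have "\<dots> = s\<^sup>2 + c\<^sup>2 * expectation (\<lambda>\<omega>. (h \<omega>)\<^sup>2) - c\<^sup>2 * e\<^sup>2"
    by (simp add: power2_eq_square algebra_simps)
  also have "\<dots> \<le> s\<^sup>2 + c\<^sup>2 * expectation (\<lambda>\<omega>. (g \<omega> - a)\<^sup>2)" by (simp add: h_def)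
  finally show ?thesis by (simp add: ennreal_leI)
qed

lemma lipschitz_1_measurable:
  fixes \<phi> :: "'b::euclidean_space \<Rightarrow> real"
  assumes "\<And>x y. \<bar>\<phi> x - \<phi> y\<bar> \<le> norm (x - y)"
  shows "\<phi> \<in> borel_measurable borel"
proof -
  have "1-lipschitz_on UNIV \<phi>"
    using assms by (intro lipschitz_onI) (auto simp: dist_norm)
  then show ?thesis by (intro borel_measurable_continuous_onI lipschitz_on_continuous_on)
qed

lemma (in prob_space) lipschitz_1_integrable:
  fixes \<phi> :: "'b::euclidean_space \<Rightarrow> real" and Y :: "'a \<Rightarrow> 'b"
  assumes lip: "\<And>x y. \<bar>\<phi> x - \<phi> y\<bar> \<le> norm (x - y)"
    and [measurable]: "random_variable borel Y" and int: "integrable M (\<lambda>\<omega>. (norm (Y \<omega>))\<^sup>2)"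
  shows "integrable M (\<lambda>\<omega>. \<phi> (x + Y \<omega>))" "integrable M (\<lambda>\<omega>. (\<phi> (x + Y \<omega>) - \<phi> x)\<^sup>2)"
proof -
  note [measurable] = lipschitz_1_measurable[OF lip]
  have le: "\<bar>\<phi> (x + Y \<omega>) - \<phi> x\<bar> \<le> norm (Y \<omega>)" for \<omega>
    using lip[of "x + Y \<omega>" x] by simp
  show sq: "integrable M (\<lambda>\<omega>. (\<phi> (x + Y \<omega>) - \<phi> x)\<^sup>2)"
    by (rule Bochner_Integration.integrable_bound[OF int]) (use le in \<open>auto simp: abs_le_square_iff[symmetric]\<close>)
  have "integrable M (\<lambda>\<omega>. \<phi> (x + Y \<omega>) - \<phi> x)"
    using sq by (rule square_integrable_imp_integrable[rotated]) simp
  from Bochner_Integration.integrable_add[OF this, of "\<lambda>_. \<phi> x"]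
  show "integrable M (\<lambda>\<omega>. \<phi> (x + Y \<omega>))" by simp
qed

text \<open>Averaging over shifts preserves the Lipschitz constant, so the one-step conditional mean
  is continuous and therefore measurable.\<close>

lemma (in prob_space) lipschitz_1_expectation:
  fixes \<phi> :: "'b::euclidean_space \<Rightarrow> real" and Y :: "'a \<Rightarrow> 'b"
  assumes lip: "\<And>x y. \<bar>\<phi> x - \<phi> y\<bar> \<le> norm (x - y)"
    and Y: "random_variable borel Y" and int: "integrable M (\<lambda>\<omega>. (norm (Y \<omega>))\<^sup>2)"
  shows "(\<lambda>x. expectation (\<lambda>\<omega>. \<phi> (x + Y \<omega>))) \<in> borel_measurable borel"
proof (rule lipschitz_1_measurable)
  fix x y
  note i = lipschitz_1_integrable(1)[OF lip Y int]
  have "\<bar>expectation (\<lambda>\<omega>. \<phi> (x + Y \<omega>)) - expectation (\<lambda>\<omega>. \<phi> (y + Y \<omega>))\<bar>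
      = \<bar>expectation (\<lambda>\<omega>. \<phi> (x + Y \<omega>) - \<phi> (y + Y \<omega>))\<bar>"
    using i by simp
  also have "\<dots> \<le> expectation (\<lambda>\<omega>. \<bar>\<phi> (x + Y \<omega>) - \<phi> (y + Y \<omega>)\<bar>)"
    by (rule integral_abs_bound)
  also have "\<dots> \<le> expectation (\<lambda>\<omega>. norm (x - y))"
  proof (rule integral_mono)
    show "\<bar>\<phi> (x + Y \<omega>) - \<phi> (y + Y \<omega>)\<bar> \<le> norm (x - y)" for \<omega>
      using lip[of "x + Y \<omega>" "y + Y \<omega>"] by simp
  qed (use i in auto)
  finally show "\<bar>expectation (\<lambda>\<omega>. \<phi> (x + Y \<omega>)) - expectation (\<lambda>\<omega>. \<phi> (y + Y \<omega>))\<bar> \<le> norm (x - y)"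
    by (simp add: prob_space)
qed

text \<open>The inner expectation is the conditional mean of the next value given the past, so the
  summands are martingale differences; adding one raises the second moment by at most
  \<open>(c m)^2\<close> times that of the increment, by the Lipschitz bound. Used with the identity
  for Wiener sums and with the norm for Bessel sums.\<close>

lemma (in prob_space) martingale_transform_square_le:
  fixes \<phi> :: "'b::euclidean_space \<Rightarrow> real" and Y :: "nat \<Rightarrow> 'a \<Rightarrow> 'b" and c :: "nat \<Rightarrow> real"
  assumes ind: "indep_vars (\<lambda>_. borel) Y {..<n}"
    and lip: "\<And>x y. \<bar>\<phi> x - \<phi> y\<bar> \<le> norm (x - y)"
    and int: "\<And>k. k < n \<Longrightarrow> integrable M (\<lambda>\<omega>. (norm (Y k \<omega>))\<^sup>2)"
    and "m \<le> n"
  shows "(\<integral>\<^sup>+\<omega>. ennreal ((\<Sum>k<m. c k * (\<phi> (\<Sum>i<Suc k. Y i \<omega>)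
        - expectation (\<lambda>\<omega>'. \<phi> ((\<Sum>i<k. Y i \<omega>) + Y k \<omega>'))))\<^sup>2) \<partial>M)
    \<le> ennreal (\<Sum>k<m. (c k)\<^sup>2 * expectation (\<lambda>\<omega>. (norm (Y k \<omega>))\<^sup>2))"
  using \<open>m \<le> n\<close>
proof (induction m)
  case 0
  then show ?case by simp
next
  case (Suc m)
  then have m: "m < n" by simp
  have Y: "random_variable borel (Y k)" if "k < n" for k
    using ind that by (auto simp: indep_vars_def)
  note [measurable] = lipschitz_1_measurable[OF lip]
  define p where "p k x = expectation (\<lambda>\<omega>'. \<phi> (x + Y k \<omega>'))" for k x
  have p[measurable]: "p k \<in> borel_measurable borel" if "k < n" for k
    unfolding p_def using that by (intro lipschitz_1_expectation[OF lip] Y int) auto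
  \<comment> \<open>Everything up to index \<open>m\<close> is rewritten as a function of this
    tuple, so that the fresh increment \<open>Y m\<close> can be integrated out first.\<close>
  define X where "X \<omega> = (\<lambda>i\<in>{..<m}. Y i \<omega>)" for \<omega>
  let ?N = "PiM {..<m} (\<lambda>_. borel :: 'b measure)"
  define b where "b k x = (\<Sum>i<k. x i)" for k and x :: "nat \<Rightarrow> 'b"
  have b[measurable]: "b k \<in> borel_measurable ?N" if "k \<le> m" for k
    unfolding b_def using that by (intro borel_measurable_sum) auto
  have bX: "b k (X \<omega>) = (\<Sum>i<k. Y i \<omega>)" if "k \<le> m" for k \<omega>
    using that by (auto simp: b_def X_def intro!: sum.cong)
  define s where "s x = (\<Sum>k<m. c k * (\<phi> (b (Suc k) x) - p k (b k x)))" for x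
  have [measurable]: "s \<in> borel_measurable ?N"
    unfolding s_def
    by (intro borel_measurable_sum borel_measurable_times borel_measurable_diff borel_measurable_const
        measurable_compose[OF b p] measurable_compose[OF b lipschitz_1_measurable[OF lip]])
       (use m in auto)
  have [measurable]: "b m \<in> borel_measurable ?N" "p m \<in> borel_measurable borel" using m by auto
  define F where "F z = ennreal ((s (fst z) + c m * (\<phi> (b m (fst z) + snd z) - p m (b m (fst z))))\<^sup>2)" for z
  have [measurable]: "F \<in> borel_measurable (?N \<Otimes>\<^sub>M borel)"
    unfolding F_def by measurable
  have [measurable]: "X \<in> measurable M ?N"
    unfolding X_def by (rule nn_integral_indep_past(1)[OF ind m, of "\<lambda>_. 0"]) simp
  define v where "v k = expectation (\<lambda>\<omega>. (norm (Y k \<omega>))\<^sup>2)" for k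
  have v0: "0 \<le> v k" for k unfolding v_def by simp
  have sX: "s (X \<omega>) = (\<Sum>k<m. c k * (\<phi> (\<Sum>i<Suc k. Y i \<omega>) - p k (\<Sum>i<k. Y i \<omega>)))" for \<omega>
    unfolding s_def by (intro sum.cong refl) (simp add: bX del: sum.lessThan_Suc)
  have "(\<integral>\<^sup>+\<omega>. ennreal ((\<Sum>k<Suc m. c k * (\<phi> (\<Sum>i<Suc k. Y i \<omega>) - p k (\<Sum>i<k. Y i \<omega>)))\<^sup>2) \<partial>M)
      = (\<integral>\<^sup>+\<omega>. F (X \<omega>, Y m \<omega>) \<partial>M)"
    by (intro nn_integral_cong) (simp add: F_def sX bX)
  also have "\<dots> = (\<integral>\<^sup>+\<omega>. (\<integral>\<^sup>+\<omega>'. F (X \<omega>, Y m \<omega>') \<partial>M) \<partial>M)"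
    unfolding X_def by (rule nn_integral_indep_past(2)[OF ind m]) simp
  also have "\<dots> \<le> (\<integral>\<^sup>+\<omega>. ennreal ((s (X \<omega>))\<^sup>2) + ennreal ((c m)\<^sup>2 * v m) \<partial>M)"
  proof (rule nn_integral_mono)
    fix \<omega>
    let ?x = "b m (X \<omega>)"
    \<comment> \<open>The past is frozen at \<open>X \<omega>\<close>; the centring point of
      \<open>nn_integral_centered_square_le\<close> is \<open>\<phi> ?x\<close>.\<close>
    note i = lipschitz_1_integrable[OF lip Y[OF m] int[OF m]]
    have "(\<integral>\<^sup>+\<omega>'. F (X \<omega>, Y m \<omega>') \<partial>M) \<le>
       ennreal ((s (X \<omega>))\<^sup>2 + (c m)\<^sup>2 * expectation (\<lambda>\<omega>'. (\<phi> (?x + Y m \<omega>') - \<phi> ?x)\<^sup>2))"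
      unfolding F_def fst_conv snd_conv p_def
      by (rule nn_integral_centered_square_le) (use i in auto)
    also have "expectation (\<lambda>\<omega>'. (\<phi> (?x + Y m \<omega>') - \<phi> ?x)\<^sup>2) \<le> v m"
      unfolding v_def
    proof (rule integral_mono[OF i(2) int[OF m]])
      show "(\<phi> (?x + Y m \<omega>) - \<phi> ?x)\<^sup>2 \<le> (norm (Y m \<omega>))\<^sup>2" for \<omega>
        using lip[of "?x + Y m \<omega>" ?x] by (simp add: abs_le_square_iff[symmetric])
    qed
    finally show "(\<integral>\<^sup>+\<omega>'. F (X \<omega>, Y m \<omega>') \<partial>M) \<le> ennreal ((s (X \<omega>))\<^sup>2) + ennreal ((c m)\<^sup>2 * v m)"
      using v0[of m] by (simp add: ennreal_plus[symmetric] mult_left_mono ennreal_leI del: ennreal_plus)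
  qed
  also have "\<dots> = (\<integral>\<^sup>+\<omega>. ennreal ((s (X \<omega>))\<^sup>2) \<partial>M) + ennreal ((c m)\<^sup>2 * v m)"
    by (subst nn_integral_add) (auto simp: emeasure_space_1)
  also have "\<dots> \<le> ennreal (\<Sum>k<m. (c k)\<^sup>2 * v k) + ennreal ((c m)\<^sup>2 * v m)"
    using Suc by (intro add_right_mono) (simp add: sX p_def v_def)
  also have "\<dots> = ennreal (\<Sum>k<Suc m. (c k)\<^sup>2 * v k)"
    using v0 by (subst ennreal_plus[symmetric]) (auto intro!: sum_nonneg)
  finally show ?case unfolding p_def v_def .
qed

text \<open>Jensen's inequality: the norm of a centred walk is a submartingale, which makes its
  compensator nondecreasing.\<close>

lemma (in prob_space) norm_le_expectation_norm_add:
  fixes Y :: "'a \<Rightarrow> 'b::euclidean_space"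
  assumes "integrable M Y" "expectation Y = 0"
  shows "norm x \<le> (\<integral>\<omega>. norm (x + Y \<omega>) \<partial>M)"
proof -
  have "norm x = norm (\<integral>\<omega>. x + Y \<omega> \<partial>M)" using assms by (simp add: prob_space)
  also have "\<dots> \<le> (\<integral>\<omega>. norm (x + Y \<omega>) \<partial>M)" by (rule integral_norm_bound)
  finally show ?thesis .
qed

text \<open>A linear substitute for Cauchy-Schwarz, from \<open>2 * |x| * d <= d^2 + x^2\<close>. It
  avoids square roots of extended reals and leaves \<open>d\<close> to be tuned to the rate of the
  sequence.\<close>

lemma (in prob_space) nn_integral_abs_le_square:
  fixes g :: "'a \<Rightarrow> real"
  assumes [measurable]: "random_variable borel g" and d: "0 < d"
  shows "(\<integral>\<^sup>+\<omega>. ennreal \<bar>g \<omega>\<bar> \<partial>M) \<le> ennreal d + ennreal (1 / d) * (\<integral>\<^sup>+\<omega>. ennreal ((g \<omega>)\<^sup>2) \<partial>M)"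
proof -
  have "\<bar>x\<bar> \<le> d + 1 / d * x\<^sup>2" for x :: real
  proof -
    have "0 \<le> (\<bar>x\<bar> - d)\<^sup>2" by simp
    then have "2 * (\<bar>x\<bar> * d) \<le> d\<^sup>2 + x\<^sup>2" by (simp add: power2_diff)
    moreover have "0 \<le> \<bar>x\<bar> * d" using d by simp
    ultimately have "\<bar>x\<bar> * d \<le> d\<^sup>2 + x\<^sup>2" by linarith
    then show ?thesis using d by (simp add: field_simps power2_eq_square)
  qed
  then have "(\<integral>\<^sup>+\<omega>. ennreal \<bar>g \<omega>\<bar> \<partial>M) \<le> (\<integral>\<^sup>+\<omega>. ennreal d + ennreal (1 / d) * ennreal ((g \<omega>)\<^sup>2) \<partial>M)"
    using d by (intro nn_integral_mono) (simp add: ennreal_mult[symmetric] ennreal_plus[symmetric] del: ennreal_plus)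
  also have "\<dots> = ennreal d + ennreal (1 / d) * (\<integral>\<^sup>+\<omega>. ennreal ((g \<omega>)\<^sup>2) \<partial>M)"
    using d by (subst nn_integral_add) (auto simp: emeasure_space_1 nn_integral_cmult)
  finally show ?thesis .
qed

text \<open>Doob decomposition of the norm. The martingale part pays with the squared coefficients;
  the compensator has nonnegative increments, so absolute values go inside the sum and its mean is a
  sum of differences of mean norms.\<close>

lemma (in prob_space) expectation_abs_norm_increments_le:
  fixes Y :: "nat \<Rightarrow> 'a \<Rightarrow> 'b::euclidean_space" and c :: "nat \<Rightarrow> real"
  assumes ind: "indep_vars (\<lambda>_. borel) Y {..<n}"
    and int: "\<And>k. k < n \<Longrightarrow> integrable M (\<lambda>\<omega>. (norm (Y k \<omega>))\<^sup>2)"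
    and mean: "\<And>k. k < n \<Longrightarrow> expectation (Y k) = 0"
    and d: "0 < d"
  defines "B \<equiv> \<lambda>k \<omega>. \<Sum>i<k. Y i \<omega>"
  shows "(\<integral>\<^sup>+\<omega>. ennreal \<bar>\<Sum>k<n. c k * (norm (B (Suc k) \<omega>) - norm (B k \<omega>))\<bar> \<partial>M)
    \<le> ennreal d + ennreal (1 / d) * ennreal (\<Sum>k<n. (c k)\<^sup>2 * expectation (\<lambda>\<omega>. (norm (Y k \<omega>))\<^sup>2))
      + ennreal (\<Sum>k<n. \<bar>c k\<bar> * (expectation (\<lambda>\<omega>. norm (B (Suc k) \<omega>)) - expectation (\<lambda>\<omega>. norm (B k \<omega>))))"
proof -
  have lip: "\<bar>norm x - norm y\<bar> \<le> norm (x - y)" for x y :: 'b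
    by (rule norm_triangle_ineq3)
  have Y: "random_variable borel (Y k)" if "k < n" for k
    using ind that by (auto simp: indep_vars_def)
  have iY: "integrable M (Y k)" if "k < n" for k
  proof -
    note [measurable] = Y[OF that]
    have "integrable M (\<lambda>\<omega>. norm (Y k \<omega>))"
      by (rule square_integrable_imp_integrable[OF _ int[OF that]]) measurable
    then show ?thesis by (rule Bochner_Integration.integrable_bound) auto
  qed
  have iB: "integrable M (B k)" if "k \<le> n" for k
    unfolding B_def using that by (intro Bochner_Integration.integrable_sum iY) auto
  have B: "random_variable borel (B k)" if "k \<le> n" for k
    using iB[OF that] by auto
  \<comment> \<open>The conditional mean of the next norm when the walk stands at \<open>x\<close>;
    \<open>p k x - norm x\<close> is the increment of the compensator.\<close>
  define p where "p k x = expectation (\<lambda>\<omega>'. norm (x + Y k \<omega>'))" for k x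
  have p[measurable]: "p k \<in> borel_measurable borel" if "k < n" for k
    unfolding p_def using that by (intro lipschitz_1_expectation[OF lip] Y int) auto
  have p_ge: "norm x \<le> p k x" if "k < n" for k x
    unfolding p_def using iY[OF that] mean[OF that]
    by (intro norm_le_expectation_norm_add)
  have p_nn: "ennreal (p k x) = (\<integral>\<^sup>+\<omega>'. ennreal (norm (x + Y k \<omega>')) \<partial>M)" if "k < n" for k x
    unfolding p_def by (rule nn_integral_eq_integral[symmetric]) (use iY[OF that] in auto)
  \<comment> \<open>Tower property: averaging the one-step mean over the past gives back the mean
    norm at the next index.\<close>
  have Ep: "(\<integral>\<^sup>+\<omega>. ennreal (p k (B k \<omega>)) \<partial>M) = ennreal (expectation (\<lambda>\<omega>. norm (B (Suc k) \<omega>)))" if k: "k < n" for k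
  proof -
    define F where "F z = ennreal (norm ((\<Sum>i<k. fst z i) + snd z))" for z :: "(nat \<Rightarrow> 'b) \<times> 'b"
    have F: "F \<in> borel_measurable (PiM {..<k} (\<lambda>_. borel) \<Otimes>\<^sub>M borel)"
      unfolding F_def by measurable
    have "(\<integral>\<^sup>+\<omega>. ennreal (p k (B k \<omega>)) \<partial>M) = (\<integral>\<^sup>+\<omega>. \<integral>\<^sup>+\<omega>'. F (\<lambda>i\<in>{..<k}. Y i \<omega>, Y k \<omega>') \<partial>M \<partial>M)"
      unfolding p_nn[OF k] F_def B_def by simp
    also have "\<dots> = (\<integral>\<^sup>+\<omega>. F (\<lambda>i\<in>{..<k}. Y i \<omega>, Y k \<omega>) \<partial>M)"
      by (rule nn_integral_indep_past(2)[OF ind k F, symmetric])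
    also have "\<dots> = (\<integral>\<^sup>+\<omega>. ennreal (norm (B (Suc k) \<omega>)) \<partial>M)"
      unfolding F_def B_def by simp
    also have "\<dots> = ennreal (expectation (\<lambda>\<omega>. norm (B (Suc k) \<omega>)))"
      by (rule nn_integral_eq_integral) (use iB[of "Suc k"] k in auto)
    finally show ?thesis .
  qed
  define e where "e k = expectation (\<lambda>\<omega>. norm (B k \<omega>))" for k
  have e0: "0 \<le> e k" for k unfolding e_def by simp
  define D where "D \<omega> = (\<Sum>k<n. c k * (norm (B (Suc k) \<omega>) - p k (B k \<omega>)))" for \<omega>
  have D[measurable]: "random_variable borel D"
    unfolding D_def
    by (intro borel_measurable_sum borel_measurable_times borel_measurable_diff borel_measurable_const
        measurable_compose[OF B p] measurable_compose[OF B borel_measurable_norm]) auto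
  have diff: "(\<integral>\<^sup>+\<omega>. ennreal (p k (B k \<omega>) - norm (B k \<omega>)) \<partial>M) = ennreal (e (Suc k) - e k)"
    and e_mono: "e k \<le> e (Suc k)" if k: "k < n" for k
  proof -
    have [measurable]: "(\<lambda>\<omega>. p k (B k \<omega>)) \<in> borel_measurable M" "random_variable borel (B k)"
      using k by (auto intro!: measurable_compose[OF B p] B)
    have n: "(\<integral>\<^sup>+\<omega>. ennreal (norm (B k \<omega>)) \<partial>M) = ennreal (e k)"
      unfolding e_def by (rule nn_integral_eq_integral) (use iB[of k] k in auto)
    have "(\<integral>\<^sup>+\<omega>. ennreal (norm (B k \<omega>)) \<partial>M) \<le> (\<integral>\<^sup>+\<omega>. ennreal (p k (B k \<omega>)) \<partial>M)"
      by (intro nn_integral_mono ennreal_leI p_ge k)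
    then show "e k \<le> e (Suc k)" using Ep[OF k] n e0 by (simp add: e_def)
    have "(\<integral>\<^sup>+\<omega>. ennreal (p k (B k \<omega>) - norm (B k \<omega>)) \<partial>M)
        = (\<integral>\<^sup>+\<omega>. ennreal (p k (B k \<omega>)) - ennreal (norm (B k \<omega>)) \<partial>M)"
      by (simp add: ennreal_minus)
    also have "\<dots> = (\<integral>\<^sup>+\<omega>. ennreal (p k (B k \<omega>)) \<partial>M) - (\<integral>\<^sup>+\<omega>. ennreal (norm (B k \<omega>)) \<partial>M)"
      by (rule nn_integral_diff) (auto simp: n intro!: ennreal_leI p_ge k)
    finally show "(\<integral>\<^sup>+\<omega>. ennreal (p k (B k \<omega>) - norm (B k \<omega>)) \<partial>M) = ennreal (e (Suc k) - e k)"
      using Ep[OF k] n e0 by (simp add: e_def ennreal_minus)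
  qed
  have "(\<integral>\<^sup>+\<omega>. ennreal \<bar>\<Sum>k<n. c k * (norm (B (Suc k) \<omega>) - norm (B k \<omega>))\<bar> \<partial>M)
     \<le> (\<integral>\<^sup>+\<omega>. ennreal \<bar>D \<omega>\<bar> + (\<Sum>k<n. ennreal \<bar>c k\<bar> * ennreal (p k (B k \<omega>) - norm (B k \<omega>))) \<partial>M)"
  proof (rule nn_integral_mono)
    fix \<omega>
    have "\<bar>\<Sum>k<n. c k * (norm (B (Suc k) \<omega>) - norm (B k \<omega>))\<bar>
        = \<bar>D \<omega> + (\<Sum>k<n. c k * (p k (B k \<omega>) - norm (B k \<omega>)))\<bar>"
      unfolding D_def sum.distrib[symmetric] by (simp add: algebra_simps)
    also have "\<dots> \<le> \<bar>D \<omega>\<bar> + (\<Sum>k<n. \<bar>c k * (p k (B k \<omega>) - norm (B k \<omega>))\<bar>)"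
      by (rule order_trans[OF abs_triangle_ineq]) (simp add: sum_abs)
    also have "\<dots> = \<bar>D \<omega>\<bar> + (\<Sum>k<n. \<bar>c k\<bar> * (p k (B k \<omega>) - norm (B k \<omega>)))"
      using p_ge by (simp add: abs_mult)
    finally have "ennreal \<bar>\<Sum>k<n. c k * (norm (B (Suc k) \<omega>) - norm (B k \<omega>))\<bar>
      \<le> ennreal (\<bar>D \<omega>\<bar> + (\<Sum>k<n. \<bar>c k\<bar> * (p k (B k \<omega>) - norm (B k \<omega>))))"
      by (rule ennreal_leI)
    also have "\<dots> = ennreal \<bar>D \<omega>\<bar> + (\<Sum>k<n. ennreal \<bar>c k\<bar> * ennreal (p k (B k \<omega>) - norm (B k \<omega>)))"
    proof -
      have "(\<Sum>k<n. ennreal \<bar>c k\<bar> * ennreal (p k (B k \<omega>) - norm (B k \<omega>)))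
          = (\<Sum>k<n. ennreal (\<bar>c k\<bar> * (p k (B k \<omega>) - norm (B k \<omega>))))"
        by (simp only: ennreal_mult'' ennreal_mult' abs_ge_zero)
      also have "\<dots> = ennreal (\<Sum>k<n. \<bar>c k\<bar> * (p k (B k \<omega>) - norm (B k \<omega>)))"
        using p_ge by (intro sum_ennreal) auto
      finally show ?thesis
        using p_ge by (subst ennreal_plus) (auto intro!: sum_nonneg)
    qed
    finally show "ennreal \<bar>\<Sum>k<n. c k * (norm (B (Suc k) \<omega>) - norm (B k \<omega>))\<bar> \<le> \<dots>" .
  qed
  also have "\<dots> = (\<integral>\<^sup>+\<omega>. ennreal \<bar>D \<omega>\<bar> \<partial>M) + (\<Sum>k<n. ennreal \<bar>c k\<bar> * ennreal (e (Suc k) - e k))"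
  proof -
    have [measurable]: "(\<lambda>\<omega>. p k (B k \<omega>)) \<in> borel_measurable M" "random_variable borel (B k)" if "k < n" for k
      using that by (auto intro!: measurable_compose[OF B p] B)
    have "(\<integral>\<^sup>+\<omega>. (\<Sum>k<n. ennreal \<bar>c k\<bar> * ennreal (p k (B k \<omega>) - norm (B k \<omega>))) \<partial>M)
        = (\<Sum>k<n. ennreal \<bar>c k\<bar> * ennreal (e (Suc k) - e k))"
      by (subst nn_integral_sum) (auto simp: nn_integral_cmult diff)
    then show ?thesis by (subst nn_integral_add) auto
  qed
  also have "(\<Sum>k<n. ennreal \<bar>c k\<bar> * ennreal (e (Suc k) - e k)) = ennreal (\<Sum>k<n. \<bar>c k\<bar> * (e (Suc k) - e k))"
    unfolding ennreal_mult'[OF abs_ge_zero, symmetric] using e_mono by (intro sum_ennreal) auto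
  also have "(\<integral>\<^sup>+\<omega>. ennreal \<bar>D \<omega>\<bar> \<partial>M) \<le> ennreal d + ennreal (1 / d) * (\<integral>\<^sup>+\<omega>. ennreal ((D \<omega>)\<^sup>2) \<partial>M)"
    by (rule nn_integral_abs_le_square[OF D d])
  also have "(\<integral>\<^sup>+\<omega>. ennreal ((D \<omega>)\<^sup>2) \<partial>M) \<le> ennreal (\<Sum>k<n. (c k)\<^sup>2 * expectation (\<lambda>\<omega>. (norm (Y k \<omega>))\<^sup>2))"
    unfolding D_def B_def p_def
    by (rule martingale_transform_square_le[OF ind lip int order_refl])
  finally show ?thesis unfolding e_def by (simp add: mult_left_mono add_mono)
qed

text \<open>Intersections of rectangles are rectangles, and the product measure factorises on them,
  so independence holds on a generating pi-system. Applied twice, this passes from one to three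
  dimensions.\<close>

lemma indep_vars_pair_measure:
  fixes X :: "'i \<Rightarrow> 'a \<Rightarrow> 'c" and Y :: "'i \<Rightarrow> 'b \<Rightarrow> 'd"
  assumes M: "prob_space M" and M': "prob_space M'"
    and X: "prob_space.indep_vars M (\<lambda>_. N) X I" and Y: "prob_space.indep_vars M' (\<lambda>_. N') Y I"
  shows "prob_space.indep_vars (M \<Otimes>\<^sub>M M') (\<lambda>_. N \<Otimes>\<^sub>M N') (\<lambda>i z. (X i (fst z), Y i (snd z))) I"
proof -
  interpret M: prob_space M by fact
  interpret M': prob_space M' by fact
  interpret pair_prob_space M M' ..
  have Xm[measurable]: "X i \<in> measurable M N" if "i \<in> I" for i
    using X that by (auto simp: M.indep_vars_def2)
  have Ym[measurable]: "Y i \<in> measurable M' N'" if "i \<in> I" for i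
    using Y that by (auto simp: M'.indep_vars_def2)
  have Xi: "M.indep_sets (\<lambda>i. { X i -` A \<inter> space M | A. A \<in> sets N}) I"
    using X by (auto simp: M.indep_vars_def2)
  have Yi: "M'.indep_sets (\<lambda>i. { Y i -` A \<inter> space M' | A. A \<in> sets N'}) I"
    using Y by (auto simp: M'.indep_vars_def2)
  define G where "G i = {(X i -` A \<inter> space M) \<times> (Y i -` B \<inter> space M') | A B. A \<in> sets N \<and> B \<in> sets N'}" for i
  have GI: "(X i -` A \<inter> space M) \<times> (Y i -` B \<inter> space M') \<in> G i" if "A \<in> sets N" "B \<in> sets N'" for A B i
    using that unfolding G_def by blast
  have Gsub: "G i \<subseteq> Pow (space (M \<Otimes>\<^sub>M M'))" for i
    by (auto simp: G_def space_pair_measure)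
  have G: "indep_sets G I"
  proof (rule indep_setsI)
    show "G i \<subseteq> events" if "i \<in> I" for i
      using that by (auto simp: G_def)
    fix A J assume J: "J \<noteq> {}" "J \<subseteq> I" "finite J" and A: "\<forall>j\<in>J. A j \<in> G j"
    have "\<forall>j\<in>J. \<exists>a b. a \<in> sets N \<and> b \<in> sets N' \<and> A j = (X j -` a \<inter> space M) \<times> (Y j -` b \<inter> space M')"
    proof
      fix j assume "j \<in> J"
      with A have "A j \<in> G j" by blast
      then show "\<exists>a b. a \<in> sets N \<and> b \<in> sets N' \<and> A j = (X j -` a \<inter> space M) \<times> (Y j -` b \<inter> space M')"
        unfolding G_def by blast
    qed
    then obtain a b where ab: "\<And>j. j \<in> J \<Longrightarrow> a j \<in> sets N" "\<And>j. j \<in> J \<Longrightarrow> b j \<in> sets N'"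
      "\<And>j. j \<in> J \<Longrightarrow> A j = (X j -` a j \<inter> space M) \<times> (Y j -` b j \<inter> space M')"
      by metis
    let ?U = "\<lambda>j. X j -` a j \<inter> space M" and ?V = "\<lambda>j. Y j -` b j \<inter> space M'"
    have U: "?U j \<in> sets M" and V: "?V j \<in> sets M'" if "j \<in> J" for j
      using that ab J by (auto intro!: measurable_sets)
    have times: "measure (M \<Otimes>\<^sub>M M') (S \<times> T) = measure M S * measure M' T" if "S \<in> sets M" "T \<in> sets M'" for S T
      using that by (simp add: measure_def M'.emeasure_pair_measure_Times enn2real_mult)
    have "(\<Inter>j\<in>J. A j) = (\<Inter>j\<in>J. ?U j) \<times> (\<Inter>j\<in>J. ?V j)"
      using J ab(3) by auto
    then have "measure (M \<Otimes>\<^sub>M M') (\<Inter>j\<in>J. A j) = measure M (\<Inter>j\<in>J. ?U j) * measure M' (\<Inter>j\<in>J. ?V j)"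
      using times[OF sets.finite_INT[OF J(3,1) U] sets.finite_INT[OF J(3,1) V]] by (simp only:)
    also have "measure M (\<Inter>j\<in>J. ?U j) = (\<Prod>j\<in>J. measure M (?U j))"
      using J ab by (intro M.indep_setsD[OF Xi]) auto
    also have "measure M' (\<Inter>j\<in>J. ?V j) = (\<Prod>j\<in>J. measure M' (?V j))"
      using J ab by (intro M'.indep_setsD[OF Yi]) auto
    also have "(\<Prod>j\<in>J. measure M (?U j)) * (\<Prod>j\<in>J. measure M' (?V j)) = (\<Prod>j\<in>J. measure (M \<Otimes>\<^sub>M M') (A j))"
      using U V ab(3) by (simp add: prod.distrib times)
    finally show "prob (\<Inter>j\<in>J. A j) = (\<Prod>j\<in>J. prob (A j))" .
  qed
  have "indep_sets (\<lambda>i. sigma_sets (space (M \<Otimes>\<^sub>M M')) (G i)) I"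
  proof (rule indep_sets_sigma[OF G])
    show "Int_stable (G i)" for i
    proof (rule Int_stableI)
      fix S T assume "S \<in> G i" "T \<in> G i"
      then obtain a b a' b' where "a \<in> sets N" "b \<in> sets N'" "a' \<in> sets N" "b' \<in> sets N'"
        and *: "S = (X i -` a \<inter> space M) \<times> (Y i -` b \<inter> space M')" "T = (X i -` a' \<inter> space M) \<times> (Y i -` b' \<inter> space M')"
        by (auto simp: G_def)
      then have "(X i -` (a \<inter> a') \<inter> space M) \<times> (Y i -` (b \<inter> b') \<inter> space M') \<in> G i"
        by (intro GI) auto
      also have "(X i -` (a \<inter> a') \<inter> space M) \<times> (Y i -` (b \<inter> b') \<inter> space M') = S \<inter> T"
        by (auto simp: *)
      finally show "S \<inter> T \<in> G i" .
    qed
  qed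
  then have "indep_sets (\<lambda>i. {(\<lambda>z. (X i (fst z), Y i (snd z))) -` A \<inter> space (M \<Otimes>\<^sub>M M') | A. A \<in> sets (N \<Otimes>\<^sub>M N')}) I"
  proof (rule indep_sets_mono_sets)
    fix i assume i: "i \<in> I"
    let ?S = "sigma (space (M \<Otimes>\<^sub>M M')) (G i)"
    have spS: "space ?S = space M \<times> space M'" and seS: "sets ?S = sigma_sets (space (M \<Otimes>\<^sub>M M')) (G i)"
      using Gsub[of i] by (auto simp: space_pair_measure space_measure_of)
    have "(\<lambda>z. X i (fst z)) \<in> measurable ?S N"
    proof (rule measurableI)
      fix A assume A: "A \<in> sets N"
      \<comment> \<open>Writing the free side as the preimage of the whole of \<open>N'\<close>
        displays this one-coordinate preimage as a member of \<open>G i\<close>.\<close>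
      have "(\<lambda>z. X i (fst z)) -` A \<inter> space ?S = (X i -` A \<inter> space M) \<times> (Y i -` space N' \<inter> space M')"
        using measurable_space[OF Ym[OF i]] by (auto simp: spS)
      then show "(\<lambda>z. X i (fst z)) -` A \<inter> space ?S \<in> sets ?S"
        using GI[OF A sets.top, of i] by (simp add: seS)
    qed (use measurable_space[OF Xm[OF i]] in \<open>auto simp: spS\<close>)
    moreover have "(\<lambda>z. Y i (snd z)) \<in> measurable ?S N'"
    proof (rule measurableI)
      fix A assume A: "A \<in> sets N'"
      have "(\<lambda>z. Y i (snd z)) -` A \<inter> space ?S = (X i -` space N \<inter> space M) \<times> (Y i -` A \<inter> space M')"
        using measurable_space[OF Xm[OF i]] by (auto simp: spS)
      then show "(\<lambda>z. Y i (snd z)) -` A \<inter> space ?S \<in> sets ?S"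
        using GI[OF sets.top A, of i] by (simp add: seS)
    qed (use measurable_space[OF Ym[OF i]] in \<open>auto simp: spS\<close>)
    ultimately have "(\<lambda>z. (X i (fst z), Y i (snd z))) \<in> measurable ?S (N \<Otimes>\<^sub>M N')"
      by (rule measurable_Pair)
    from measurable_sets[OF this, unfolded spS seS]
    show "{(\<lambda>z. (X i (fst z), Y i (snd z))) -` A \<inter> space (M \<Otimes>\<^sub>M M') | A. A \<in> sets (N \<Otimes>\<^sub>M N')}
      \<subseteq> sigma_sets (space (M \<Otimes>\<^sub>M M')) (G i)"
      by (auto simp: space_pair_measure)
  qed
  then show ?thesis
    unfolding indep_vars_def2 by auto
qed

section \<open>Increments of Wiener measure and of three-dimensional Brownian motion\<close>

lemma coordinate_measurable[measurable (raw)]: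
  "t \<in> I \<Longrightarrow> (\<lambda>w. w t) \<in> borel_measurable (path_space I)"
  unfolding path_space_def by (intro measurable_restrict_space1 measurable_component_singleton)

abbreviation std_normal :: "real measure" where
  "std_normal \<equiv> density lborel std_normal_density"

lemma prob_space_std_normal: "prob_space std_normal"
  by (intro prob_space_normal_density) simp

context
  fixes P :: "(real \<Rightarrow> real) measure"
  assumes P: "wiener_measure P"
begin

lemma wiener_prob_space: "prob_space P"
  and wiener_sets[measurable_cong]: "sets P = sets \<Omega>"
  and wiener_start: "AE w in P. w 0 = 0"
  and wiener_increment: "0 \<le> s \<Longrightarrow> s < t \<Longrightarrow>
    distributed P lborel (\<lambda>w. w t - w s) (normal_density 0 (sqrt (t - s)))"
  and wiener_indep: "0 \<le> q 0 \<Longrightarrow> (\<And>k. k < n \<Longrightarrow> q k < q (Suc k)) \<Longrightarrow>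
    prob_space.indep_vars P (\<lambda>_. borel) (\<lambda>k w. w (q (Suc k)) - w (q k)) {..<n}"
  using P unfolding wiener_measure_def by auto

interpretation prob_space P by (rule wiener_prob_space)

lemma wiener_coordinate_measurable[measurable (raw)]: "0 \<le> t \<Longrightarrow> (\<lambda>w. w t) \<in> borel_measurable P"
  by measurable

text \<open>Brownian scaling: all dependence on \<open>s\<close> and \<open>t\<close> moves into the
  factor \<open>sqrt (t - s)\<close>, so that later moments are fixed constants times powers of
  \<open>t - s\<close>.\<close>

lemma wiener_increment_nn_integral:
  assumes s: "0 \<le> s" "s < t" and [measurable]: "F \<in> borel_measurable borel"
  shows "(\<integral>\<^sup>+w. F (w t - w s) \<partial>P) = (\<integral>\<^sup>+x. F (sqrt (t - s) * x) \<partial>std_normal)"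
proof -
  let ?X = "\<lambda>w. (w t - w s) / sqrt (t - s)"
  have "distributed P lborel ?X std_normal_density"
    using wiener_increment[OF s] normal_standard_normal_convert[of "sqrt (t - s)" "\<lambda>w. w t - w s" 0] s
    by simp
  from distributed_nn_integral[OF this, of "\<lambda>x. F (sqrt (t - s) * x)"] s
  show ?thesis
    by (simp add: nn_integral_density mult.commute)
qed

lemma wiener_increment_moments:
  assumes s: "0 \<le> s" "s < t"
  shows "integrable P (\<lambda>w. (w t - w s)\<^sup>2)" "expectation (\<lambda>w. (w t - w s)\<^sup>2) = t - s"
    "integrable P (\<lambda>w. w t - w s)" "expectation (\<lambda>w. w t - w s) = 0"
proof -
  have pos: "0 < sqrt (t - s)" using s by simp
  have [measurable]: "(\<lambda>w. w t - w s) \<in> borel_measurable P"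
    using s by (intro borel_measurable_diff wiener_coordinate_measurable) auto
  note D = wiener_increment[OF s]
  have "integrable lborel (\<lambda>x. normal_density 0 (sqrt (t - s)) x * x\<^sup>2)"
    using integrable_normal_moment[OF pos, of 0 2] by simp
  then show i2: "integrable P (\<lambda>w. (w t - w s)\<^sup>2)"
    using distributed_integrable[OF D, of "\<lambda>x. x\<^sup>2"] by simp
  show i1: "integrable P (\<lambda>w. w t - w s)"
    by (rule square_integrable_imp_integrable[OF _ i2]) simp
  show e: "expectation (\<lambda>w. w t - w s) = 0"
    by (rule normal_distributed_expectation[OF pos D])
  show "expectation (\<lambda>w. (w t - w s)\<^sup>2) = t - s"
    using normal_distributed_variance[OF pos D] s unfolding e by simp
qed

text \<open>The bounded half of the Ito isometry: with \<open>\<phi>\<close> the identity, the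
  conditional mean of the next value is the current one, and the transform is the Wiener sum
  itself.\<close>

lemma wiener_step_sum_square_le:
  fixes q c :: "nat \<Rightarrow> real"
  assumes q: "0 \<le> q 0" "\<And>k. k < n \<Longrightarrow> q k < q (Suc k)"
  shows "(\<integral>\<^sup>+w. ennreal ((\<Sum>k<n. c k * (w (q (Suc k)) - w (q k)))\<^sup>2) \<partial>P)
    \<le> ennreal (\<Sum>k<n. (c k)\<^sup>2 * (q (Suc k) - q k))"
proof -
  have q0: "0 \<le> q k" if "k \<le> n" for k
    using that
  proof (induction k)
    case (Suc k)
    then show ?case using q(2)[of k] by simp
  qed (use q in simp)
  define Y where "Y k w = w (q (Suc k)) - w (q k)" for k and w :: "real \<Rightarrow> real"
  note m = wiener_increment_moments[OF q0 q(2), folded Y_def]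
  have ind: "indep_vars (\<lambda>_. borel) Y {..<n}"
    unfolding Y_def[abs_def] by (rule wiener_indep[OF q])
  have "expectation (\<lambda>w'. x + Y k w') = x" if "k < n" for x k
    using m(3,4)[of k] that by (simp add: prob_space)
  then have "(\<Sum>k<n. c k * Y k w) = (\<Sum>k<n. c k * ((\<Sum>i<Suc k. Y i w)
      - expectation (\<lambda>w'. (\<Sum>i<k. Y i w) + Y k w')))" for w
    by (intro sum.cong) auto
  then have "(\<integral>\<^sup>+w. ennreal ((\<Sum>k<n. c k * Y k w)\<^sup>2) \<partial>P) =
    (\<integral>\<^sup>+w. ennreal ((\<Sum>k<n. c k * ((\<Sum>i<Suc k. Y i w)
      - expectation (\<lambda>w'. (\<Sum>i<k. Y i w) + Y k w')))\<^sup>2) \<partial>P)" by simp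
  also have "\<dots> \<le> ennreal (\<Sum>k<n. (c k)\<^sup>2 * expectation (\<lambda>\<omega>. (norm (Y k \<omega>))\<^sup>2))"
    by (rule martingale_transform_square_le[OF ind, where \<phi> = "\<lambda>x. x"]) (use m(1) in auto)
  also have "(\<Sum>k<n. (c k)\<^sup>2 * expectation (\<lambda>\<omega>. (norm (Y k \<omega>))\<^sup>2)) = (\<Sum>k<n. (c k)\<^sup>2 * (q (Suc k) - q k))"
    using m(2) by (intro sum.cong) auto
  finally show ?thesis unfolding Y_def .
qed

end

lemma distr_pair_snd:
  assumes "prob_space M" "prob_space N"
  shows "distr (M \<Otimes>\<^sub>M N) N snd = N"
proof -
  interpret M: prob_space M by fact
  interpret N: prob_space N by fact
  show ?thesis
  proof (rule measure_eqI)
    fix A assume A: "A \<in> sets (distr (M \<Otimes>\<^sub>M N) N snd)"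
    then have "snd -` A \<inter> space (M \<Otimes>\<^sub>M N) = space M \<times> A"
      using sets.sets_into_space[of A N] by (auto simp: space_pair_measure)
    with A show "emeasure (distr (M \<Otimes>\<^sub>M N) N snd) A = emeasure N A"
      by (simp add: emeasure_distr N.emeasure_pair_measure_Times M.emeasure_space_1)
  qed simp
qed

abbreviation std_normal3 :: "(real \<times> real \<times> real) measure" where
  "std_normal3 \<equiv> std_normal \<Otimes>\<^sub>M (std_normal \<Otimes>\<^sub>M std_normal)"

text \<open>Mean norm and mean squared norm of a standard Gaussian vector in three dimensions, that
  is \<open>2 * sqrt (2 / pi)\<close> and 3. They stay symbolic; \<open>enn2real\<close> fits the
  Bochner integral of a nonnegative function, which is the \<open>enn2real\<close> of its
  \<open>nn_integral\<close>.\<close>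

definition "normal3_mean = enn2real (\<integral>\<^sup>+x. ennreal (norm x) \<partial>std_normal3)"
definition "normal3_second_moment = enn2real (\<integral>\<^sup>+x. ennreal ((norm x)\<^sup>2) \<partial>std_normal3)"

abbreviation wiener3 :: "(real \<Rightarrow> real) measure \<Rightarrow> ((real \<Rightarrow> real) \<times> (real \<Rightarrow> real) \<times> (real \<Rightarrow> real)) measure" where
  "wiener3 P \<equiv> P \<Otimes>\<^sub>M (P \<Otimes>\<^sub>M P)"

text \<open>Reading the triple as one path in a Euclidean space makes the Bessel process
  \<open>norm (path3 z t)\<close>, to which the Lipschitz estimates with
  \<open>\<phi> = norm\<close> apply.\<close>

definition path3 :: "(real \<Rightarrow> real) \<times> (real \<Rightarrow> real) \<times> (real \<Rightarrow> real) \<Rightarrow> real \<Rightarrow> real \<times> real \<times> real" where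
  "path3 z t = (fst z t, fst (snd z) t, snd (snd z) t)"

lemma norm_path3: "norm (path3 (a, b, c) t) = sqrt ((a t)\<^sup>2 + (b t)\<^sup>2 + (c t)\<^sup>2)"
  by (simp add: path3_def norm_Pair add.assoc)

context
  fixes P :: "(real \<Rightarrow> real) measure"
  assumes P: "wiener_measure P"
begin

interpretation P: prob_space P by (rule wiener_prob_space[OF P])
interpretation PP: pair_prob_space P P ..
interpretation P3: pair_prob_space P "P \<Otimes>\<^sub>M P" ..
interpretation N: prob_space std_normal by (rule prob_space_std_normal)
interpretation NN: pair_prob_space std_normal std_normal ..

lemma wiener3_prob_space: "prob_space (wiener3 P)"
  by (rule P3.P.prob_space_axioms)

lemma path3_measurable[measurable]:
  assumes "0 \<le> t" shows "(\<lambda>z. path3 z t) \<in> borel_measurable (wiener3 P)"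
proof -
  have [measurable]: "(\<lambda>w. w t) \<in> borel_measurable P" by (rule wiener_coordinate_measurable[OF P assms])
  show ?thesis unfolding path3_def by measurable
qed

text \<open>Tonelli separates the three coordinates; each one-dimensional increment is then
  exchanged for a scaled normal variable, from the innermost integral outwards.\<close>

lemma wiener3_increment_nn_integral:
  assumes s: "0 \<le> s" "s < t" and F[measurable]: "F \<in> borel_measurable borel"
  shows "(\<integral>\<^sup>+z. F (path3 z t - path3 z s) \<partial>wiener3 P) = (\<integral>\<^sup>+x. F (sqrt (t - s) *\<^sub>R x) \<partial>std_normal3)"
proof -
  have [measurable]: "(\<lambda>w. w t) \<in> borel_measurable P" "(\<lambda>w. w s) \<in> borel_measurable P"
    using s by (auto intro!: wiener_coordinate_measurable[OF P])
  let ?d = "\<lambda>w. w t - w s :: real" and ?r = "sqrt (t - s)"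
  note W = wiener_increment_nn_integral[OF P s]
  have [measurable]: "F \<in> borel_measurable (borel \<Otimes>\<^sub>M (borel \<Otimes>\<^sub>M borel))" by (simp add: borel_prod F)
  have "(\<integral>\<^sup>+z. F (path3 z t - path3 z s) \<partial>wiener3 P) = (\<integral>\<^sup>+z. F (?d (fst z), ?d (fst (snd z)), ?d (snd (snd z))) \<partial>wiener3 P)"
    by (simp add: path3_def)
  also have "\<dots> = (\<integral>\<^sup>+a. \<integral>\<^sup>+z. F (?d a, ?d (fst z), ?d (snd z)) \<partial>(P \<Otimes>\<^sub>M P) \<partial>P)"
    by (subst PP.P.nn_integral_fst[symmetric]) simp_all
  also have "\<dots> = (\<integral>\<^sup>+a. \<integral>\<^sup>+b. \<integral>\<^sup>+c. F (?d a, ?d b, ?d c) \<partial>P \<partial>P \<partial>P)"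
    by (subst P.nn_integral_fst[symmetric]) simp_all
  also have "\<dots> = (\<integral>\<^sup>+a. \<integral>\<^sup>+b. \<integral>\<^sup>+z. F (?d a, ?d b, ?r * z) \<partial>std_normal \<partial>P \<partial>P)"
    by (subst W) simp_all
  also have "\<dots> = (\<integral>\<^sup>+a. \<integral>\<^sup>+y. \<integral>\<^sup>+z. F (?d a, ?r * y, ?r * z) \<partial>std_normal \<partial>std_normal \<partial>P)"
    by (subst W[of "\<lambda>y. \<integral>\<^sup>+z. F (_, y, ?r * z) \<partial>std_normal"]) simp_all
  also have "\<dots> = (\<integral>\<^sup>+x. \<integral>\<^sup>+y. \<integral>\<^sup>+z. F (?r * x, ?r * y, ?r * z) \<partial>std_normal \<partial>std_normal \<partial>std_normal)"
    by (subst W[of "\<lambda>x. \<integral>\<^sup>+y. \<integral>\<^sup>+z. F (x, ?r * y, ?r * z) \<partial>std_normal \<partial>std_normal"]) simp_all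
  also have "\<dots> = (\<integral>\<^sup>+x. \<integral>\<^sup>+z. F (?r * x, ?r * fst z, ?r * snd z) \<partial>(std_normal \<Otimes>\<^sub>M std_normal) \<partial>std_normal)"
    by (subst N.nn_integral_fst[symmetric]) simp_all
  also have "\<dots> = (\<integral>\<^sup>+x. F (?r * fst x, ?r * fst (snd x), ?r * snd (snd x)) \<partial>std_normal3)"
    by (subst NN.P.nn_integral_fst[symmetric]) simp_all
  also have "\<dots> = (\<integral>\<^sup>+x. F (?r *\<^sub>R x) \<partial>std_normal3)"
    by (simp add: scaleR_prod_def)
  finally show ?thesis .
qed

text \<open>The coordinate projections preserve the probability measures, so each coordinate
  inherits the one-dimensional integral.\<close>

lemma wiener3_coordinate_integral:
  fixes g :: "(real \<Rightarrow> real) \<Rightarrow> real"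
  assumes g: "integrable P g"
  shows "integrable (wiener3 P) (\<lambda>z. g (fst z))" "integrable (wiener3 P) (\<lambda>z. g (fst (snd z)))"
    "integrable (wiener3 P) (\<lambda>z. g (snd (snd z)))"
    "(\<integral>z. g (fst z) \<partial>wiener3 P) = integral\<^sup>L P g" "(\<integral>z. g (fst (snd z)) \<partial>wiener3 P) = integral\<^sup>L P g"
    "(\<integral>z. g (snd (snd z)) \<partial>wiener3 P) = integral\<^sup>L P g"
proof -
  have [measurable]: "g \<in> borel_measurable P" using g by simp
  have d1: "distr (wiener3 P) P fst = P"
    by (rule PP.P.distr_pair_fst)
  have d2: "distr (wiener3 P) (P \<Otimes>\<^sub>M P) snd = P \<Otimes>\<^sub>M P"
    by (rule distr_pair_snd) unfold_locales
  have d3: "distr (P \<Otimes>\<^sub>M P) P fst = P"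
    by (rule P.distr_pair_fst)
  have d4: "distr (P \<Otimes>\<^sub>M P) P snd = P"
    by (rule distr_pair_snd) unfold_locales
  have *: "integrable M (\<lambda>z. h (f z))" "(\<integral>z. h (f z) \<partial>M) = integral\<^sup>L N h"
    if "distr M N f = N" "f \<in> measurable M N" "integrable N h" for M N f and h :: "_ \<Rightarrow> real"
    using integrable_distr[OF that(2), of h] integral_distr[OF that(2), of h] that by auto
  have f: "integrable (P \<Otimes>\<^sub>M P) (\<lambda>z. g (fst z))" "(\<integral>z. g (fst z) \<partial>(P \<Otimes>\<^sub>M P)) = integral\<^sup>L P g"
    "integrable (P \<Otimes>\<^sub>M P) (\<lambda>z. g (snd z))" "(\<integral>z. g (snd z) \<partial>(P \<Otimes>\<^sub>M P)) = integral\<^sup>L P g"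
    using *[OF d3 measurable_fst g] *[OF d4 measurable_snd g] by auto
  show "integrable (wiener3 P) (\<lambda>z. g (fst z))" "integrable (wiener3 P) (\<lambda>z. g (fst (snd z)))"
    "integrable (wiener3 P) (\<lambda>z. g (snd (snd z)))"
    "(\<integral>z. g (fst z) \<partial>wiener3 P) = integral\<^sup>L P g" "(\<integral>z. g (fst (snd z)) \<partial>wiener3 P) = integral\<^sup>L P g"
    "(\<integral>z. g (snd (snd z)) \<partial>wiener3 P) = integral\<^sup>L P g"
    using *[OF d1 measurable_fst g] *[OF d2 measurable_snd f(1)] *[OF d2 measurable_snd f(3)] f by auto
qed

lemma wiener3_increment_moments:
  assumes s: "0 \<le> s" "s < t"
  shows "integrable (wiener3 P) (\<lambda>z. (norm (path3 z t - path3 z s))\<^sup>2)"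
    "integrable (wiener3 P) (\<lambda>z. path3 z t - path3 z s)"
    "(\<integral>z. path3 z t - path3 z s \<partial>wiener3 P) = 0"
proof -
  note m = wiener_increment_moments[OF P s]
  note c = wiener3_coordinate_integral[OF m(1)] and c' = wiener3_coordinate_integral[OF m(3)]
  have eq: "(norm (path3 z t - path3 z s))\<^sup>2 = (fst z t - fst z s)\<^sup>2 + (fst (snd z) t - fst (snd z) s)\<^sup>2
    + (snd (snd z) t - snd (snd z) s)\<^sup>2" for z
    by (simp add: path3_def norm_Pair)
  show i2: "integrable (wiener3 P) (\<lambda>z. (norm (path3 z t - path3 z s))\<^sup>2)"
    unfolding eq using c by (intro Bochner_Integration.integrable_add)
  have [measurable]: "(\<lambda>z. path3 z t - path3 z s) \<in> borel_measurable (wiener3 P)"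
    using s by (intro borel_measurable_diff path3_measurable) auto
  have "integrable (wiener3 P) (\<lambda>z. norm (path3 z t - path3 z s))"
    by (rule P3.P.square_integrable_imp_integrable[OF _ i2]) measurable
  then show i: "integrable (wiener3 P) (\<lambda>z. path3 z t - path3 z s)"
    by (subst (asm) integrable_norm_iff) measurable
  let ?I = "\<integral>z. path3 z t - path3 z s \<partial>wiener3 P"
  have "fst ?I = 0" "fst (snd ?I) = 0" "snd (snd ?I) = 0"
    using c'(4-6) m(4) i
    by (simp_all only: integral_fst[symmetric] integral_snd[symmetric] integrable_snd)
       (simp_all add: path3_def)
  then show "?I = 0" by (simp add: prod_eq_iff)
qed

lemma wiener3_indep:
  assumes q: "0 \<le> q 0" "\<And>k. k < n \<Longrightarrow> q k < q (Suc k)"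
  shows "prob_space.indep_vars (wiener3 P) (\<lambda>_. borel) (\<lambda>k z. path3 z (q (Suc k)) - path3 z (q k)) {..<n}"
proof -
  note i = wiener_indep[OF P q]
  have "prob_space.indep_vars (P \<Otimes>\<^sub>M P) (\<lambda>_. borel \<Otimes>\<^sub>M borel)
      (\<lambda>k z. (fst z (q (Suc k)) - fst z (q k), snd z (q (Suc k)) - snd z (q k))) {..<n}"
    by (rule indep_vars_pair_measure[OF _ _ i i]) unfold_locales
  from indep_vars_pair_measure[OF P.prob_space_axioms PP.P.prob_space_axioms i this]
  show ?thesis by (simp add: borel_prod path3_def)
qed

lemma wiener3_expectation_norm:
  assumes s: "0 \<le> s" "s < t"
  shows "(\<integral>z. norm (path3 z t - path3 z s) \<partial>wiener3 P) = sqrt (t - s) * normal3_mean"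
    "(\<integral>z. (norm (path3 z t - path3 z s))\<^sup>2 \<partial>wiener3 P) = (t - s) * normal3_second_moment"
proof -
  note [measurable] = wiener3_increment_moments(2)[OF s, THEN borel_measurable_integrable]
  have sets: "sets std_normal3 = sets (borel :: (real \<times> real \<times> real) measure)"
    by (simp add: borel_prod[symmetric] cong: sets_pair_measure_cong)
  have [measurable]: "(\<lambda>x. ennreal (norm x)) \<in> borel_measurable std_normal3"
    "(\<lambda>x. ennreal ((norm x)\<^sup>2)) \<in> borel_measurable std_normal3"
    unfolding measurable_cong_sets[OF sets refl] by measurable
  have "(\<integral>\<^sup>+z. ennreal (norm (path3 z t - path3 z s)) \<partial>wiener3 P)
      = (\<integral>\<^sup>+x. ennreal (sqrt (t - s)) * ennreal (norm x) \<partial>std_normal3)"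
    using s by (subst wiener3_increment_nn_integral[OF s]) (auto simp: ennreal_mult)
  also have "\<dots> = ennreal (sqrt (t - s)) * (\<integral>\<^sup>+x. ennreal (norm x) \<partial>std_normal3)"
    by (rule nn_integral_cmult) measurable
  finally show "(\<integral>z. norm (path3 z t - path3 z s) \<partial>wiener3 P) = sqrt (t - s) * normal3_mean"
    using s by (subst integral_eq_nn_integral) (auto simp: enn2real_mult normal3_mean_def)
  have "(\<integral>\<^sup>+z. ennreal ((norm (path3 z t - path3 z s))\<^sup>2) \<partial>wiener3 P)
      = (\<integral>\<^sup>+x. ennreal (t - s) * ennreal ((norm x)\<^sup>2) \<partial>std_normal3)"
    using s by (subst wiener3_increment_nn_integral[OF s, where F = "\<lambda>x. ennreal ((norm x)\<^sup>2)"])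
      (auto simp: power_mult_distrib ennreal_mult)
  also have "\<dots> = ennreal (t - s) * (\<integral>\<^sup>+x. ennreal ((norm x)\<^sup>2) \<partial>std_normal3)"
    by (rule nn_integral_cmult) measurable
  finally show "(\<integral>z. (norm (path3 z t - path3 z s))\<^sup>2 \<partial>wiener3 P) = (t - s) * normal3_second_moment"
    using s by (subst integral_eq_nn_integral) (auto simp: enn2real_mult normal3_second_moment_def)
qed

lemma path3_start: "AE z in wiener3 P. path3 z 0 = 0"
proof -
  note [measurable] = wiener_coordinate_measurable[OF P order_refl]
  note w = wiener_start[OF P]
  have "AE z in P \<Otimes>\<^sub>M P. fst z 0 = 0 \<and> snd z 0 = 0"
    by (rule PP.AE_pair_measure) (use w in auto)
  then have "AE z in wiener3 P. fst z 0 = 0 \<and> fst (snd z) 0 = 0 \<and> snd (snd z) 0 = 0"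
    by (intro P3.AE_pair_measure) (use w in auto)
  then show ?thesis by eventually_elim (simp add: path3_def prod_eq_iff)
qed

text \<open>By scaling, the mean norm at time \<open>t\<close> is \<open>sqrt t\<close> times
  \<open>normal3_mean\<close>; so the compensator contributes increments of the square root. This is
  the source of the kernel \<open>1 / (2 * sqrt (r - u))\<close>.\<close>

lemma path3_step_sum_le:
  fixes q c :: "nat \<Rightarrow> real"
  assumes q0: "q 0 = 0" and q: "\<And>k. k < n \<Longrightarrow> q k < q (Suc k)" and d: "0 < d"
  shows "(\<integral>\<^sup>+z. ennreal \<bar>\<Sum>k<n. c k * (norm (path3 z (q (Suc k))) - norm (path3 z (q k)))\<bar> \<partial>wiener3 P)
    \<le> ennreal d + ennreal (1 / d) * ennreal (normal3_second_moment * (\<Sum>k<n. (c k)\<^sup>2 * (q (Suc k) - q k)))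
      + ennreal (normal3_mean * (\<Sum>k<n. \<bar>c k\<bar> * (sqrt (q (Suc k)) - sqrt (q k))))"
proof -
  have qpos: "0 < q k" if "k \<le> n" "k \<noteq> 0" for k
    using that
  proof (induction k)
    case (Suc k)
    then show ?case using q[of k] q0 by (cases "k = 0") auto
  qed simp
  then have qn: "0 \<le> q k" if "k \<le> n" for k
    using q0 that by (cases "k = 0") (auto intro: less_imp_le)
  define Y where "Y k z = path3 z (q (Suc k)) - path3 z (q k)" for k z
  define B where "B k z = (\<Sum>i<k. Y i z)" for k z
  \<comment> \<open>The start is subtracted because \<open>path3 z 0\<close> vanishes only almost
    surely; the passage to \<open>B\<close> under the integral is therefore a congruence almost
    everywhere.\<close>
  have B: "B k z = path3 z (q k) - path3 z 0" for k z
    unfolding B_def Y_def using sum_lessThan_telescope[of "\<lambda>k. path3 z (q k)" k] q0 by simp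
  have ind: "P3.indep_vars (\<lambda>_. borel) Y {..<n}"
    unfolding Y_def[abs_def] using q0 q by (intro wiener3_indep) auto
  have mY: "integrable (wiener3 P) (\<lambda>z. (norm (Y k z))\<^sup>2)" "integral\<^sup>L (wiener3 P) (Y k) = 0"
    "(\<integral>z. (norm (Y k z))\<^sup>2 \<partial>wiener3 P) = (q (Suc k) - q k) * normal3_second_moment" if "k < n" for k
    using wiener3_increment_moments[of "q k" "q (Suc k)"] wiener3_expectation_norm[of "q k" "q (Suc k)"]
      qn[of k] q[of k] that by (auto simp: Y_def[abs_def])
  have EB: "(\<integral>z. norm (B k z) \<partial>wiener3 P) = sqrt (q k) * normal3_mean" if "k \<le> n" for k
    using wiener3_expectation_norm(1)[of 0 "q k"] qpos[of k] that q0 by (cases "k = 0") (auto simp: B)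
  have "(\<integral>\<^sup>+z. ennreal \<bar>\<Sum>k<n. c k * (norm (path3 z (q (Suc k))) - norm (path3 z (q k)))\<bar> \<partial>wiener3 P)
    = (\<integral>\<^sup>+z. ennreal \<bar>\<Sum>k<n. c k * (norm (B (Suc k) z) - norm (B k z))\<bar> \<partial>wiener3 P)"
    using path3_start by (intro nn_integral_cong_AE) (auto simp: B elim!: eventually_mono)
  also have "\<dots> \<le> ennreal d + ennreal (1 / d) * ennreal (\<Sum>k<n. (c k)\<^sup>2 * (\<integral>z. (norm (Y k z))\<^sup>2 \<partial>wiener3 P))
      + ennreal (\<Sum>k<n. \<bar>c k\<bar> * ((\<integral>z. norm (B (Suc k) z) \<partial>wiener3 P) - (\<integral>z. norm (B k z) \<partial>wiener3 P)))"
    unfolding B_def by (rule P3.expectation_abs_norm_increments_le[OF ind mY(1,2) d])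
  also have "(\<Sum>k<n. (c k)\<^sup>2 * (\<integral>z. (norm (Y k z))\<^sup>2 \<partial>wiener3 P)) = normal3_second_moment * (\<Sum>k<n. (c k)\<^sup>2 * (q (Suc k) - q k))"
    unfolding sum_distrib_left by (intro sum.cong) (auto simp: mY)
  also have "(\<Sum>k<n. \<bar>c k\<bar> * ((\<integral>z. norm (B (Suc k) z) \<partial>wiener3 P) - (\<integral>z. norm (B k z) \<partial>wiener3 P)))
     = normal3_mean * (\<Sum>k<n. \<bar>c k\<bar> * (sqrt (q (Suc k)) - sqrt (q k)))"
    unfolding sum_distrib_left by (intro sum.cong) (auto simp: EB algebra_simps)
  finally show ?thesis .
qed

end

section \<open>Step functions along a common partition\<close>

definition partition_pts :: "nat \<Rightarrow> (nat \<Rightarrow> real) \<Rightarrow> bool" where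
  "partition_pts n q \<longleftrightarrow> q 0 = 0 \<and> (\<forall>k<n. q k < q (Suc k))"

lemma partition_pts_mono:
  assumes q: "partition_pts n q" and "i \<le> k" "k \<le> n"
  shows "q i \<le> q k"
  using assms(2,3)
proof (induction k rule: dec_induct)
  case (step m)
  then have "q i \<le> q m" "q m < q (Suc m)" using q by (auto simp: partition_pts_def)
  then show ?case by simp
qed simp

lemma partition_pts_nonneg:
  assumes q: "partition_pts n q" and "k \<le> n"
  shows "0 \<le> q k"
  using partition_pts_mono[OF q, of 0 k] assms by (simp add: partition_pts_def)

lemma partition_pts_cell:
  assumes q: "partition_pts n q" and s: "0 \<le> s" "s < q n"
  shows "\<exists>i<n. q i \<le> s \<and> s < q (Suc i)"
proof -
  define k where "k = (LEAST k. s < q k)"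
  have k: "s < q k" unfolding k_def using s(2) by (rule LeastI)
  have kn: "k \<le> n" unfolding k_def using s(2) by (rule Least_le)
  have "q 0 = 0" using q by (simp add: partition_pts_def)
  with k s(1) have "k \<noteq> 0" by (metis not_less)
  then obtain i where i: "k = Suc i" by (cases k) auto
  then have "\<not> s < q i" unfolding k_def by (metis not_less_Least lessI)
  with i k kn show ?thesis by (intro exI[of _ i]) auto
qed

lemma partition_pts_indicator:
  assumes q: "partition_pts n q" and i: "i < n" "q i \<le> s" "s < q (Suc i)" and k: "k < n"
  shows "(indicator {q k..<q (Suc k)} s :: 'a::semiring_1) = of_bool (k = i)"
proof -
  consider "k < i" | "k = i" | "i < k" by linarith
  then show ?thesis
  proof cases
    case 1
    then have "q (Suc k) \<le> s" using partition_pts_mono[OF q, of "Suc k" i] i by simp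
    with 1 show ?thesis by simp
  next
    case 3
    then have "s < q k" using partition_pts_mono[OF q, of "Suc i" k] i k by simp
    with 3 show ?thesis by simp
  qed (use i in simp)
qed

lemma partition_pts_sum:
  fixes a :: "nat \<Rightarrow> 'a::semiring_1"
  assumes q: "partition_pts n q" and i: "i < n" "q i \<le> s" "s < q (Suc i)"
  shows "(\<Sum>k<n. a k * indicator {q k..<q (Suc k)} s) = a i"
proof -
  have "(\<Sum>k<n. a k * indicator {q k..<q (Suc k)} s) = (\<Sum>k<n. if k = i then a k else 0)"
    by (intro sum.cong refl) (simp add: partition_pts_indicator[OF q i])
  then show ?thesis using i by simp
qed

lemma partition_pts_sum_outside:
  fixes a :: "nat \<Rightarrow> 'a::semiring_1"
  assumes q: "partition_pts n q" and s: "q n \<le> s"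
  shows "(\<Sum>k<n. a k * indicator {q k..<q (Suc k)} s) = 0"
proof (intro sum.neutral ballI)
  fix k assume "k \<in> {..<n}"
  then have "q (Suc k) \<le> s" using partition_pts_mono[OF q, of "Suc k" n] s by simp
  then show "a k * indicator {q k..<q (Suc k)} s = 0" by simp
qed

text \<open>\<open>step_repr\<close> numbers the values from \<open>1\<close>; here the value on \<open>[q k, q (k + 1))\<close> is \<open>f (q k)\<close>.\<close>

definition step_along :: "(real \<Rightarrow> real) \<Rightarrow> nat \<Rightarrow> (nat \<Rightarrow> real) \<Rightarrow> bool" where
  "step_along f n q \<longleftrightarrow> partition_pts n q \<and>
     (\<forall>s\<ge>0. f s = (\<Sum>k<n. f (q k) * indicator {q k..<q (Suc k)} s))"

lemma step_along_partition: "step_along f n q \<Longrightarrow> partition_pts n q"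
  by (simp add: step_along_def)

text \<open>Refinement: a partition that contains all breakpoints has cells on which the function is
  constant, and beyond its last point the function vanishes.\<close>

lemma step_alongI:
  assumes r: "step_repr f n c t" and q: "partition_pts m q" and sub: "t ` {..n} \<subseteq> q ` {..m}"
  shows "step_along f m q"
  unfolding step_along_def
proof (intro conjI allI impI q)
  fix s :: real assume s: "0 \<le> s"
  have fs: "f s = (\<Sum>k=1..n. c k * indicator {t (k - 1)..<t k} s)" if "0 \<le> s" for s
    using r that by (simp add: step_repr_def)
  show "f s = (\<Sum>k<m. f (q k) * indicator {q k..<q (Suc k)} s)"
  proof (cases "s < q m")
    case True
    then obtain i where i: "i < m" "q i \<le> s" "s < q (Suc i)"
      using partition_pts_cell[OF q s] by blast
    \<comment> \<open>No breakpoint lies in the interval from \<open>q i\<close> (excluded) to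
      \<open>s\<close>, so every indicator has the same value at \<open>s\<close> and at
      \<open>q i\<close>.\<close>
    have le: "t k \<le> s \<longleftrightarrow> t k \<le> q i" if "k \<le> n" for k
    proof -
      have "t k \<in> q ` {..m}" using sub that by (auto simp: image_subset_iff)
      then obtain l where l: "l \<le> m" "t k = q l" by auto
      show ?thesis
        using partition_pts_mono[OF q, of l i] partition_pts_mono[OF q, of "Suc i" l] i l
        by (cases "l \<le> i") auto
    qed
    have "f s = f (q i)"
      unfolding fs[OF s] fs[OF partition_pts_nonneg[OF q less_imp_le[OF i(1)]]]
    proof (intro sum.cong refl arg_cong2[where f = "(*)"])
      fix k assume "k \<in> {1..n}"
      then have "k - 1 \<le> n" "k \<le> n" by auto
      from le[OF this(1)] le[OF this(2)]
      show "indicator {t (k - 1)..<t k} s = (indicator {t (k - 1)..<t k} (q i) :: real)"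
        by (auto simp: indicator_def not_le[symmetric])
    qed
    then show ?thesis by (simp add: partition_pts_sum[OF q i])
  next
    case False
    have "indicator {t (k - 1)..<t k} s = (0 :: real)" if "k \<in> {1..n}" for k
    proof -
      have "t k \<in> q ` {..m}" using sub that by (auto simp: image_subset_iff)
      then obtain l where "l \<le> m" "t k = q l" by auto
      with partition_pts_mono[OF q, of l m] False have "t k \<le> s" by simp
      then show ?thesis by simp
    qed
    then have "f s = 0" unfolding fs[OF s] by (intro sum.neutral) auto
    moreover have "(\<Sum>k<m. f (q k) * indicator {q k..<q (Suc k)} s) = 0"
      using False by (intro partition_pts_sum_outside[OF q]) simp
    ultimately show ?thesis by simp
  qed
qed

lemma step_along_repr:
  assumes "step_along f n q"
  shows "step_repr f n (\<lambda>k. f (q (k - 1))) q"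
proof -
  have "(\<Sum>k=1..n. f (q (k - 1)) * indicator {q (k - 1)..<q k} s) = (\<Sum>k<n. f (q k) * indicator {q k..<q (Suc k)} s)" for s
    by (simp add: sum.atLeast1_atMost_eq)
  then show ?thesis
    using assms by (simp add: step_along_def step_repr_def partition_pts_def)
qed

lemma step_integral_along:
  assumes "step_along f n q"
  shows "step_integral f w = (\<Sum>k<n. f (q k) * (w (q (Suc k)) - w (q k)))"
  unfolding step_integral_eq[OF step_along_repr[OF assms]] by (simp add: sum.atLeast1_atMost_eq)

lemma partition_pts_enumerate:
  assumes S: "finite S" "0 \<in> S" "\<And>s. s \<in> S \<Longrightarrow> 0 \<le> s"
  shows "\<exists>n q. partition_pts n q \<and> q ` {..n} = S"
proof -
  define L where "L = sorted_list_of_set S"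
  have L: "set L = S" "sorted_wrt (<) L" using S(1) by (auto simp: L_def)
  then have len: "0 < length L" using S(2) by auto
  have "L ! 0 = 0"
  proof -
    obtain i where i: "i < length L" "L ! i = 0" using S(2) L(1) by (auto simp: in_set_conv_nth)
    have "0 \<le> L ! 0" using S(3) L(1) len nth_mem by blast
    then show ?thesis using sorted_wrt_nth_less[OF L(2), of 0 i] i by (cases "i = 0") auto
  qed
  then have "partition_pts (length L - 1) (\<lambda>k. L ! k)"
    unfolding partition_pts_def using sorted_wrt_nth_less[OF L(2)] by auto
  moreover have "(\<lambda>k. L ! k) ` {..length L - 1} = S"
  proof -
    have "{..length L - 1} = {..<length L}" using len by (cases "length L") auto
    then show ?thesis using L(1) by (auto simp: set_conv_nth)
  qed
  ultimately show ?thesis by blast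
qed

text \<open>The point \<open>u\<close> is forced into the partition so that a concatenation at time
  \<open>u\<close> never cuts a cell; treating two functions at once gives linearity of the step
  integral.\<close>

lemma step_function_common_partition:
  assumes f: "step_function f" and g: "step_function g" and u: "0 \<le> u"
  shows "\<exists>n q j. step_along f n q \<and> step_along g n q \<and> j \<le> n \<and> q j = u"
proof -
  obtain n c t where r: "step_repr f n c t" using f by (auto simp: step_function_def)
  obtain n' c' t' where r': "step_repr g n' c' t'" using g by (auto simp: step_function_def)
  let ?S = "insert u (insert 0 (t ` {..n} \<union> t' ` {..n'}))"
  have "\<exists>m q. partition_pts m q \<and> q ` {..m} = ?S"
    by (rule partition_pts_enumerate) (use u step_repr_nonneg[OF r] step_repr_nonneg[OF r'] in auto)
  then obtain m q where q: "partition_pts m q" "q ` {..m} = ?S" by blast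
  moreover have "step_along f m q" "step_along g m q"
    using step_alongI[OF r q(1)] step_alongI[OF r' q(1)] q(2) by auto
  moreover obtain j where "j \<le> m" "q j = u" using q(2) by (metis atMost_iff imageE insertI1)
  ultimately show ?thesis by blast
qed

lemma step_along_diff:
  assumes "step_along f n q" "step_along g n q"
  shows "step_along (\<lambda>s. f s - g s) n q"
  using assms unfolding step_along_def by (simp add: left_diff_distrib sum_subtractf)

text \<open>\<open>step_integral\<close> is a definite description, so linearity is read off by
  evaluating all three integrals along one partition.\<close>

lemma step_function_diff:
  assumes f: "step_function f" and g: "step_function g"
  shows "step_function (\<lambda>s. f s - g s)"
    "step_integral (\<lambda>s. f s - g s) w = step_integral f w - step_integral g w"
proof -
  obtain n q where fg: "step_along f n q" "step_along g n q"
    using step_function_common_partition[OF f g order_refl] by blast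
  note d = step_along_diff[OF fg]
  show "step_function (\<lambda>s. f s - g s)"
    using step_along_repr[OF d] unfolding step_function_def by blast
  show "step_integral (\<lambda>s. f s - g s) w = step_integral f w - step_integral g w"
    unfolding step_integral_along[OF d] step_integral_along[OF fg(1)] step_integral_along[OF fg(2)]
    by (simp add: sum_subtractf left_diff_distrib)
qed

text \<open>At each \<open>s\<close> at most one indicator is nonzero, so \<open>\<Phi>\<close>
  passes through the sum; \<open>\<Phi> 0 = 0\<close> takes care of the times beyond
  \<open>q n\<close>.\<close>

lemma step_along_map:
  fixes \<Phi> :: "real \<Rightarrow> 'a::semiring_1"
  assumes f: "step_along f n q" and "\<Phi> 0 = 0" and s: "0 \<le> s"
  shows "\<Phi> (f s) = (\<Sum>k<n. \<Phi> (f (q k)) * indicator {q k..<q (Suc k)} s)"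
proof -
  note q = step_along_partition[OF f]
  have fs: "f s = (\<Sum>k<n. f (q k) * indicator {q k..<q (Suc k)} s)"
    using f s by (simp add: step_along_def)
  show ?thesis
  proof (cases "s < q n")
    case True
    then obtain i where i: "i < n" "q i \<le> s" "s < q (Suc i)"
      using partition_pts_cell[OF q s] by blast
    then show ?thesis using fs by (simp add: partition_pts_sum[OF q i])
  next
    case False
    then have out: "q n \<le> s" by simp
    then have "f s = 0" using fs by (simp only: partition_pts_sum_outside[OF q])
    then show ?thesis using assms(2) by (simp only: partition_pts_sum_outside[OF q out])
  qed
qed

lemma step_along_map_measurable:
  fixes \<Phi> :: "real \<Rightarrow> ennreal"
  assumes f: "step_along f n q" and "\<Phi> 0 = 0"
  shows "(\<lambda>s. \<Phi> (f s) * indicator {0..} s) \<in> borel_measurable borel"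
proof -
  have "(\<lambda>s. \<Phi> (f s) * indicator {0..} s) =
      (\<lambda>s. (\<Sum>k<n. \<Phi> (f (q k)) * indicator {q k..<q (Suc k)} s) * indicator {0..} s)"
  proof
    fix s show "\<Phi> (f s) * indicator {0..} s
        = (\<Sum>k<n. \<Phi> (f (q k)) * indicator {q k..<q (Suc k)} s) * indicator {0..} s"
      using step_along_map[where \<Phi> = \<Phi>, OF assms, of s] by (cases "0 \<le> s") auto
  qed
  also have "\<dots> \<in> borel_measurable borel" by measurable
  finally show ?thesis .
qed

text \<open>The weight \<open>h\<close> will be the constant 1, the function
  \<open>1 / (1 + sqrt s)\<close>, and \<open>bessel_kernel\<close>.\<close>

lemma step_along_nn_integral:
  fixes \<Phi> :: "real \<Rightarrow> ennreal"
  assumes f: "step_along f n q" and "\<Phi> 0 = 0" and [measurable]: "h \<in> borel_measurable borel"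
  shows "(\<integral>\<^sup>+s. \<Phi> (f s) * indicator {0..} s * h s \<partial>lborel)
    = (\<Sum>k<n. \<Phi> (f (q k)) * (\<integral>\<^sup>+s. h s * indicator {q k..<q (Suc k)} s \<partial>lborel))"
proof -
  have "(\<integral>\<^sup>+s. \<Phi> (f s) * indicator {0..} s * h s \<partial>lborel)
    = (\<integral>\<^sup>+s. (\<Sum>k<n. \<Phi> (f (q k)) * (h s * indicator {q k..<q (Suc k)} s)) \<partial>lborel)"
  proof (intro nn_integral_cong)
    fix s
    show "\<Phi> (f s) * indicator {0..} s * h s = (\<Sum>k<n. \<Phi> (f (q k)) * (h s * indicator {q k..<q (Suc k)} s))"
    proof (cases "0 \<le> s")
      case True
      have "\<Phi> (f s) * indicator {0..} s * h s = (\<Sum>k<n. \<Phi> (f (q k)) * indicator {q k..<q (Suc k)} s) * h s"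
        using True step_along_map[where \<Phi> = \<Phi>, OF assms(1,2) True] by simp
      also have "\<dots> = (\<Sum>k<n. \<Phi> (f (q k)) * (h s * indicator {q k..<q (Suc k)} s))"
        unfolding sum_distrib_right by (intro sum.cong refl) (simp only: ac_simps)
      finally show ?thesis .
    next
      case False
      then have "indicator {q k..<q (Suc k)} s = (0 :: ennreal)" if "k < n" for k
        using partition_pts_nonneg[OF step_along_partition[OF f], of k] that by simp
      then show ?thesis using False by simp
    qed
  qed
  also have "\<dots> = (\<Sum>k<n. \<Phi> (f (q k)) * (\<integral>\<^sup>+s. h s * indicator {q k..<q (Suc k)} s \<partial>lborel))"
    by (subst nn_integral_sum) (auto simp: nn_integral_cmult)
  finally show ?thesis .
qed

section \<open>Norms of step functions with respect to \<open>ds\<close> and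
  \<open>weighted_ds\<close>\<close>

lemma step_function_along: "step_function f \<Longrightarrow> \<exists>n q. step_along f n q"
  using step_function_common_partition[of f f 0] by auto

text \<open>\<open>ds\<close> comes from the completed Lebesgue measure, whereas Tonelli is applied
  to \<open>lborel\<close>; Borel measurability of the truncated integrand allows the
  change.\<close>

lemma nn_integral_ds:
  assumes "(\<lambda>s. F s * indicator {0..} s) \<in> borel_measurable borel"
  shows "(\<integral>\<^sup>+s. F s \<partial>ds) = (\<integral>\<^sup>+s. F s * indicator {0..} s \<partial>lborel)"
  using assms by (simp add: nn_integral_restrict_space nn_integral_completion)

lemma step_function_measurable_ds:
  assumes "step_function f" shows "f \<in> borel_measurable ds"
proof -
  obtain n q where f: "step_along f n q" using step_function_along[OF assms] by blast
  have "(\<lambda>s. \<Sum>k<n. f (q k) * indicator {q k..<q (Suc k)} s) \<in> borel_measurable lborel"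
    by measurable
  then have "(\<lambda>s. \<Sum>k<n. f (q k) * indicator {q k..<q (Suc k)} s) \<in> borel_measurable ds"
    by (intro measurable_restrict_space1 measurable_completion)
  then show ?thesis
    by (subst measurable_cong[where g = "\<lambda>s. \<Sum>k<n. f (q k) * indicator {q k..<q (Suc k)} s"])
      (use f in \<open>auto simp: step_along_def space_restrict_space\<close>)
qed


lemma step_along_square_nn_integral:
  assumes f: "step_along f n q"
  shows "(\<integral>\<^sup>+s. ennreal (\<bar>f s\<bar>\<^sup>2) \<partial>ds) = ennreal (\<Sum>k<n. (f (q k))\<^sup>2 * (q (Suc k) - q k))"
proof -
  have q: "0 \<le> q (Suc k) - q k" if "k < n" for k
    using step_along_partition[OF f] that by (auto simp: partition_pts_def less_imp_le)
  let ?\<Phi> = "\<lambda>x. ennreal (\<bar>x\<bar>\<^sup>2)"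
  have "(\<integral>\<^sup>+s. ?\<Phi> (f s) \<partial>ds) = (\<integral>\<^sup>+s. ?\<Phi> (f s) * indicator {0..} s * 1 \<partial>lborel)"
    by (subst nn_integral_ds[OF step_along_map_measurable[OF f, of ?\<Phi>]]) simp_all
  also have "\<dots> = (\<Sum>k<n. ?\<Phi> (f (q k)) * (\<integral>\<^sup>+s. 1 * indicator {q k..<q (Suc k)} s \<partial>lborel))"
    by (rule step_along_nn_integral[OF f]) auto
  also have "\<dots> = (\<Sum>k<n. ennreal ((f (q k))\<^sup>2 * (q (Suc k) - q k)))"
    using q by (intro sum.cong) (auto simp: ennreal_mult)
  also have "\<dots> = ennreal (\<Sum>k<n. (f (q k))\<^sup>2 * (q (Suc k) - q k))"
    using q by (intro sum_ennreal) auto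
  finally show ?thesis .
qed

abbreviation weighted_ds :: "real measure" where
  "weighted_ds \<equiv> density ds (\<lambda>s. ennreal (1 / (1 + sqrt s)))"

lemma nn_integral_weighted_ds:
  assumes f: "f \<in> borel_measurable ds"
  shows "(\<integral>\<^sup>+s. f s \<partial>weighted_ds) = (\<integral>\<^sup>+s. ennreal (1 / (1 + sqrt s)) * f s \<partial>ds)"
proof (rule nn_integral_density[OF _ f])
  have "(\<lambda>s. ennreal (1 / (1 + sqrt s))) \<in> borel_measurable lborel" by measurable
  then show "(\<lambda>s. ennreal (1 / (1 + sqrt s))) \<in> borel_measurable ds"
    by (intro measurable_restrict_space1 measurable_completion)
qed

lemma step_weighted_nn_integral:
  assumes f: "step_function f"
  shows "(\<integral>\<^sup>+s. ennreal \<bar>f s\<bar> \<partial>weighted_ds) = (\<integral>\<^sup>+s. ennreal \<bar>f s\<bar> * indicator {0..} s * ennreal (1 / (1 + sqrt s)) \<partial>lborel)"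
proof -
  have [measurable]: "f \<in> borel_measurable ds" by (rule step_function_measurable_ds[OF f])
  obtain n q where "step_along f n q" using step_function_along[OF f] by blast
  from step_along_map_measurable[OF this, of "\<lambda>x. ennreal \<bar>x\<bar>"]
  have [measurable]: "(\<lambda>s. ennreal \<bar>f s\<bar> * indicator {0..} s) \<in> borel_measurable borel" by simp
  have "(\<integral>\<^sup>+s. ennreal \<bar>f s\<bar> \<partial>weighted_ds) = (\<integral>\<^sup>+s. ennreal (1 / (1 + sqrt s)) * ennreal \<bar>f s\<bar> \<partial>ds)"
    by (rule nn_integral_weighted_ds) measurable
  also have "\<dots> = (\<integral>\<^sup>+s. ennreal (1 / (1 + sqrt s)) * ennreal \<bar>f s\<bar> * indicator {0..} s \<partial>lborel)"
    by (rule nn_integral_ds) (simp add: mult.assoc)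
  also have "\<dots> = (\<integral>\<^sup>+s. ennreal \<bar>f s\<bar> * indicator {0..} s * ennreal (1 / (1 + sqrt s)) \<partial>lborel)"
    by (simp add: mult_ac)
  finally show ?thesis .
qed

section \<open>The square-root kernel and the mean drift of the Bessel part\<close>

lemma nn_integral_inverse_sqrt:
  fixes a b u :: real
  assumes u: "u \<le> a" and ab: "a < b"
  shows "(\<integral>\<^sup>+r. ennreal (1 / (2 * sqrt (r - u))) * indicator {a..b} r \<partial>lborel) = ennreal (sqrt (b - u) - sqrt (a - u))"
proof -
  have "((\<lambda>r. 1 / (2 * sqrt (r - u))) has_integral (sqrt (b - u) - sqrt (a - u))) {a..b}"
  \<comment> \<open>The interior version is used because the derivative of
    \<open>sqrt (r - u)\<close> blows up at the left endpoint when \<open>a = u\<close>.\<close>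
  proof (rule fundamental_theorem_of_calculus_interior)
    show "continuous_on {a..b} (\<lambda>r. sqrt (r - u))" by (intro continuous_intros)
    show "((\<lambda>r. sqrt (r - u)) has_vector_derivative 1 / (2 * sqrt (r - u))) (at r)" if "r \<in> {a<..<b}" for r
      using that u unfolding has_real_derivative_iff_has_vector_derivative[symmetric]
      by (auto intro!: derivative_eq_intros simp: divide_simps)
  qed (use ab in simp)
  then have "((\<lambda>r. if r \<in> {a..b} then 1 / (2 * sqrt (r - u)) else 0) has_integral (sqrt (b - u) - sqrt (a - u))) UNIV"
    by (simp only: has_integral_restrict_UNIV)
  moreover have "(\<lambda>r. if r \<in> {a..b} then 1 / (2 * sqrt (r - u)) else 0) = (\<lambda>r. indicator {a..b} r *\<^sub>R (1 / (2 * sqrt (r - u))))"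
    by (rule ext) (simp add: indicator_def)
  ultimately have "((\<lambda>r. indicator {a..b} r *\<^sub>R (1 / (2 * sqrt (r - u)))) has_integral (sqrt (b - u) - sqrt (a - u))) UNIV"
    by simp
  then have "(\<integral>\<^sup>+r. ennreal (indicator {a..b} r *\<^sub>R (1 / (2 * sqrt (r - u)))) \<partial>lborel) = ennreal (sqrt (b - u) - sqrt (a - u))"
    using u by (intro nn_integral_has_integral_lborel) (auto simp: indicator_def)
  then show ?thesis by (simp add: indicator_mult_ennreal mult.commute)
qed

text \<open>The kernel is the derivative of \<open>\<surd>(r - u)\<close>, the profile of the mean of a Bessel process started at time \<open>u\<close>.\<close>

definition bessel_kernel :: "real \<Rightarrow> real \<Rightarrow> ennreal" where
  "bessel_kernel u r = ennreal (1 / (2 * sqrt (r - u))) * indicator {u<..} r"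

lemma bessel_kernel_measurable[measurable]:
  "(\<lambda>(u, r). bessel_kernel u r) \<in> borel_measurable (borel \<Otimes>\<^sub>M borel)"
proof -
  have "bessel_kernel u r = ennreal (1 / (2 * sqrt (r - u))) * (if u < r then 1 else 0)" for u r
    by (simp add: bessel_kernel_def)
  then show ?thesis by simp
qed

lemma bessel_kernel_measurable2[measurable]: "bessel_kernel u \<in> borel_measurable borel"
  unfolding bessel_kernel_def[abs_def] by measurable

lemma bessel_kernel_cell:
  assumes "u \<le> a" "a < b"
  shows "(\<integral>\<^sup>+r. bessel_kernel u r * indicator {a..<b} r \<partial>lborel) = ennreal (sqrt (b - u) - sqrt (a - u))"
proof -
  have "(\<integral>\<^sup>+r. bessel_kernel u r * indicator {a..<b} r \<partial>lborel)
      = (\<integral>\<^sup>+r. ennreal (1 / (2 * sqrt (r - u))) * indicator {a..b} r \<partial>lborel)"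
    using AE_lborel_singleton[of a] AE_lborel_singleton[of b] assms
    by (intro nn_integral_cong_AE) (auto simp: bessel_kernel_def indicator_def)
  then show ?thesis using nn_integral_inverse_sqrt[OF assms] by simp
qed

text \<open>With \<open>b = min U r\<close> the integral is at most
  \<open>?d = sqrt r - sqrt (r - b)\<close>. Subadditivity of the root gives
  \<open>?d <= sqrt U\<close>, and multiplying by the conjugate gives
  \<open>?d * sqrt r <= b <= U\<close>; the sum of both is the constant \<open>U + sqrt U\<close>,
  valid near 0 and at infinity.\<close>

lemma bessel_kernel_start_integral_le:
  assumes U: "0 < U" and r: "0 \<le> r"
  shows "(\<integral>\<^sup>+u. bessel_kernel u r * indicator {0<..<U} u \<partial>lborel) \<le> ennreal (U + sqrt U) * ennreal (1 / (1 + sqrt r))"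
proof (cases "r = 0")
  case True
  then have "bessel_kernel u r * indicator {0<..<U} u = 0" for u by (auto simp: bessel_kernel_def indicator_def)
  then have "(\<integral>\<^sup>+u. bessel_kernel u r * indicator {0<..<U} u \<partial>lborel) = 0"
    by (simp only: nn_integral_const mult_zero_left)
  then show ?thesis by simp
next
  case False
  with r have r: "0 < r" by simp
  define b where "b = min U r"
  have b: "0 < b" "b \<le> U" "b \<le> r" using U r by (auto simp: b_def)
  have "(\<integral>\<^sup>+u. bessel_kernel u r * indicator {0<..<U} u \<partial>lborel)
    \<le> (\<integral>\<^sup>+u. ennreal (1 / (2 * sqrt (r - u))) * indicator {0..b} u \<partial>lborel)"
    by (intro nn_integral_mono) (auto simp: bessel_kernel_def indicator_def b_def)
  \<comment> \<open>Reflection \<open>u = r - x\<close>, which turns the singularity at the right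
    endpoint into the form integrated above.\<close>
  also have "\<dots> = (\<integral>\<^sup>+x. ennreal (1 / (2 * sqrt (x - (r - b) + (r - b)))) * indicator {0..b} (r - x) \<partial>lborel)"
    by (subst nn_integral_real_affine[where c = "-1" and t = r]) auto
  also have "\<dots> = (\<integral>\<^sup>+x. ennreal (1 / (2 * sqrt (x - 0))) * indicator {r - b..r} x \<partial>lborel)"
    by (intro nn_integral_cong) (auto simp: indicator_def)
  also have "\<dots> = ennreal (sqrt r - sqrt (r - b))"
    using b by (subst nn_integral_inverse_sqrt) auto
  also have "\<dots> \<le> ennreal ((U + sqrt U) * (1 / (1 + sqrt r)))"
  proof (rule ennreal_leI)
    let ?d = "sqrt r - sqrt (r - b)"
    have "sqrt r \<le> sqrt (r - b) + sqrt b" using sqrt_add_le_add_sqrt[of "r - b" b] b by simp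
    moreover have "sqrt b \<le> sqrt U" using b by simp
    ultimately have 1: "?d \<le> sqrt U" by linarith
    have "?d * sqrt r \<le> ?d * (sqrt r + sqrt (r - b))"
      using b by (intro mult_left_mono) auto
    also have "\<dots> = b" using b r by (simp add: algebra_simps)
    finally have "?d * (1 + sqrt r) \<le> U + sqrt U" using 1 b by (simp add: algebra_simps)
    then show "?d \<le> (U + sqrt U) * (1 / (1 + sqrt r))"
      using r by (simp add: pos_le_divide_eq add_pos_pos)
  qed
  also have "\<dots> = ennreal (U + sqrt U) * ennreal (1 / (1 + sqrt r))"
    using U r by (intro ennreal_mult) auto
  finally show ?thesis .
qed

text \<open>The integral of \<open>|g r|\<close> against \<open>d (sqrt (r - u))\<close> over
  \<open>r > u\<close>: up to the factor \<open>normal3_mean\<close>, the mean of the compensator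
  when the Bessel path starts at time \<open>u\<close>.\<close>

definition bessel_drift :: "(real \<Rightarrow> real) \<Rightarrow> real \<Rightarrow> ennreal" where
  "bessel_drift g u = (\<integral>\<^sup>+r. ennreal \<bar>g r\<bar> * indicator {0..} r * bessel_kernel u r \<partial>lborel)"

lemma step_abs_measurable:
  assumes "step_function g"
  shows "(\<lambda>r. ennreal \<bar>g r\<bar> * indicator {0..} r) \<in> borel_measurable borel"
  using step_function_along[OF assms] step_along_map_measurable[of g _ _ "\<lambda>x. ennreal \<bar>x\<bar>"] by auto

lemma bessel_drift_measurable:
  assumes g: "step_function g"
  shows "bessel_drift g \<in> borel_measurable borel"
proof -
  note [measurable] = step_abs_measurable[OF g]
  show ?thesis unfolding bessel_drift_def[abs_def] by measurable
qed

lemma bessel_drift_nn_integral_le: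
  assumes g: "step_function g" and U: "0 < U"
  shows "(\<integral>\<^sup>+u. bessel_drift g u * indicator {0<..<U} u \<partial>lborel)
    \<le> ennreal (U + sqrt U) * (\<integral>\<^sup>+s. ennreal \<bar>g s\<bar> \<partial>weighted_ds)"
proof -
  note [measurable] = step_abs_measurable[OF g]
  let ?G = "\<lambda>r. ennreal \<bar>g r\<bar> * indicator {0..} r"
  have "(\<integral>\<^sup>+u. bessel_drift g u * indicator {0<..<U} u \<partial>lborel)
      = (\<integral>\<^sup>+u. \<integral>\<^sup>+r. ?G r * (bessel_kernel u r * indicator {0<..<U} u) \<partial>lborel \<partial>lborel)"
    unfolding bessel_drift_def by (subst nn_integral_multc[symmetric]) (simp_all add: mult.assoc[symmetric])
  also have "\<dots> = (\<integral>\<^sup>+r. \<integral>\<^sup>+u. ?G r * (bessel_kernel u r * indicator {0<..<U} u) \<partial>lborel \<partial>lborel)"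
    by (rule lborel_pair.Fubini') measurable
  also have "\<dots> = (\<integral>\<^sup>+r. ?G r * (\<integral>\<^sup>+u. bessel_kernel u r * indicator {0<..<U} u \<partial>lborel) \<partial>lborel)"
    by (intro nn_integral_cong nn_integral_cmult) measurable
  also have "\<dots> \<le> (\<integral>\<^sup>+r. ?G r * (ennreal (U + sqrt U) * ennreal (1 / (1 + sqrt r))) \<partial>lborel)"
    using bessel_kernel_start_integral_le[OF U]
    by (intro nn_integral_mono) (auto simp: indicator_def intro!: mult_left_mono)
  also have "\<dots> = (\<integral>\<^sup>+r. ennreal (U + sqrt U) * (?G r * ennreal (1 / (1 + sqrt r))) \<partial>lborel)"
    by (simp only: ac_simps)
  also have "\<dots> = ennreal (U + sqrt U) * (\<integral>\<^sup>+s. ennreal \<bar>g s\<bar> \<partial>weighted_ds)"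
    unfolding step_weighted_nn_integral[OF g] by (rule nn_integral_cmult) measurable
  finally show ?thesis .
qed

section \<open>The laws entering \<open>\<W>\<close>\<close>

lemma summable_iff_suminf_ennreal:
  fixes a :: "nat \<Rightarrow> real"
  assumes "\<And>n. 0 \<le> a n"
  shows "summable a \<longleftrightarrow> (\<Sum>n. ennreal (a n)) \<noteq> \<infinity>"
proof
  assume "summable a"
  then show "(\<Sum>n. ennreal (a n)) \<noteq> \<infinity>"
    using ennreal_suminf_neq_top[OF _ assms] by (simp add: infinity_ennreal_def)
next
  assume "(\<Sum>n. ennreal (a n)) \<noteq> \<infinity>"
  then show "summable a"
    using summable_suminf_not_top[OF assms] by (simp add: infinity_ennreal_def)
qed

text \<open>The series is exchanged with the integral, and a function with finite integral is finite
  almost everywhere.\<close>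

lemma AE_summable_abs:
  fixes Z :: "nat \<Rightarrow> 'a \<Rightarrow> real"
  assumes [measurable]: "\<And>n. Z n \<in> borel_measurable M"
    and fin: "(\<Sum>n. \<integral>\<^sup>+w. ennreal \<bar>Z n w\<bar> \<partial>M) \<noteq> \<infinity>"
  shows "AE w in M. summable (\<lambda>n. \<bar>Z n w\<bar>)"
proof -
  have "(\<integral>\<^sup>+w. (\<Sum>n. ennreal \<bar>Z n w\<bar>) \<partial>M) \<noteq> \<infinity>"
    using fin by (subst nn_integral_suminf) auto
  then have "AE w in M. (\<Sum>n. ennreal \<bar>Z n w\<bar>) \<noteq> \<infinity>"
    by (intro nn_integral_PInf_AE) auto
  then show ?thesis by (simp add: summable_iff_suminf_ennreal)
qed

lemma measurable_path_spaceI: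
  assumes "\<And>\<omega>. \<omega> \<in> space M \<Longrightarrow> f \<omega> \<in> extensional I" "\<And>\<omega>. \<omega> \<in> space M \<Longrightarrow> continuous_on I (f \<omega>)"
    and "\<And>t. t \<in> I \<Longrightarrow> (\<lambda>\<omega>. f \<omega> t) \<in> borel_measurable M"
  shows "f \<in> measurable M (path_space I)"
  unfolding path_space_def
proof (rule measurable_restrict_space2)
  show "f \<in> measurable M (\<Pi>\<^sub>M t\<in>I. borel)"
    by (rule measurable_PiM_single'[OF assms(3)]) (use assms(1) in \<open>auto simp: PiE_def\<close>)
  show "f \<in> space M \<rightarrow> {w. continuous_on I w}" using assms(2) by blast
qed

lemma step_integral_measurable:
  assumes "step_function g"
  shows "step_integral g \<in> borel_measurable \<Omega>"
proof -
  obtain n q where g: "step_along g n q" using step_function_along[OF assms] by blast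
  have "0 \<le> q k" if "k \<le> n" for k
    using partition_pts_nonneg[OF step_along_partition[OF g] that] .
  then have "(\<lambda>w. \<Sum>k<n. g (q k) * (w (q (Suc k)) - w (q k))) \<in> borel_measurable \<Omega>"
    by (intro borel_measurable_sum borel_measurable_times borel_measurable_diff coordinate_measurable) auto
  then show ?thesis by (simp add: step_integral_along[OF g, abs_def])
qed

lemma bridge_map_measurable:
  assumes P: "wiener_measure P" and u: "0 < u"
  shows "(\<lambda>w. \<lambda>t\<in>{0..u}. w t - t / u * w u) \<in> measurable P (path_space {0..u})"
proof (rule measurable_path_spaceI)
  note [measurable_cong] = wiener_sets[OF P]
  have sp: "space P = space \<Omega>" by (rule sets_eq_imp_space_eq[OF wiener_sets[OF P]])
  fix w assume "w \<in> space P"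
  then have "continuous_on {0..u} w"
    using sp by (auto simp: space_path_space intro: continuous_on_subset)
  then have "continuous_on {0..u} (\<lambda>t. w t - t / u * w u)"
    using u by (intro continuous_intros) auto
  then show "continuous_on {0..u} (\<lambda>t\<in>{0..u}. w t - t / u * w u)"
    by (subst continuous_on_cong[OF refl]) auto
next
  fix t assume t: "t \<in> {0..u}"
  have "(\<lambda>w. w t - t / u * w u) \<in> borel_measurable P"
    using t u by (intro borel_measurable_diff borel_measurable_times borel_measurable_const wiener_coordinate_measurable[OF P]) auto
  then show "(\<lambda>w. (\<lambda>t\<in>{0..u}. w t - t / u * w u) t) \<in> borel_measurable P" using t by simp
qed simp

lemma bessel_map_measurable:
  assumes P: "wiener_measure P"
  shows "(\<lambda>(a, b, c). \<lambda>t\<in>{0..}. sqrt ((a t)\<^sup>2 + (b t)\<^sup>2 + (c t)\<^sup>2)) \<in> measurable (wiener3 P) \<Omega>"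
proof (rule measurable_path_spaceI)
  have sp: "space P = space \<Omega>" by (rule sets_eq_imp_space_eq[OF wiener_sets[OF P]])
  fix z assume "z \<in> space (wiener3 P)"
  then obtain a b c where z: "z = (a, b, c)" "continuous_on {0..} a" "continuous_on {0..} b" "continuous_on {0..} c"
    using sp by (auto simp: space_pair_measure space_path_space)
  then have "continuous_on {0..} (\<lambda>t. sqrt ((a t)\<^sup>2 + (b t)\<^sup>2 + (c t)\<^sup>2))"
    by (intro continuous_intros)
  then show "continuous_on {0..} ((\<lambda>(a, b, c). \<lambda>t\<in>{0..}. sqrt ((a t)\<^sup>2 + (b t)\<^sup>2 + (c t)\<^sup>2)) z)"
    unfolding z prod.case by (subst continuous_on_cong[OF refl]) auto
next
  fix t :: real assume t: "t \<in> {0..}"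
  then have [measurable]: "(\<lambda>z. path3 z t) \<in> borel_measurable (wiener3 P)" by (intro path3_measurable[OF P]) simp
  have "(\<lambda>z. (\<lambda>(a, b, c). \<lambda>t\<in>{0..}. sqrt ((a t)\<^sup>2 + (b t)\<^sup>2 + (c t)\<^sup>2)) z t) = (\<lambda>z. norm (path3 z t))"
    using t by (auto simp: norm_path3)
  then show "(\<lambda>z. (\<lambda>(a, b, c). \<lambda>t\<in>{0..}. sqrt ((a t)\<^sup>2 + (b t)\<^sup>2 + (c t)\<^sup>2)) z t) \<in> borel_measurable (wiener3 P)"
    by simp
qed auto

lemma neg_path_measurable: "(\<lambda>w. \<lambda>t\<in>{0..}. - w t) \<in> measurable \<Omega> \<Omega>"
proof (rule measurable_path_spaceI)
  fix w assume "w \<in> space \<Omega>"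
  then have "continuous_on {0..} (\<lambda>t. - w t)"
    by (intro continuous_intros) (simp add: space_path_space)
  then show "continuous_on {0..} (\<lambda>t\<in>{0..}. - w t)"
    by (subst continuous_on_cong[OF refl]) auto
qed auto

text \<open>The branch that freezes the path at \<open>x u\<close> when the ends do not meet keeps
  every concatenation continuous, so the map goes into path space for all pairs and not only for
  almost all.\<close>

lemma concat_path_measurable:
  assumes u: "0 < u"
  shows "(\<lambda>(x, y). concat_path u x y) \<in> measurable (path_space {0..u} \<Otimes>\<^sub>M \<Omega>) \<Omega>"
proof (rule measurable_path_spaceI)
  fix z assume "z \<in> space (path_space {0..u} \<Otimes>\<^sub>M \<Omega>)"
  then obtain x y where z: "z = (x, y)" and x: "continuous_on {0..u} x" and y: "continuous_on {0..} y"
    by (auto simp: space_pair_measure space_path_space)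
  \<comment> \<open>The weak inequality in place of the strict one of \<open>concat_path\<close>
    gives two closed pieces for pasting; the formulas agree at \<open>t = u\<close>.\<close>
  define F where "F t = (if t \<le> u then x t else if x u = y 0 then y (t - u) else x u)" for t
  have "continuous_on ({0..u} \<union> {u..}) F"
    unfolding F_def
  proof (rule continuous_on_If)
    show "continuous_on {u..} (\<lambda>t. if x u = y 0 then y (t - u) else x u)"
    proof (cases "x u = y 0")
      case True
      have "continuous_on {u..} (\<lambda>t. y (t - u))"
        by (rule continuous_on_compose2[OF y]) (auto intro!: continuous_intros)
      then show ?thesis using True by simp
    qed simp
    show "x t = (if x u = y 0 then y (t - u) else x u)" if "t \<in> {0..u}" "\<not> t \<le> u" for t
      using that by simp
    show "x t = (if x u = y 0 then y (t - u) else x u)" if "t \<in> {u..}" "t \<le> u" for t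
    proof -
      have "t = u" using that by simp
      then show ?thesis by simp
    qed
  qed (use x in auto)
  moreover have "{0..u} \<union> {u..} = {0..}" using u by auto
  ultimately have "continuous_on {0..} F" by simp
  moreover have "F t = concat_path u x y t" if "t \<in> {0..}" for t
  proof (cases "t = u")
    case True
    then show ?thesis using u by (simp add: concat_path_def F_def)
  next
    case False
    then have "t \<le> u \<longleftrightarrow> t < u" by auto
    then show ?thesis using that by (simp add: concat_path_def F_def)
  qed
  ultimately show "continuous_on {0..} ((\<lambda>(x, y). concat_path u x y) z)"
    unfolding z prod.case using continuous_on_cong[OF refl, of "{0..}" F "concat_path u x y"] by blast
next
  fix t :: real assume t: "t \<in> {0..}"
  let ?M = "path_space {0..u} \<Otimes>\<^sub>M \<Omega>"
  have [measurable]: "(\<lambda>z. fst z u) \<in> borel_measurable ?M" "(\<lambda>z. snd z 0) \<in> borel_measurable ?M"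
    using u by (auto intro!: measurable_compose[OF measurable_fst coordinate_measurable] measurable_compose[OF measurable_snd coordinate_measurable])
  show "(\<lambda>z. (\<lambda>(x, y). concat_path u x y) z t) \<in> borel_measurable ?M"
  proof (cases "t < u")
    case True
    have "(\<lambda>z. fst z t) \<in> borel_measurable ?M"
      using t True by (intro measurable_compose[OF measurable_fst coordinate_measurable]) auto
    then show ?thesis using t True by (simp add: concat_path_def case_prod_unfold)
  next
    case False
    have [measurable]: "(\<lambda>z. snd z (t - u)) \<in> borel_measurable ?M"
      using False by (intro measurable_compose[OF measurable_snd coordinate_measurable]) auto
    have "(\<lambda>z. if fst z u = snd z 0 then snd z (t - u) else fst z u) \<in> borel_measurable ?M" by measurable
    then show ?thesis using t False by (simp add: concat_path_def case_prod_unfold)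
  qed
qed (auto simp: concat_path_def)

context
  fixes P :: "(real \<Rightarrow> real) measure"
  assumes P: "wiener_measure P"
begin

interpretation P: prob_space P by (rule wiener_prob_space[OF P])
interpretation P3: prob_space "wiener3 P" by (rule wiener3_prob_space[OF P])

lemma bridge_law_prob_space: "0 < u \<Longrightarrow> prob_space (bridge_law P u)"
  unfolding bridge_law_def by (intro P.prob_space_distr bridge_map_measurable[OF P])

lemma sets_bridge_law[measurable_cong]: "sets (bridge_law P u) = sets (path_space {0..u})"
  by (simp add: bridge_law_def)

lemma sets_bessel3_law[measurable_cong]: "sets (bessel3_law P) = sets \<Omega>" "sets (neg_bessel3_law P) = sets \<Omega>"
  by (simp_all add: bessel3_law_def neg_bessel3_law_def)

lemma bessel3_law_prob_space: "prob_space (bessel3_law P)" "prob_space (neg_bessel3_law P)"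
proof -
  show b: "prob_space (bessel3_law P)"
    unfolding bessel3_law_def by (intro P3.prob_space_distr bessel_map_measurable[OF P])
  show "prob_space (neg_bessel3_law P)"
    unfolding neg_bessel3_law_def
    by (rule prob_space.prob_space_distr[OF b]) (simp add: measurable_cong_sets[OF sets_bessel3_law(1) refl] neg_path_measurable)
qed

lemma sets_sym_bessel3_law[measurable_cong]: "sets (sym_bessel3_law P) = sets \<Omega>"
  by (simp add: sym_bessel3_law_def)

lemma emeasure_sym_bessel3_law:
  assumes "A \<in> sets \<Omega>"
  shows "emeasure (sym_bessel3_law P) A = (emeasure (bessel3_law P) A + emeasure (neg_bessel3_law P) A) / 2"
proof (rule emeasure_measure_of[OF sym_bessel3_law_def])
  show "countably_additive (sets (sym_bessel3_law P)) (\<lambda>A. (emeasure (bessel3_law P) A + emeasure (neg_bessel3_law P) A) / 2)"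
  proof (rule countably_additiveI)
    fix A :: "nat \<Rightarrow> (real \<Rightarrow> real) set"
    assume A: "range A \<subseteq> sets (sym_bessel3_law P)" "disjoint_family A"
    then have "(\<Sum>i. emeasure (bessel3_law P) (A i)) = emeasure (bessel3_law P) (\<Union>i. A i)"
      "(\<Sum>i. emeasure (neg_bessel3_law P) (A i)) = emeasure (neg_bessel3_law P) (\<Union>i. A i)"
      by (auto intro!: suminf_emeasure simp: sets_sym_bessel3_law sets_bessel3_law)
    then show "(\<Sum>i. (emeasure (bessel3_law P) (A i) + emeasure (neg_bessel3_law P) (A i)) / 2) =
      (emeasure (bessel3_law P) (\<Union>i. A i) + emeasure (neg_bessel3_law P) (\<Union>i. A i)) / 2"
      by (simp add: divide_ennreal_def suminf_add[OF summableI summableI, symmetric])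
  qed
  show "sets \<Omega> \<subseteq> Pow (space \<Omega>)" by (rule sets.space_closed)
qed (use assms in \<open>auto simp: positive_def sets_sym_bessel3_law\<close>)

lemma sym_bessel3_law_prob_space: "prob_space (sym_bessel3_law P)"
proof
  have sp: "space (sym_bessel3_law P) = space \<Omega>" "space (bessel3_law P) = space \<Omega>" "space (neg_bessel3_law P) = space \<Omega>"
    by (rule sets_eq_imp_space_eq, rule sets_sym_bessel3_law sets_bessel3_law)+
  show "emeasure (sym_bessel3_law P) (space (sym_bessel3_law P)) = 1"
    using prob_space.emeasure_space_1[OF bessel3_law_prob_space(1)] prob_space.emeasure_space_1[OF bessel3_law_prob_space(2)]
    unfolding sp by (simp add: emeasure_sym_bessel3_law ennreal_divide_self)
qed

lemma AE_sym_bessel3_law: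
  assumes "AE y in bessel3_law P. Q y" "AE y in neg_bessel3_law P. Q y"
  shows "AE y in sym_bessel3_law P. Q y"
proof -
  have sp: "space (sym_bessel3_law P) = space \<Omega>" "space (bessel3_law P) = space \<Omega>" "space (neg_bessel3_law P) = space \<Omega>"
    by (rule sets_eq_imp_space_eq, rule sets_sym_bessel3_law sets_bessel3_law)+
  obtain N1 where N1: "{y \<in> space \<Omega>. \<not> Q y} \<subseteq> N1" "emeasure (bessel3_law P) N1 = 0" "N1 \<in> sets \<Omega>"
    using AE_E[OF assms(1)] by (auto simp: sp sets_bessel3_law)
  obtain N2 where N2: "{y \<in> space \<Omega>. \<not> Q y} \<subseteq> N2" "emeasure (neg_bessel3_law P) N2 = 0" "N2 \<in> sets \<Omega>"
    using AE_E[OF assms(2)] by (auto simp: sp sets_bessel3_law)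
  \<comment> \<open>Each set is known to be null for one law only. The intersection still covers the
    exceptional set and is null for both.\<close>
  have "emeasure (bessel3_law P) (N1 \<inter> N2) = 0" "emeasure (neg_bessel3_law P) (N1 \<inter> N2) = 0"
    using N1 N2 emeasure_mono[of "N1 \<inter> N2" N1 "bessel3_law P"] emeasure_mono[of "N1 \<inter> N2" N2 "neg_bessel3_law P"]
    by (auto simp: sets_bessel3_law)
  then have "emeasure (sym_bessel3_law P) (N1 \<inter> N2) = 0"
    using N1 N2 by (simp add: emeasure_sym_bessel3_law)
  then show ?thesis
    using N1 N2 by (intro AE_I[of _ _ "N1 \<inter> N2"]) (auto simp: sp sets_sym_bessel3_law)
qed

lemma bridge_bessel_law_prob_space:
  assumes u: "0 < u" shows "prob_space (bridge_bessel_law P u)"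
proof -
  interpret B: prob_space "bridge_law P u" by (rule bridge_law_prob_space[OF u])
  interpret S: prob_space "sym_bessel3_law P" by (rule sym_bessel3_law_prob_space)
  interpret BS: pair_prob_space "bridge_law P u" "sym_bessel3_law P" ..
  show ?thesis
    unfolding bridge_bessel_law_def
    by (rule BS.P.prob_space_distr)
       (simp add: measurable_cong_sets[OF sets_pair_measure_cong[OF sets_bridge_law sets_sym_bessel3_law] refl]
          concat_path_measurable[OF u])
qed

end

section \<open>Fast null sequences of step functions\<close>

lemma sum_lessThan_split:
  fixes F :: "nat \<Rightarrow> 'a::comm_monoid_add"
  shows "(\<Sum>k<j + m. F k) = (\<Sum>k<j. F k) + (\<Sum>k<m. F (j + k))"
  by (induction m) (simp_all add: ac_simps)

lemma geometric_suminf_finite: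
  fixes a :: "nat \<Rightarrow> ennreal"
  assumes "C \<noteq> \<infinity>" and le: "\<And>n. a n \<le> C * ennreal ((1 / 2) ^ n)"
  shows "(\<Sum>n. a n) \<noteq> \<infinity>"
proof -
  have "(\<Sum>n. a n) \<le> (\<Sum>n. C * ennreal ((1 / 2) ^ n))"
    by (intro suminf_le le summableI)
  also have "\<dots> = C * (\<Sum>n. ennreal ((1 / 2) ^ n))" by (rule ennreal_suminf_cmult)
  also have "\<dots> < \<infinity>"
  proof (rule ennreal_mult_less_top[THEN iffD2, folded infinity_ennreal_def], intro disjI2 conjI)
    have "(\<Sum>n. ennreal ((1 / 2) ^ n)) \<noteq> top"
      by (intro ennreal_suminf_neq_top summable_geometric) auto
    then show "(\<Sum>n. ennreal ((1 / 2) ^ n)) < \<infinity>" by (simp add: less_top)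
    show "C < \<infinity>" using assms(1) by (simp add: less_top)
  qed
  finally show ?thesis by simp
qed

lemma step_along_cell_pos: "step_along g n q \<Longrightarrow> k < n \<Longrightarrow> q k < q (Suc k)"
  by (simp add: step_along_def partition_pts_def)

text \<open>On [0, u] the weight is at least \<open>1 / (1 + sqrt u)\<close>, so the weighted norm
  controls the unweighted integral that multiplies \<open>w u / u\<close> in the bridge.\<close>

lemma step_initial_sum_le:
  assumes g: "step_along g n q" and j: "j \<le> n"
  shows "ennreal (\<Sum>k<j. \<bar>g (q k)\<bar> * (q (Suc k) - q k)) \<le> ennreal (1 + sqrt (q j)) * (\<integral>\<^sup>+s. ennreal \<bar>g s\<bar> \<partial>weighted_ds)"
proof -
  note q = step_along_partition[OF g]
  have sf: "step_function g" using step_along_repr[OF g] by (auto simp: step_function_def)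
  let ?h = "\<lambda>s. ennreal (1 / (1 + sqrt s))"
  let ?u = "q j"
  have u: "0 \<le> ?u" by (rule partition_pts_nonneg[OF q j])
  have cell: "ennreal (q (Suc k) - q k) \<le> ennreal (1 + sqrt ?u) * (\<integral>\<^sup>+s. ?h s * indicator {q k..<q (Suc k)} s \<partial>lborel)"
    if k: "k < j" for k
  proof -
    have le: "0 \<le> q k" "q k < q (Suc k)" "q (Suc k) \<le> ?u"
      using partition_pts_nonneg[OF q, of k] partition_pts_mono[OF q, of "Suc k" j] step_along_cell_pos[OF g, of k] k j by auto
    have "ennreal (q (Suc k) - q k) = (\<integral>\<^sup>+s. indicator {q k..<q (Suc k)} s \<partial>lborel)"
      using le by simp
    also have "\<dots> \<le> (\<integral>\<^sup>+s. ennreal (1 + sqrt ?u) * (?h s * indicator {q k..<q (Suc k)} s) \<partial>lborel)"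
    proof (rule nn_integral_mono)
      fix s
      show "indicator {q k..<q (Suc k)} s \<le> ennreal (1 + sqrt ?u) * (?h s * indicator {q k..<q (Suc k)} s)"
      proof (cases "s \<in> {q k..<q (Suc k)}")
        case True
        then have s: "0 \<le> s" "s \<le> ?u" using le by auto
        have "0 < 1 + sqrt s" using s by (simp add: add_pos_nonneg)
        then have "1 \<le> (1 + sqrt ?u) * (1 / (1 + sqrt s))" using s by (simp add: field_simps)
        then have "ennreal 1 \<le> ennreal ((1 + sqrt ?u) * (1 / (1 + sqrt s)))" by (rule ennreal_leI)
        also have "\<dots> = ennreal (1 + sqrt ?u) * ennreal (1 / (1 + sqrt s))"
          using s u by (intro ennreal_mult) auto
        finally show ?thesis using True by (simp del: ennreal_plus)
      qed simp
    qed
    also have "\<dots> = ennreal (1 + sqrt ?u) * (\<integral>\<^sup>+s. ?h s * indicator {q k..<q (Suc k)} s \<partial>lborel)"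
      by (rule nn_integral_cmult) measurable
    finally show ?thesis .
  qed
  have pos: "0 \<le> q (Suc k) - q k" if "k < j" for k
    using step_along_cell_pos[OF g, of k] that j by simp
  have "ennreal (\<Sum>k<j. \<bar>g (q k)\<bar> * (q (Suc k) - q k)) = (\<Sum>k<j. ennreal \<bar>g (q k)\<bar> * ennreal (q (Suc k) - q k))"
    unfolding ennreal_mult'[OF abs_ge_zero, symmetric] using pos by (intro sum_ennreal[symmetric]) auto
  also have "\<dots> \<le> (\<Sum>k<j. ennreal \<bar>g (q k)\<bar> * (ennreal (1 + sqrt ?u) * (\<integral>\<^sup>+s. ?h s * indicator {q k..<q (Suc k)} s \<partial>lborel)))"
    using cell by (intro sum_mono mult_left_mono) auto
  also have "\<dots> \<le> (\<Sum>k<n. ennreal \<bar>g (q k)\<bar> * (ennreal (1 + sqrt ?u) * (\<integral>\<^sup>+s. ?h s * indicator {q k..<q (Suc k)} s \<partial>lborel)))"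
    using j by (intro sum_mono2) auto
  also have "\<dots> = ennreal (1 + sqrt ?u) * (\<Sum>k<n. ennreal \<bar>g (q k)\<bar> * (\<integral>\<^sup>+s. ?h s * indicator {q k..<q (Suc k)} s \<partial>lborel))"
    unfolding sum_distrib_left by (simp only: ac_simps)
  also have "(\<Sum>k<n. ennreal \<bar>g (q k)\<bar> * (\<integral>\<^sup>+s. ?h s * indicator {q k..<q (Suc k)} s \<partial>lborel)) = (\<integral>\<^sup>+s. ennreal \<bar>g s\<bar> \<partial>weighted_ds)"
    unfolding step_weighted_nn_integral[OF sf]
    by (rule step_along_nn_integral[OF g, where \<Phi> = "\<lambda>x. ennreal \<bar>x\<bar>", symmetric]) auto
  finally show ?thesis .
qed

text \<open>Each square-root increment is the integral of the kernel over its cell; adding the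
  nonnegative terms of the earlier cells completes the drift integral.\<close>

lemma step_tail_sum_le:
  assumes g: "step_along g (j + m) q"
  shows "ennreal (\<Sum>k<m. \<bar>g (q (j + k))\<bar> * (sqrt (q (Suc (j + k)) - q j) - sqrt (q (j + k) - q j))) \<le> bessel_drift g (q j)"
proof -
  note q = step_along_partition[OF g]
  let ?\<kappa> = "bessel_kernel (q j)"
  have pos: "q j \<le> q (j + k)" "q (j + k) < q (Suc (j + k))" if "k < m" for k
    using partition_pts_mono[OF q, of j "j + k"] step_along_cell_pos[OF g, of "j + k"] that by auto
  have "ennreal (\<Sum>k<m. \<bar>g (q (j + k))\<bar> * (sqrt (q (Suc (j + k)) - q j) - sqrt (q (j + k) - q j)))
    = (\<Sum>k<m. ennreal \<bar>g (q (j + k))\<bar> * ennreal (sqrt (q (Suc (j + k)) - q j) - sqrt (q (j + k) - q j)))"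
    unfolding ennreal_mult'[OF abs_ge_zero, symmetric] using pos
    by (intro sum_ennreal[symmetric] mult_nonneg_nonneg) (auto simp: less_imp_le)
  also have "\<dots> = (\<Sum>k<m. ennreal \<bar>g (q (j + k))\<bar> * (\<integral>\<^sup>+r. ?\<kappa> r * indicator {q (j + k)..<q (Suc (j + k))} r \<partial>lborel))"
    using pos by (intro sum.cong refl) (simp add: bessel_kernel_cell)
  also have "\<dots> \<le> (\<Sum>k<j + m. ennreal \<bar>g (q k)\<bar> * (\<integral>\<^sup>+r. ?\<kappa> r * indicator {q k..<q (Suc k)} r \<partial>lborel))"
    unfolding sum_lessThan_split by simp
  also have "\<dots> = bessel_drift g (q j)"
    unfolding bessel_drift_def
    by (rule step_along_nn_integral[OF g, where \<Phi> = "\<lambda>x. ennreal \<bar>x\<bar>", symmetric]) auto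
  finally show ?thesis .
qed

section \<open>Splitting the step integral at the junction of the two paths\<close>

definition left_sum :: "(real \<Rightarrow> real) \<Rightarrow> (nat \<Rightarrow> real) \<Rightarrow> nat \<Rightarrow> (real \<Rightarrow> real) \<Rightarrow> real" where
  "left_sum g q j x = (\<Sum>k<j. g (q k) * (x (q (Suc k)) - x (q k)))"

definition right_sum :: "(real \<Rightarrow> real) \<Rightarrow> (nat \<Rightarrow> real) \<Rightarrow> nat \<Rightarrow> nat \<Rightarrow> (real \<Rightarrow> real) \<Rightarrow> real" where
  "right_sum g q j m y = (\<Sum>k<m. g (q (j + k)) * (y (q (Suc (j + k)) - q j) - y (q (j + k) - q j)))"

text \<open>Since \<open>x u = y 0\<close> the concatenation takes its second branch after
  \<open>u\<close>; since both values are 0, the partition point \<open>u\<close> can be read from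
  either path.\<close>

lemma step_integral_concat_path:
  assumes g: "step_along g (j + m) q" and u: "q j = u" "0 < u" and xy: "x u = 0" "y 0 = 0"
  shows "step_integral g (concat_path u x y) = left_sum g q j x + right_sum g q j m y"
proof -
  note q = step_along_partition[OF g]
  have L: "concat_path u x y (q k) = x (q k)" if "k \<le> j" for k
  proof (cases "q k < u")
    case True
    then show ?thesis using partition_pts_nonneg[OF q, of k] that by (simp add: concat_path_def)
  next
    case False
    moreover have "q k \<le> q j" using that by (intro partition_pts_mono[OF q]) auto
    ultimately have "q k = u" using u by simp
    then show ?thesis using u xy by (simp add: concat_path_def)
  qed
  have R: "concat_path u x y (q k) = y (q k - u)" if "j \<le> k" "k \<le> j + m" for k
  proof -
    have "u \<le> q k" using partition_pts_mono[OF q, of j k] that u by simp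
    then show ?thesis using u xy by (simp add: concat_path_def)
  qed
  have "step_integral g (concat_path u x y) = (\<Sum>k<j + m. g (q k) * (concat_path u x y (q (Suc k)) - concat_path u x y (q k)))"
    by (rule step_integral_along[OF g])
  also have "\<dots> = left_sum g q j x + right_sum g q j m y"
    unfolding sum_lessThan_split left_sum_def right_sum_def u
    by (intro arg_cong2[where f = "(+)"] sum.cong refl) (simp_all add: L R)
  finally show ?thesis .
qed

lemma left_sum_measurable:
  assumes g: "step_along g (j + m) q"
  shows "left_sum g q j \<in> borel_measurable (path_space {0..q j})"
  unfolding left_sum_def[abs_def]
  using partition_pts_nonneg[OF step_along_partition[OF g]] partition_pts_mono[OF step_along_partition[OF g]]
  by (intro borel_measurable_sum borel_measurable_times borel_measurable_diff borel_measurable_const coordinate_measurable) auto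

lemma right_sum_measurable:
  assumes g: "step_along g (j + m) q"
  shows "right_sum g q j m \<in> borel_measurable \<Omega>"
proof -
  have "q j \<le> q (j + k)" if "k \<le> m" for k
    using partition_pts_mono[OF step_along_partition[OF g], of j "j + k"] that by simp
  from this[of "Suc _"] this show ?thesis
    unfolding right_sum_def[abs_def]
    by (intro borel_measurable_sum borel_measurable_times borel_measurable_diff borel_measurable_const coordinate_measurable) auto
qed

text \<open>The factors 4 and 2 are those produced by subtracting two fast approximations of the
  same function.\<close>

definition fast_null :: "(nat \<Rightarrow> real \<Rightarrow> real) \<Rightarrow> bool" where
  "fast_null g \<longleftrightarrow> (\<forall>n. step_function (g n) \<and>
     (\<integral>\<^sup>+s. ennreal (\<bar>g n s\<bar>\<^sup>2) \<partial>ds) \<le> ennreal (4 * (1 / 4) ^ n) \<and>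
     (\<integral>\<^sup>+s. ennreal \<bar>g n s\<bar> \<partial>weighted_ds) \<le> ennreal (2 * (1 / 2) ^ n))"

text \<open>Over each bounded range of \<open>u\<close> the integrated drifts form a geometric
  series, so their sum is finite for almost every \<open>u\<close> there; the ranges (0, N + 1)
  exhaust the half-line.\<close>

lemma AE_bessel_drift_finite:
  assumes g: "fast_null g"
  shows "AE u in lborel. 0 < u \<longrightarrow> (\<Sum>n. bessel_drift (g n) u) \<noteq> \<infinity>"
proof -
  have sf: "step_function (g n)" for n using g by (simp add: fast_null_def)
  have scale: "ennreal C * ennreal (2 * p) = ennreal (C * 2) * ennreal p" if "0 \<le> C" "0 \<le> p" for C p :: real
    using that by (simp add: ennreal_mult[symmetric] mult.assoc)
  note [measurable] = bessel_drift_measurable[OF sf]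
  have "AE u in lborel. (\<Sum>n. bessel_drift (g n) u * indicator {0<..<real (Suc N)} u) \<noteq> \<infinity>" for N
  proof (rule nn_integral_PInf_AE)
    let ?U = "real (Suc N)"
    have "(\<integral>\<^sup>+u. (\<Sum>n. bessel_drift (g n) u * indicator {0<..<?U} u) \<partial>lborel)
      = (\<Sum>n. \<integral>\<^sup>+u. bessel_drift (g n) u * indicator {0<..<?U} u \<partial>lborel)"
      by (rule nn_integral_suminf) measurable
    also have "\<dots> \<noteq> \<infinity>"
    proof (rule geometric_suminf_finite)
      fix n
      have "(\<integral>\<^sup>+u. bessel_drift (g n) u * indicator {0<..<?U} u \<partial>lborel) \<le> ennreal (?U + sqrt ?U) * (\<integral>\<^sup>+s. ennreal \<bar>g n s\<bar> \<partial>weighted_ds)"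
        by (rule bessel_drift_nn_integral_le[OF sf]) simp
      also have "\<dots> \<le> ennreal (?U + sqrt ?U) * ennreal (2 * (1 / 2) ^ n)"
        using g by (intro mult_left_mono) (auto simp: fast_null_def)
      also have "\<dots> = ennreal ((?U + sqrt ?U) * 2) * ennreal ((1 / 2) ^ n)"
        by (rule scale) simp_all
      finally show "(\<integral>\<^sup>+u. bessel_drift (g n) u * indicator {0<..<?U} u \<partial>lborel) \<le> \<dots>" .
    qed simp
    finally show "(\<integral>\<^sup>+u. (\<Sum>n. bessel_drift (g n) u * indicator {0<..<?U} u) \<partial>lborel) \<noteq> \<infinity>" .
  qed measurable
  then have "AE u in lborel. \<forall>N. (\<Sum>n. bessel_drift (g n) u * indicator {0<..<real (Suc N)} u) \<noteq> \<infinity>"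
    by (simp add: AE_all_countable)
  then show ?thesis
  proof eventually_elim
    case (elim u)
    show ?case
    proof
      assume "0 < u"
      moreover obtain N where "u < real N" using reals_Archimedean2 by blast
      ultimately have "u \<in> {0<..<real (Suc N)}" by simp
      with elim[rule_format, of N] show "(\<Sum>n. bessel_drift (g n) u) \<noteq> \<infinity>" by simp
    qed
  qed
qed

context
  fixes P :: "(real \<Rightarrow> real) measure"
  assumes P: "wiener_measure P"
begin

interpretation P: prob_space P by (rule wiener_prob_space[OF P])
interpretation P3: prob_space "wiener3 P" by (rule wiener3_prob_space[OF P])

text \<open>First moment of the slope subtracted in the bridge. It is taken from the increment
  \<open>w u - w 0\<close>, whose law is given, and \<open>w 0\<close> vanishes almost
  surely.\<close>

lemma wiener_abs_nn_integral_finite: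
  assumes u: "0 < u" shows "(\<integral>\<^sup>+w. ennreal (\<bar>w u\<bar> / u) \<partial>P) \<noteq> \<infinity>"
proof -
  have [measurable]: "(\<lambda>w. w u) \<in> borel_measurable P"
    using u by (intro wiener_coordinate_measurable[OF P]) simp
  have "integrable P (\<lambda>w. \<bar>w u - w 0\<bar> / u)"
    using wiener_increment_moments(3)[OF P order_refl u] by auto
  then have "(\<integral>\<^sup>+w. ennreal (\<bar>w u - w 0\<bar> / u) \<partial>P) \<noteq> \<infinity>"
    using u by (subst nn_integral_eq_integral) auto
  moreover have "(\<integral>\<^sup>+w. ennreal (\<bar>w u - w 0\<bar> / u) \<partial>P) = (\<integral>\<^sup>+w. ennreal (\<bar>w u\<bar> / u) \<partial>P)"
    using wiener_start[OF P] by (intro nn_integral_cong_AE) (auto elim!: eventually_mono)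
  ultimately show ?thesis by simp
qed

text \<open>The subtracted path is linear in time, so it contributes \<open>w u / u\<close> times an
  ordinary integral of \<open>g\<close> over [0, u]; the triangle inequality separates it from the
  Wiener sum.\<close>

lemma bridge_left_sum_le:
  assumes u: "0 < u" and g: "step_along g n q" and j: "j \<le> n" "q j = u" and d: "0 < d"
  shows "(\<integral>\<^sup>+x. ennreal \<bar>left_sum g q j x\<bar> \<partial>bridge_law P u)
    \<le> ennreal d + ennreal (1 / d) * (\<integral>\<^sup>+s. ennreal (\<bar>g s\<bar>\<^sup>2) \<partial>ds)
      + (\<integral>\<^sup>+w. ennreal (\<bar>w u\<bar> / u) \<partial>P) * (ennreal (1 + sqrt u) * (\<integral>\<^sup>+s. ennreal \<bar>g s\<bar> \<partial>weighted_ds))"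
proof -
  note q = step_along_partition[OF g]
  have qk: "0 \<le> q k" "q k \<le> u" if "k \<le> j" for k
    using partition_pts_nonneg[OF q, of k] partition_pts_mono[OF q, of k j] that j by auto
  define S where "S w = (\<Sum>k<j. g (q k) * (w (q (Suc k)) - w (q k)))" for w
  define V where "V = (\<Sum>k<j. \<bar>g (q k)\<bar> * (q (Suc k) - q k))"
  have V0: "0 \<le> V"
    unfolding V_def using step_along_cell_pos[OF g] j by (intro sum_nonneg mult_nonneg_nonneg) (auto simp: less_imp_le)
  have [measurable]: "S \<in> borel_measurable P" "(\<lambda>w. w u) \<in> borel_measurable P"
    unfolding S_def using qk u
    by (intro borel_measurable_sum borel_measurable_times borel_measurable_diff borel_measurable_const wiener_coordinate_measurable[OF P]; simp)+
  have left: "\<bar>left_sum g q j (\<lambda>t\<in>{0..u}. w t - t / u * w u)\<bar> \<le> \<bar>S w\<bar> + \<bar>w u\<bar> / u * V" for w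
  proof -
    have "left_sum g q j (\<lambda>t\<in>{0..u}. w t - t / u * w u)
      = (\<Sum>k<j. g (q k) * (w (q (Suc k)) - w (q k)) - w u / u * (g (q k) * (q (Suc k) - q k)))"
      unfolding left_sum_def using qk by (intro sum.cong refl) (simp add: algebra_simps diff_divide_distrib)
    also have "\<dots> = S w - w u / u * (\<Sum>k<j. g (q k) * (q (Suc k) - q k))"
      by (simp add: S_def sum_subtractf sum_distrib_left)
    also have "\<bar>\<dots>\<bar> \<le> \<bar>S w\<bar> + \<bar>w u\<bar> / u * \<bar>\<Sum>k<j. g (q k) * (q (Suc k) - q k)\<bar>"
      using u by (intro order_trans[OF abs_triangle_ineq4]) (simp add: abs_mult)
    also have "\<dots> \<le> \<bar>S w\<bar> + \<bar>w u\<bar> / u * V"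
    proof (intro add_left_mono mult_left_mono)
      have "\<bar>\<Sum>k<j. g (q k) * (q (Suc k) - q k)\<bar> \<le> (\<Sum>k<j. \<bar>g (q k) * (q (Suc k) - q k)\<bar>)"
        by (rule sum_abs)
      also have "\<dots> = V"
        unfolding V_def using step_along_cell_pos[OF g] j by (intro sum.cong refl) (simp add: abs_mult less_imp_le)
      finally show "\<bar>\<Sum>k<j. g (q k) * (q (Suc k) - q k)\<bar> \<le> V" .
    qed (use u in simp)
    finally show ?thesis .
  qed
  have "left_sum g q j \<in> borel_measurable (path_space {0..u})"
    using left_sum_measurable[of g j "n - j" q] g j by simp
  then have "(\<integral>\<^sup>+x. ennreal \<bar>left_sum g q j x\<bar> \<partial>bridge_law P u)
    = (\<integral>\<^sup>+w. ennreal \<bar>left_sum g q j (\<lambda>t\<in>{0..u}. w t - t / u * w u)\<bar> \<partial>P)"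
    unfolding bridge_law_def by (intro nn_integral_distr bridge_map_measurable[OF P u]) simp
  also have "\<dots> \<le> (\<integral>\<^sup>+w. ennreal \<bar>S w\<bar> + ennreal (\<bar>w u\<bar> / u) * ennreal V \<partial>P)"
    using left V0 u by (intro nn_integral_mono) (simp add: ennreal_mult'[symmetric] ennreal_plus[symmetric] ennreal_leI del: ennreal_plus)
  also have "\<dots> = (\<integral>\<^sup>+w. ennreal \<bar>S w\<bar> \<partial>P) + (\<integral>\<^sup>+w. ennreal (\<bar>w u\<bar> / u) \<partial>P) * ennreal V"
    by (subst nn_integral_add) (simp_all add: nn_integral_multc)
  also have "(\<integral>\<^sup>+w. ennreal \<bar>S w\<bar> \<partial>P) \<le> ennreal d + ennreal (1 / d) * (\<integral>\<^sup>+w. ennreal ((S w)\<^sup>2) \<partial>P)"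
    by (rule P.nn_integral_abs_le_square) (use d in auto)
  also have "(\<integral>\<^sup>+w. ennreal ((S w)\<^sup>2) \<partial>P) \<le> ennreal (\<Sum>k<j. (g (q k))\<^sup>2 * (q (Suc k) - q k))"
    unfolding S_def using qk step_along_cell_pos[OF g] j by (intro wiener_step_sum_square_le[OF P]) auto
  also have "\<dots> \<le> ennreal (\<Sum>k<n. (g (q k))\<^sup>2 * (q (Suc k) - q k))"
    using step_along_cell_pos[OF g] j by (intro ennreal_leI sum_mono2) (auto simp: less_imp_le)
  also have "\<dots> = (\<integral>\<^sup>+s. ennreal (\<bar>g s\<bar>\<^sup>2) \<partial>ds)"
    by (rule step_along_square_nn_integral[OF g, symmetric])
  also have "ennreal V \<le> ennreal (1 + sqrt u) * (\<integral>\<^sup>+s. ennreal \<bar>g s\<bar> \<partial>weighted_ds)"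
    unfolding V_def j(2)[symmetric] by (rule step_initial_sum_le[OF g j(1)])
  finally show ?thesis by (simp add: add_mono mult_left_mono)
qed

lemma bessel3_law_nn_integral:
  assumes [measurable]: "F \<in> borel_measurable \<Omega>"
  shows "(\<integral>\<^sup>+y. F y \<partial>bessel3_law P) = (\<integral>\<^sup>+z. F (\<lambda>t\<in>{0..}. norm (path3 z t)) \<partial>wiener3 P)"
proof -
  have "(\<lambda>(a, b, c). \<lambda>t\<in>{0..}. sqrt ((a t)\<^sup>2 + (b t)\<^sup>2 + (c t)\<^sup>2)) = (\<lambda>z. \<lambda>t\<in>{0..}. norm (path3 z t))"
    by (auto simp: norm_path3)
  then show ?thesis
    unfolding bessel3_law_def using nn_integral_distr[OF bessel_map_measurable[OF P], of F] assms by simp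
qed

lemma neg_bessel3_law_nn_integral:
  assumes [measurable]: "F \<in> borel_measurable \<Omega>"
  shows "(\<integral>\<^sup>+y. F y \<partial>neg_bessel3_law P) = (\<integral>\<^sup>+y. F (\<lambda>t\<in>{0..}. - y t) \<partial>bessel3_law P)"
  unfolding neg_bessel3_law_def
  by (intro nn_integral_distr)
     (simp_all add: measurable_cong_sets[OF sets_bessel3_law(1)[OF P] refl] neg_path_measurable)

text \<open>\<open>path3_step_sum_le\<close> is applied along the shifted times \<open>p k\<close>,
  which start at 0 with the Bessel path. The sum is odd in the path, so negation leaves the bound
  unchanged.\<close>

lemma bessel_right_sum_le:
  assumes g: "step_along g (j + m) q" and d: "0 < d"
  shows "(\<integral>\<^sup>+y. ennreal \<bar>right_sum g q j m y\<bar> \<partial>bessel3_law P)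
    \<le> ennreal d + ennreal (1 / d) * (ennreal normal3_second_moment * (\<integral>\<^sup>+s. ennreal (\<bar>g s\<bar>\<^sup>2) \<partial>ds))
      + ennreal normal3_mean * bessel_drift g (q j)" (is "?L \<le> ?R")
    and "(\<integral>\<^sup>+y. ennreal \<bar>right_sum g q j m y\<bar> \<partial>neg_bessel3_law P)
    \<le> ennreal d + ennreal (1 / d) * (ennreal normal3_second_moment * (\<integral>\<^sup>+s. ennreal (\<bar>g s\<bar>\<^sup>2) \<partial>ds))
      + ennreal normal3_mean * bessel_drift g (q j)"
proof -
  note q = step_along_partition[OF g]
  define p where "p k = q (j + k) - q j" for k
  have p0: "p 0 = 0" by (simp add: p_def)
  have pS: "p k < p (Suc k)" if "k < m" for k
    using step_along_cell_pos[OF g, of "j + k"] that by (simp add: p_def)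
  have pn: "0 \<le> p k" if "k \<le> m" for k
    using partition_pts_mono[OF q, of j "j + k"] that by (simp add: p_def)
  have n0: "0 \<le> normal3_second_moment" "0 \<le> normal3_mean"
    by (simp_all add: normal3_second_moment_def normal3_mean_def)
  have [measurable]: "right_sum g q j m \<in> borel_measurable \<Omega>" by (rule right_sum_measurable[OF g])
  have "?L = (\<integral>\<^sup>+z. ennreal \<bar>right_sum g q j m (\<lambda>t\<in>{0..}. norm (path3 z t))\<bar> \<partial>wiener3 P)"
    by (rule bessel3_law_nn_integral) measurable
  also have "\<dots> = (\<integral>\<^sup>+z. ennreal \<bar>\<Sum>k<m. g (q (j + k)) * (norm (path3 z (p (Suc k))) - norm (path3 z (p k)))\<bar> \<partial>wiener3 P)"
  proof (intro nn_integral_cong arg_cong[where f = "\<lambda>x. ennreal \<bar>x\<bar>"])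
    fix z
    show "right_sum g q j m (\<lambda>t\<in>{0..}. norm (path3 z t)) = (\<Sum>k<m. g (q (j + k)) * (norm (path3 z (p (Suc k))) - norm (path3 z (p k))))"
      unfolding right_sum_def
    proof (intro sum.cong refl)
      fix k assume "k \<in> {..<m}"
      then have "0 \<le> q (Suc (j + k)) - q j" "0 \<le> q (j + k) - q j" using pn[of k] pn[of "Suc k"] by (auto simp: p_def)
      then show "g (q (j + k)) * ((\<lambda>t\<in>{0..}. norm (path3 z t)) (q (Suc (j + k)) - q j) - (\<lambda>t\<in>{0..}. norm (path3 z t)) (q (j + k) - q j))
        = g (q (j + k)) * (norm (path3 z (p (Suc k))) - norm (path3 z (p k)))"
        by (simp add: p_def)
    qed
  qed
  also have "\<dots> \<le> ennreal d + ennreal (1 / d) * ennreal (normal3_second_moment * (\<Sum>k<m. (g (q (j + k)))\<^sup>2 * (p (Suc k) - p k)))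
      + ennreal (normal3_mean * (\<Sum>k<m. \<bar>g (q (j + k))\<bar> * (sqrt (p (Suc k)) - sqrt (p k))))"
    by (rule path3_step_sum_le[OF P p0 pS d])
  also have "ennreal (normal3_second_moment * (\<Sum>k<m. (g (q (j + k)))\<^sup>2 * (p (Suc k) - p k)))
    = ennreal normal3_second_moment * ennreal (\<Sum>k<m. (g (q (j + k)))\<^sup>2 * (q (Suc (j + k)) - q (j + k)))"
    using n0 by (simp add: ennreal_mult' p_def)
  also have "ennreal (\<Sum>k<m. (g (q (j + k)))\<^sup>2 * (q (Suc (j + k)) - q (j + k))) \<le> ennreal (\<Sum>k<j + m. (g (q k))\<^sup>2 * (q (Suc k) - q k))"
  proof -
    have "0 \<le> (\<Sum>k<j. (g (q k))\<^sup>2 * (q (Suc k) - q k))"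
      using step_along_cell_pos[OF g] by (intro sum_nonneg mult_nonneg_nonneg) (auto simp: less_imp_le)
    then show ?thesis unfolding sum_lessThan_split by (intro ennreal_leI) simp
  qed
  also have "\<dots> = (\<integral>\<^sup>+s. ennreal (\<bar>g s\<bar>\<^sup>2) \<partial>ds)"
    by (rule step_along_square_nn_integral[OF g, symmetric])
  also have "ennreal (normal3_mean * (\<Sum>k<m. \<bar>g (q (j + k))\<bar> * (sqrt (p (Suc k)) - sqrt (p k))))
    = ennreal normal3_mean * ennreal (\<Sum>k<m. \<bar>g (q (j + k))\<bar> * (sqrt (q (Suc (j + k)) - q j) - sqrt (q (j + k) - q j)))"
    using n0 by (simp add: ennreal_mult' p_def)
  also have "\<dots> \<le> ennreal normal3_mean * bessel_drift g (q j)"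
    by (intro mult_left_mono step_tail_sum_le[OF g]) simp
  finally show L: "?L \<le> ?R" by (simp add: add_mono mult_left_mono)
  have "(\<integral>\<^sup>+y. ennreal \<bar>right_sum g q j m y\<bar> \<partial>neg_bessel3_law P)
    = (\<integral>\<^sup>+y. ennreal \<bar>right_sum g q j m (\<lambda>t\<in>{0..}. - y t)\<bar> \<partial>bessel3_law P)"
    by (rule neg_bessel3_law_nn_integral) measurable
  also have "\<dots> = ?L"
  proof (intro nn_integral_cong arg_cong[where f = ennreal])
    fix y :: "real \<Rightarrow> real"
    have "right_sum g q j m (\<lambda>t\<in>{0..}. - y t) = - right_sum g q j m y"
      unfolding right_sum_def sum_negf[symmetric]
    proof (intro sum.cong refl)
      fix k assume "k \<in> {..<m}"
      then have "0 \<le> q (Suc (j + k)) - q j" "0 \<le> q (j + k) - q j" using pn[of k] pn[of "Suc k"] by (auto simp: p_def)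
      then show "g (q (j + k)) * ((\<lambda>t\<in>{0..}. - y t) (q (Suc (j + k)) - q j) - (\<lambda>t\<in>{0..}. - y t) (q (j + k) - q j))
        = - (g (q (j + k)) * (y (q (Suc (j + k)) - q j) - y (q (j + k) - q j)))"
        by (simp add: algebra_simps)
    qed
    then show "\<bar>right_sum g q j m (\<lambda>t\<in>{0..}. - y t)\<bar> = \<bar>right_sum g q j m y\<bar>" by simp
  qed
  finally show "(\<integral>\<^sup>+y. ennreal \<bar>right_sum g q j m y\<bar> \<partial>neg_bessel3_law P) \<le> ?R" using L by simp
qed

lemma sym_bessel3_law_start: "AE y in sym_bessel3_law P. y 0 = 0"
proof (rule AE_sym_bessel3_law[OF P])
  let ?F = "\<lambda>y :: real \<Rightarrow> real. ennreal \<bar>y 0\<bar>"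
  have [measurable]: "?F \<in> borel_measurable \<Omega>" by measurable
  have "(\<integral>\<^sup>+y. ?F y \<partial>bessel3_law P) = (\<integral>\<^sup>+z. ennreal (norm (path3 z 0)) \<partial>wiener3 P)"
    by (subst bessel3_law_nn_integral) auto
  also have "\<dots> = (\<integral>\<^sup>+z. 0 \<partial>wiener3 P)"
    using path3_start[OF P] by (intro nn_integral_cong_AE) auto
  finally have b: "(\<integral>\<^sup>+y. ?F y \<partial>bessel3_law P) = 0" by simp
  moreover have m: "?F \<in> borel_measurable (bessel3_law P)" "?F \<in> borel_measurable (neg_bessel3_law P)"
    by (simp_all add: measurable_cong_sets[OF sets_bessel3_law(1)[OF P] refl] measurable_cong_sets[OF sets_bessel3_law(2)[OF P] refl])
  ultimately show "AE y in bessel3_law P. y 0 = 0"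
    by (subst (asm) nn_integral_0_iff_AE) auto
  have "(\<integral>\<^sup>+y. ?F y \<partial>neg_bessel3_law P) = 0"
    using b by (subst neg_bessel3_law_nn_integral) auto
  with m(2) show "AE y in neg_bessel3_law P. y 0 = 0"
    by (subst (asm) nn_integral_0_iff_AE) auto
qed

lemma bridge_law_end:
  assumes u: "0 < u" shows "AE x in bridge_law P u. x u = 0"
proof -
  have m: "(\<lambda>x. ennreal \<bar>x u\<bar>) \<in> borel_measurable (path_space {0..u})" using u by simp
  have "(\<integral>\<^sup>+x. ennreal \<bar>x u\<bar> \<partial>bridge_law P u) = 0"
    unfolding bridge_law_def using u m by (subst nn_integral_distr[OF bridge_map_measurable[OF P u]]) auto
  moreover have "(\<lambda>x. ennreal \<bar>x u\<bar>) \<in> borel_measurable (bridge_law P u)"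
    using m by (simp add: measurable_cong_sets[OF sets_bridge_law[OF P] refl])
  ultimately show ?thesis by (subst (asm) nn_integral_0_iff_AE) auto
qed

end

section \<open>Convergence under \<open>\<W>\<close>\<close>

text \<open>\<open>nn_integral\<close> is a supremum over simple functions below \<open>f\<close>,
  whether or not \<open>f\<close> is measurable. A sequence of them attains it, and their pointwise
  supremum is a measurable function below \<open>f\<close>.\<close>

lemma nn_integral_measurable_minorant:
  "\<exists>g\<in>borel_measurable M. (\<forall>x. g x \<le> f x) \<and> (\<integral>\<^sup>+x. g x \<partial>M) = (\<integral>\<^sup>+x. f x \<partial>M)"
proof -
  let ?S = "{g. simple_function M g \<and> g \<le> f}"
  have "(\<lambda>_. 0) \<in> ?S" by (auto simp: le_fun_def)
  then have "integral\<^sup>S M ` ?S \<noteq> {}" by blast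
  from ennreal_Sup_countable_SUP[OF this] obtain a :: "nat \<Rightarrow> ennreal" where a: "range a \<subseteq> integral\<^sup>S M ` ?S" "Sup (integral\<^sup>S M ` ?S) = (SUP i. a i)"
    by (elim exE conjE)
  have "\<forall>i. \<exists>g. simple_function M g \<and> g \<le> f \<and> a i = integral\<^sup>S M g"
  proof
    fix i
    have "a i \<in> integral\<^sup>S M ` ?S" using a(1) by (rule subsetD) (rule rangeI)
    then show "\<exists>g. simple_function M g \<and> g \<le> f \<and> a i = integral\<^sup>S M g" by (elim imageE) blast
  qed
  from choice[OF this] obtain g where g: "\<And>i. simple_function M (g i)" "\<And>i. g i \<le> f" "\<And>i. a i = integral\<^sup>S M (g i)"
    by blast
  define G where "G x = (SUP i. g i x)" for x
  have [measurable]: "g i \<in> borel_measurable M" for i by (rule borel_measurable_simple_function[OF g(1)])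
  have "G \<in> borel_measurable M" unfolding G_def by measurable
  moreover have le: "G x \<le> f x" for x
    unfolding G_def using g(2) by (auto intro!: SUP_least simp: le_fun_def)
  moreover have "(\<integral>\<^sup>+x. f x \<partial>M) \<le> (\<integral>\<^sup>+x. G x \<partial>M)"
  proof -
    have "(\<integral>\<^sup>+x. f x \<partial>M) = (SUP i. a i)" using a(2) by (simp add: nn_integral_def)
    also have "\<dots> \<le> (\<integral>\<^sup>+x. G x \<partial>M)"
    proof (rule SUP_least)
      fix i
      have "a i = (\<integral>\<^sup>+x. g i x \<partial>M)" using g by (simp add: nn_integral_eq_simple_integral)
      also have "\<dots> \<le> (\<integral>\<^sup>+x. G x \<partial>M)" unfolding G_def by (intro nn_integral_mono SUP_upper) simp
      finally show "a i \<le> (\<integral>\<^sup>+x. G x \<partial>M)" .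
    qed
    finally show ?thesis .
  qed
  moreover have "(\<integral>\<^sup>+x. G x \<partial>M) \<le> (\<integral>\<^sup>+x. f x \<partial>M)" by (intro nn_integral_mono le)
  ultimately show ?thesis by (intro bexI[of _ G] conjI allI antisym) auto
qed

text \<open>The integral of a non-measurable function is a lower integral, for which dominated
  convergence to \<open>0\<close> still holds. So no measurability in \<open>u\<close> of the laws below is needed.\<close>

lemma nn_integral_tendsto_zero:
  fixes F :: "nat \<Rightarrow> 'a \<Rightarrow> ennreal"
  assumes le: "\<And>n x. F n x \<le> W x" and W: "(\<integral>\<^sup>+x. W x \<partial>M) < \<infinity>"
    and lim: "AE x in M. (\<lambda>n. F n x) \<longlonglongrightarrow> 0"
  shows "(\<lambda>n. \<integral>\<^sup>+x. F n x \<partial>M) \<longlonglongrightarrow> 0"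
proof -
  have "\<forall>n. \<exists>g. g \<in> borel_measurable M \<and> (\<forall>x. g x \<le> F n x) \<and> (\<integral>\<^sup>+x. g x \<partial>M) = (\<integral>\<^sup>+x. F n x \<partial>M)"
    using nn_integral_measurable_minorant[of M] unfolding Bex_def by (intro allI)
  from choice[OF this]
  obtain g where g[measurable]: "\<And>n. g n \<in> borel_measurable M" and gF: "\<And>n x. g n x \<le> F n x"
    and eq: "\<And>n. (\<integral>\<^sup>+x. g n x \<partial>M) = (\<integral>\<^sup>+x. F n x \<partial>M)"
    by blast
  have "(\<lambda>n. \<integral>\<^sup>+x. g n x \<partial>M) \<longlonglongrightarrow> (\<integral>\<^sup>+x. 0 \<partial>M)"
  \<comment> \<open>\<open>W\<close> may fail to be measurable, so it cannot serve as the majorant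
    itself; the supremum of the minorants is measurable and stays below \<open>W\<close>.\<close>
  proof (rule nn_integral_dominated_convergence[where w = "\<lambda>x. SUP n. g n x"])
    show "AE x in M. g j x \<le> (SUP n. g n x)" for j by (intro AE_I2 SUP_upper) simp
    have "(\<integral>\<^sup>+x. (SUP n. g n x) \<partial>M) \<le> (\<integral>\<^sup>+x. W x \<partial>M)"
      by (intro nn_integral_mono SUP_least order_trans[OF gF le])
    then show "(\<integral>\<^sup>+x. (SUP n. g n x) \<partial>M) < \<infinity>" using W by (rule le_less_trans)
    show "AE x in M. (\<lambda>i. g i x) \<longlonglongrightarrow> 0"
      using lim
    proof eventually_elim
      case (elim x)
      show ?case by (rule tendsto_sandwich[OF _ _ tendsto_const elim]) (auto simp: gF)
    qed
  qed measurable
  then show ?thesis by (simp add: eq)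
qed

lemma AE_tendsto_imp_emeasure_tendsto_0:
  fixes S :: "nat \<Rightarrow> 'a \<Rightarrow> real"
  assumes M: "finite_measure M" and S[measurable]: "\<And>n. S n \<in> borel_measurable M" "Z \<in> borel_measurable M"
    and A[measurable]: "A \<in> sets M" and e: "0 < e"
    and lim: "AE w in M. (\<lambda>n. S n w) \<longlonglongrightarrow> Z w"
  shows "(\<lambda>n. emeasure M (A \<inter> {w \<in> space M. \<bar>S n w - Z w\<bar> \<ge> e})) \<longlonglongrightarrow> 0"
proof -
  interpret finite_measure M by fact
  define B where "B n = A \<inter> {w \<in> space M. \<bar>S n w - Z w\<bar> \<ge> e}" for n
  have [measurable]: "B n \<in> sets M" for n unfolding B_def by measurable
  have "(\<lambda>n. \<integral>\<^sup>+w. indicator (B n) w \<partial>M) \<longlonglongrightarrow> (\<integral>\<^sup>+w. 0 \<partial>M)"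
  proof (rule nn_integral_dominated_convergence[where w = "\<lambda>_. 1"])
    show "AE w in M. (\<lambda>n. indicator (B n) w :: ennreal) \<longlonglongrightarrow> 0"
      using lim
    proof eventually_elim
      case (elim w)
      then have "eventually (\<lambda>n. \<bar>S n w - Z w\<bar> < e) sequentially"
        using e by (auto dest: tendstoD simp: dist_real_def)
      then have "eventually (\<lambda>n. (indicator (B n) w :: ennreal) = 0) sequentially"
        by eventually_elim (auto simp: B_def)
      then show ?case by (rule tendsto_eventually)
    qed
  qed (auto simp: indicator_def less_top[symmetric])
  then show ?thesis by (simp add: B_def[symmetric])
qed

lemma AE_pair_fst:
  assumes "prob_space N" "AE x in M. Q x" shows "AE z in M \<Otimes>\<^sub>M N. Q (fst z)"
proof (rule AE_distrD[OF measurable_fst])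
  interpret prob_space N by fact
  show "AE x in distr (M \<Otimes>\<^sub>M N) M fst. Q x" unfolding distr_pair_fst by fact
qed

lemma AE_pair_snd:
  assumes "prob_space M" "prob_space N" "AE x in N. Q x" shows "AE z in M \<Otimes>\<^sub>M N. Q (snd z)"
proof (rule AE_distrD[OF measurable_snd])
  show "AE x in distr (M \<Otimes>\<^sub>M N) N snd. Q x" unfolding distr_pair_snd[OF assms(1,2)] by fact
qed

lemma suminf_add_mult_finite:
  fixes a b :: "nat \<Rightarrow> ennreal"
  assumes le: "\<And>n. c n \<le> a n + C * b n" and fin: "(\<Sum>n. a n) \<noteq> \<infinity>" "(\<Sum>n. b n) \<noteq> \<infinity>" "C \<noteq> \<infinity>"
  shows "(\<Sum>n. c n) \<noteq> \<infinity>"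
proof -
  have "(\<Sum>n. c n) \<le> (\<Sum>n. a n + C * b n)" by (intro suminf_le le summableI)
  also have "\<dots> = (\<Sum>n. a n) + C * (\<Sum>n. b n)"
    by (subst suminf_add[symmetric]) (auto simp: ennreal_suminf_cmult)
  also have "\<dots> < \<infinity>" using fin by (simp add: less_top[symmetric] ennreal_mult_eq_top_iff)
  finally show ?thesis by simp
qed

text \<open>The choice \<open>d = (1 / 2) ^ n\<close> balances the two terms, since
  \<open>(1 / 4) ^ n / d = (1 / 2) ^ n\<close>. \<open>K\<close> is 1 for the bridge and
  \<open>normal3_second_moment\<close> for the Bessel part.\<close>

lemma fast_null_square_le:
  assumes g: "fast_null g" and K: "0 \<le> K"
  shows "ennreal ((1 / 2) ^ n) + ennreal (1 / (1 / 2) ^ n) * (ennreal K * (\<integral>\<^sup>+s. ennreal (\<bar>g n s\<bar>\<^sup>2) \<partial>ds))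
    \<le> ennreal (1 + 4 * K) * ennreal ((1 / 2) ^ n)"
proof -
  have "ennreal ((1 / 2) ^ n) + ennreal (1 / (1 / 2) ^ n) * (ennreal K * (\<integral>\<^sup>+s. ennreal (\<bar>g n s\<bar>\<^sup>2) \<partial>ds))
    \<le> ennreal ((1 / 2) ^ n) + ennreal (1 / (1 / 2) ^ n) * (ennreal K * ennreal (4 * (1 / 4) ^ n))"
    using g by (intro add_left_mono mult_left_mono) (auto simp: fast_null_def)
  also have "\<dots> = ennreal ((1 / 2) ^ n + 1 / (1 / 2) ^ n * (K * (4 * (1 / 4) ^ n)))"
    using K by (simp add: ennreal_mult[symmetric] ennreal_plus[symmetric] del: ennreal_plus)
  also have "(1 / 2) ^ n + 1 / (1 / 2) ^ n * (K * (4 * (1 / 4) ^ n)) = (1 + 4 * K) * (1 / 2 :: real) ^ n"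
  proof -
    have "(1 / 4 :: real) ^ n = (1 / 2) ^ n * (1 / 2) ^ n" by (simp add: power_mult_distrib[symmetric])
    then show ?thesis by (simp add: field_simps)
  qed
  also have "ennreal ((1 + 4 * K) * (1 / 2) ^ n) = ennreal (1 + 4 * K) * ennreal ((1 / 2) ^ n)"
    using K by (intro ennreal_mult) auto
  finally show ?thesis .
qed

context
  fixes P :: "(real \<Rightarrow> real) measure"
  assumes P: "wiener_measure P"
begin

text \<open>A time \<open>u\<close> with finite total drift is fixed; both halves of the integrals
  then have summable first moments, and the concatenation map carries almost sure summability to the
  image law.\<close>

lemma fast_null_AE_summable:
  assumes g: "fast_null g"
  shows "AE u in lborel. 0 < u \<longrightarrow>
    (AE w in bridge_bessel_law P u. summable (\<lambda>n. \<bar>step_integral (g n) w\<bar>))"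
  using AE_bessel_drift_finite[OF g]
proof eventually_elim
  case (elim u)
  show ?case
  proof
    assume u: "0 < u"
    with elim have drift: "(\<Sum>n. bessel_drift (g n) u) \<noteq> \<infinity>" by simp
    have sf: "step_function (g n)" for n using g by (simp add: fast_null_def)
    \<comment> \<open>Each \<open>g n\<close> has its own partition, in which \<open>u\<close> sits
      at its own index \<open>j n\<close>; no partition common to all \<open>n\<close> is available
      in general.\<close>
    have "\<forall>n. \<exists>j m q. step_along (g n) (j + m) q \<and> q j = u"
    proof
      fix n
      obtain N q j where "step_along (g n) N q" "j \<le> N" "q j = u"
        using step_function_common_partition[OF sf sf, of u n n] u by auto
      then show "\<exists>j m q. step_along (g n) (j + m) q \<and> q j = u"
        by (intro exI[of _ j] exI[of _ "N - j"] exI[of _ q]) simp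
    qed
    then obtain j m q where along: "\<And>n. step_along (g n) (j n + m n) (q n)" and qu: "\<And>n. q n (j n) = u"
      by metis
    define L where "L n = left_sum (g n) (q n) (j n)" for n
    define R where "R n = right_sum (g n) (q n) (j n) (m n)" for n
    have L[measurable]: "L n \<in> borel_measurable (path_space {0..u})" for n
      using left_sum_measurable[OF along[of n]] by (simp add: L_def qu)
    have R[measurable]: "R n \<in> borel_measurable \<Omega>" for n
      unfolding R_def by (rule right_sum_measurable[OF along])
    have scale: "E * (ennreal C * ennreal (2 * p)) = (E * ennreal (C * 2)) * ennreal p" if "0 \<le> C" "0 \<le> p" for C p E
      using that by (simp add: ennreal_mult mult_ac)
    let ?E = "\<integral>\<^sup>+w. ennreal (\<bar>w u\<bar> / u) \<partial>P"
    have sumL: "AE x in bridge_law P u. summable (\<lambda>n. \<bar>L n x\<bar>)"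
    proof (rule AE_summable_abs)
      show "L n \<in> borel_measurable (bridge_law P u)" for n
        using L by (simp add: measurable_cong_sets[OF sets_bridge_law[OF P] refl])
      show "(\<Sum>n. \<integral>\<^sup>+x. ennreal \<bar>L n x\<bar> \<partial>bridge_law P u) \<noteq> \<infinity>"
      proof (rule geometric_suminf_finite)
        show "ennreal (1 + 4 * 1) + ?E * ennreal ((1 + sqrt u) * 2) \<noteq> \<infinity>"
          using wiener_abs_nn_integral_finite[OF P u] by (simp add: ennreal_mult_eq_top_iff del: ennreal_plus)
        fix n
        have "(\<integral>\<^sup>+x. ennreal \<bar>L n x\<bar> \<partial>bridge_law P u)
          \<le> ennreal ((1 / 2) ^ n) + ennreal (1 / (1 / 2) ^ n) * (\<integral>\<^sup>+s. ennreal (\<bar>g n s\<bar>\<^sup>2) \<partial>ds)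
            + ?E * (ennreal (1 + sqrt u) * (\<integral>\<^sup>+s. ennreal \<bar>g n s\<bar> \<partial>weighted_ds))"
          unfolding L_def by (rule bridge_left_sum_le[OF P u along _ qu]) auto
        also have "\<dots> \<le> ennreal (1 + 4 * 1) * ennreal ((1 / 2) ^ n) + ?E * (ennreal (1 + sqrt u) * ennreal (2 * (1 / 2) ^ n))"
          using fast_null_square_le[OF g, of 1 n] g by (intro add_mono mult_left_mono) (auto simp: fast_null_def)
        also have "\<dots> = (ennreal (1 + 4 * 1) + ?E * ennreal ((1 + sqrt u) * 2)) * ennreal ((1 / 2) ^ n)"
          using u by (subst scale) (simp_all add: distrib_right del: ennreal_plus)
        finally show "(\<integral>\<^sup>+x. ennreal \<bar>L n x\<bar> \<partial>bridge_law P u) \<le> \<dots>" .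
      qed
    qed
    \<comment> \<open>Stated for an arbitrary sequence, so that it serves the Bessel law and its
      reflection alike.\<close>
    have fin: "(\<Sum>n. a n) \<noteq> \<infinity>"
      if "\<And>n. a n \<le> ennreal ((1 / 2) ^ n) + ennreal (1 / (1 / 2) ^ n) * (ennreal normal3_second_moment * (\<integral>\<^sup>+s. ennreal (\<bar>g n s\<bar>\<^sup>2) \<partial>ds))
        + ennreal normal3_mean * bessel_drift (g n) (q n (j n))" for a
    proof (rule suminf_add_mult_finite[OF that _ _ ennreal_neq_top[folded infinity_ennreal_def]])
      show "(\<Sum>n. bessel_drift (g n) (q n (j n))) \<noteq> \<infinity>" unfolding qu by (rule drift)
      show "(\<Sum>n. ennreal ((1 / 2) ^ n) + ennreal (1 / (1 / 2) ^ n) * (ennreal normal3_second_moment * (\<integral>\<^sup>+s. ennreal (\<bar>g n s\<bar>\<^sup>2) \<partial>ds))) \<noteq> \<infinity>"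
        by (rule geometric_suminf_finite[OF _ fast_null_square_le[OF g]]) (simp_all add: normal3_second_moment_def del: ennreal_plus)
    qed
    have sumR: "AE y in sym_bessel3_law P. summable (\<lambda>n. \<bar>R n y\<bar>)"
    proof (rule AE_sym_bessel3_law[OF P])
      show "AE y in bessel3_law P. summable (\<lambda>n. \<bar>R n y\<bar>)"
      proof (rule AE_summable_abs)
        show "R n \<in> borel_measurable (bessel3_law P)" for n
          using R by (simp add: measurable_cong_sets[OF sets_bessel3_law(1)[OF P] refl])
        show "(\<Sum>n. \<integral>\<^sup>+y. ennreal \<bar>R n y\<bar> \<partial>bessel3_law P) \<noteq> \<infinity>"
          unfolding R_def by (intro fin bessel_right_sum_le(1)[OF P along]) simp
      qed
      show "AE y in neg_bessel3_law P. summable (\<lambda>n. \<bar>R n y\<bar>)"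
      proof (rule AE_summable_abs)
        show "R n \<in> borel_measurable (neg_bessel3_law P)" for n
          using R by (simp add: measurable_cong_sets[OF sets_bessel3_law(2)[OF P] refl])
        show "(\<Sum>n. \<integral>\<^sup>+y. ennreal \<bar>R n y\<bar> \<partial>neg_bessel3_law P) \<noteq> \<infinity>"
          unfolding R_def by (intro fin bessel_right_sum_le(2)[OF P along]) simp
      qed
    qed
    have pB: "prob_space (bridge_law P u)" and pS: "prob_space (sym_bessel3_law P)"
      by (rule bridge_law_prob_space[OF P u], rule sym_bessel3_law_prob_space[OF P])
    have "AE z in bridge_law P u \<Otimes>\<^sub>M sym_bessel3_law P. summable (\<lambda>n. \<bar>step_integral (g n) (concat_path u (fst z) (snd z))\<bar>)"
      using AE_pair_fst[OF pS sumL] AE_pair_fst[OF pS bridge_law_end[OF P u]]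
        AE_pair_snd[OF pB pS sumR] AE_pair_snd[OF pB pS sym_bessel3_law_start[OF P]]
    proof eventually_elim
      case (elim z)
      show ?case
      proof (rule summable_comparison_test')
        show "summable (\<lambda>n. \<bar>L n (fst z)\<bar> + \<bar>R n (snd z)\<bar>)" using elim by (intro summable_add)
        fix n :: nat
        have "step_integral (g n) (concat_path u (fst z) (snd z)) = L n (fst z) + R n (snd z)"
          unfolding L_def R_def by (rule step_integral_concat_path[OF along qu u]) (use elim in auto)
        then show "norm \<bar>step_integral (g n) (concat_path u (fst z) (snd z))\<bar> \<le> \<bar>L n (fst z)\<bar> + \<bar>R n (snd z)\<bar>"
          by simp
      qed
    qed
    moreover have "(\<lambda>(x, y). concat_path u x y) \<in> measurable (bridge_law P u \<Otimes>\<^sub>M sym_bessel3_law P) \<Omega>"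
      by (simp add: measurable_cong_sets[OF sets_pair_measure_cong[OF sets_bridge_law[OF P] sets_sym_bessel3_law[OF P]] refl]
          concat_path_measurable[OF u])
    \<comment> \<open>\<open>AE_distr_iff\<close> asks for a measurable event; summability of
      absolute values becomes one as finiteness of an extended real series.\<close>
    moreover have "{w \<in> space \<Omega>. summable (\<lambda>n. \<bar>step_integral (g n) w\<bar>)} \<in> sets \<Omega>"
    proof -
      note [measurable] = step_integral_measurable[OF sf]
      show ?thesis by (simp add: summable_iff_suminf_ennreal)
    qed
    ultimately show "AE w in bridge_bessel_law P u. summable (\<lambda>n. \<bar>step_integral (g n) w\<bar>)"
      unfolding bridge_bessel_law_def by (subst AE_distr_iff) (auto simp: case_prod_unfold)
  qed
qed

end

text \<open>The first bound is on the squared L2 distance, so both distances decay at least like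
  \<open>(1 / 2) ^ n\<close>.\<close>

definition fast_approx :: "(nat \<Rightarrow> real \<Rightarrow> real) \<Rightarrow> (real \<Rightarrow> real) \<Rightarrow> bool" where
  "fast_approx h f \<longleftrightarrow> (\<forall>n. step_function (h n) \<and>
     (\<integral>\<^sup>+s. ennreal (\<bar>h n s - f s\<bar>\<^sup>2) \<partial>ds) \<le> ennreal ((1 / 4) ^ n) \<and>
     (\<integral>\<^sup>+s. ennreal \<bar>h n s - f s\<bar> \<partial>weighted_ds) \<le> ennreal ((1 / 2) ^ n))"

lemma fast_null_diff:
  assumes f[measurable]: "f \<in> borel_measurable ds" and h: "fast_approx h f" and k: "fast_approx k f"
  shows "fast_null (\<lambda>n s. h n s - k n s)"
  unfolding fast_null_def
proof (intro allI conjI)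
  fix n
  have sf: "step_function (h n)" "step_function (k n)" using h k by (auto simp: fast_approx_def)
  note [measurable] = step_function_measurable_ds[OF sf(1)] step_function_measurable_ds[OF sf(2)]
  have [measurable]: "f \<in> borel_measurable weighted_ds" "h n \<in> borel_measurable weighted_ds" "k n \<in> borel_measurable weighted_ds"
    by simp_all
  show "step_function (\<lambda>s. h n s - k n s)" by (rule step_function_diff(1)[OF sf])
  \<comment> \<open>The right side exceeds the left by exactly
    \<open>(a + b - 2 * c)^2\<close>.\<close>
  have "\<bar>a - b\<bar>\<^sup>2 \<le> 2 * \<bar>a - c\<bar>\<^sup>2 + 2 * \<bar>b - c\<bar>\<^sup>2" for a b c :: real
  proof -
    have "0 \<le> (a + b - 2 * c)\<^sup>2" by simp
    then show ?thesis by (simp add: power2_eq_square algebra_simps)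
  qed
  then have "(\<integral>\<^sup>+s. ennreal (\<bar>h n s - k n s\<bar>\<^sup>2) \<partial>ds)
    \<le> (\<integral>\<^sup>+s. 2 * ennreal (\<bar>h n s - f s\<bar>\<^sup>2) + 2 * ennreal (\<bar>k n s - f s\<bar>\<^sup>2) \<partial>ds)"
    by (intro nn_integral_mono) (simp add: ennreal_plus[symmetric] ennreal_mult'[symmetric] ennreal_numeral[symmetric] ennreal_leI del: ennreal_plus ennreal_numeral)
  also have "\<dots> = 2 * (\<integral>\<^sup>+s. ennreal (\<bar>h n s - f s\<bar>\<^sup>2) \<partial>ds) + 2 * (\<integral>\<^sup>+s. ennreal (\<bar>k n s - f s\<bar>\<^sup>2) \<partial>ds)"
    by (subst nn_integral_add) (simp_all add: nn_integral_cmult)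
  also have "\<dots> \<le> 2 * ennreal ((1 / 4) ^ n) + 2 * ennreal ((1 / 4) ^ n)"
    using h k by (intro add_mono mult_left_mono) (auto simp: fast_approx_def)
  also have "\<dots> = ennreal (4 * (1 / 4) ^ n)"
    by (simp add: ennreal_mult' distrib_right[symmetric])
  finally show "(\<integral>\<^sup>+s. ennreal (\<bar>h n s - k n s\<bar>\<^sup>2) \<partial>ds) \<le> ennreal (4 * (1 / 4) ^ n)" .
  have "(\<integral>\<^sup>+s. ennreal \<bar>h n s - k n s\<bar> \<partial>weighted_ds)
    \<le> (\<integral>\<^sup>+s. ennreal \<bar>h n s - f s\<bar> + ennreal \<bar>k n s - f s\<bar> \<partial>weighted_ds)"
    by (intro nn_integral_mono) (simp add: ennreal_plus[symmetric] ennreal_leI del: ennreal_plus)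
  also have "\<dots> = (\<integral>\<^sup>+s. ennreal \<bar>h n s - f s\<bar> \<partial>weighted_ds) + (\<integral>\<^sup>+s. ennreal \<bar>k n s - f s\<bar> \<partial>weighted_ds)"
    by (rule nn_integral_add) measurable
  also have "\<dots> \<le> ennreal ((1 / 2) ^ n) + ennreal ((1 / 2) ^ n)"
    using h k by (intro add_mono) (auto simp: fast_approx_def)
  also have "\<dots> = ennreal (2 * (1 / 2) ^ n)"
    by (simp add: ennreal_plus[symmetric] del: ennreal_plus)
  finally show "(\<integral>\<^sup>+s. ennreal \<bar>h n s - k n s\<bar> \<partial>weighted_ds) \<le> ennreal (2 * (1 / 2) ^ n)" .
qed

lemma fast_approx_Suc:
  assumes h: "fast_approx h f" shows "fast_approx (\<lambda>n. h (Suc n)) f"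
  unfolding fast_approx_def
proof (intro allI conjI)
  fix n
  have *: "ennreal (c ^ Suc n) \<le> ennreal (c ^ n)" if "0 \<le> c" "c \<le> 1" for c :: real
    using that by (intro ennreal_leI) (simp add: mult_left_le_one_le)
  show "step_function (h (Suc n))" using h by (simp add: fast_approx_def)
  show "(\<integral>\<^sup>+s. ennreal (\<bar>h (Suc n) s - f s\<bar>\<^sup>2) \<partial>ds) \<le> ennreal ((1 / 4) ^ n)"
    by (rule order_trans[OF _ *]) (use h[unfolded fast_approx_def, rule_format, of "Suc n"] in auto)
  show "(\<integral>\<^sup>+s. ennreal \<bar>h (Suc n) s - f s\<bar> \<partial>weighted_ds) \<le> ennreal ((1 / 2) ^ n)"
    by (rule order_trans[OF _ *]) (use h[unfolded fast_approx_def, rule_format, of "Suc n"] in auto)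
qed

text \<open>Summable consecutive differences make the integrals of \<open>h\<close> converge, and
  summable differences \<open>k n - h n\<close> give \<open>k\<close> the same limit. The limit is a
  function of the path alone, so one random variable works for almost every
  \<open>u\<close>.\<close>

lemma fast_approx_AE_tendsto:
  assumes P: "wiener_measure P" and f: "f \<in> borel_measurable ds"
    and h: "fast_approx h f" and k: "fast_approx k f"
  shows "AE u in lborel. 0 < u \<longrightarrow>
    (AE w in bridge_bessel_law P u. (\<lambda>n. step_integral (k n) w) \<longlonglongrightarrow> lim (\<lambda>n. step_integral (h n) w))"
  using fast_null_AE_summable[OF P fast_null_diff[OF f fast_approx_Suc[OF h] h]]
    fast_null_AE_summable[OF P fast_null_diff[OF f k h]]
proof eventually_elim
  case (elim u)
  have sf: "step_function (h n)" "step_function (k n)" for n using h k by (auto simp: fast_approx_def)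
  show ?case
  proof
    assume "0 < u"
    with elim have
      "AE w in bridge_bessel_law P u. summable (\<lambda>n. \<bar>step_integral (\<lambda>s. h (Suc n) s - h n s) w\<bar>)"
      "AE w in bridge_bessel_law P u. summable (\<lambda>n. \<bar>step_integral (\<lambda>s. k n s - h n s) w\<bar>)"
      by auto
    then show "AE w in bridge_bessel_law P u. (\<lambda>n. step_integral (k n) w) \<longlonglongrightarrow> lim (\<lambda>n. step_integral (h n) w)"
    proof eventually_elim
      case (elim w)
      let ?S = "\<lambda>n. step_integral (h n) w"
      have "summable (\<lambda>n. ?S (Suc n) - ?S n)"
        using summable_rabs_cancel[OF elim(1)] by (simp add: step_function_diff(2)[OF sf(1) sf(1)])
      then have "(\<lambda>n. \<Sum>i<n. ?S (Suc i) - ?S i) \<longlonglongrightarrow> (\<Sum>i. ?S (Suc i) - ?S i)"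
        by (rule summable_LIMSEQ)
      then have "(\<lambda>n. (?S n - ?S 0) + ?S 0) \<longlonglongrightarrow> (\<Sum>i. ?S (Suc i) - ?S i) + ?S 0"
        by (intro tendsto_add tendsto_const) (simp only: sum_lessThan_telescope[of ?S])
      then have "convergent ?S" by (auto simp: convergent_def)
      then have S: "?S \<longlonglongrightarrow> lim ?S" by (simp add: convergent_LIMSEQ_iff)
      have "(\<lambda>n. step_integral (k n) w - ?S n) \<longlonglongrightarrow> 0"
        using summable_LIMSEQ_zero[OF summable_rabs_cancel[OF elim(2)]] by (simp add: step_function_diff(2)[OF sf(2) sf(1)])
      from tendsto_add[OF this S] show ?case by simp
    qed
  qed
qed

section \<open>From almost every \<open>u\<close> to the mixture \<open>\<W>\<close>\<close>

lemma sets_\<W>[measurable_cong]: "sets (\<W> P) = sets \<Omega>" and space_\<W>: "space (\<W> P) = space \<Omega>"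
  by (simp_all add: \<W>_def space_measure_of_conv)

text \<open>If the defining formula were not countably additive, \<open>measure_of\<close> would return the zero measure.\<close>

lemma emeasure_\<W>_cases:
  obtains "\<And>A. emeasure (\<W> P) A = 0"
  | "\<And>A. A \<in> sets \<Omega> \<Longrightarrow> emeasure (\<W> P) A =
      (\<integral>\<^sup>+u. ennreal (1 / sqrt (2 * pi * u)) * emeasure (bridge_bessel_law P u) A * indicator {0<..} u \<partial>lborel)"
  by (cases "measure_space (space \<Omega>) (sets \<Omega>) (\<lambda>A. \<integral>\<^sup>+u\<in>{0<..}. ennreal (1 / sqrt (2 * pi * u)) * emeasure (bridge_bessel_law P u) A \<partial>lborel)")
     (auto simp: \<W>_def emeasure_measure_of_conv sets.sigma_sets_eq)

text \<open>For almost every \<open>u\<close> the bad sets have vanishing probability. The integrand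
  belonging to \<open>A\<close> dominates, and its integral is finite because \<open>A\<close> has
  finite measure: this is why convergence is only local.\<close>

lemma fast_approx_tendsto_\<W>:
  assumes P: "wiener_measure P" and f: "f \<in> borel_measurable ds"
    and h: "fast_approx h f" and k: "fast_approx k f"
    and A: "A \<in> sets (\<W> P)" "emeasure (\<W> P) A < \<infinity>" and e: "0 < e"
  defines "Z \<equiv> \<lambda>w. lim (\<lambda>n. step_integral (h n) w)"
  shows "(\<lambda>n. emeasure (\<W> P) (A \<inter> {w \<in> space (\<W> P). \<bar>step_integral (k n) w - Z w\<bar> \<ge> e})) \<longlonglongrightarrow> 0"
proof (rule emeasure_\<W>_cases[of P])
  assume "\<And>A. emeasure (\<W> P) A = 0"
  then show ?thesis by simp
next
  let ?\<rho> = "\<lambda>u. ennreal (1 / sqrt (2 * pi * u))"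
  assume em: "\<And>A. A \<in> sets \<Omega> \<Longrightarrow> emeasure (\<W> P) A =
      (\<integral>\<^sup>+u. ?\<rho> u * emeasure (bridge_bessel_law P u) A * indicator {0<..} u \<partial>lborel)"
  have sf: "step_function (h n)" "step_function (k n)" for n using h k by (auto simp: fast_approx_def)
  have [measurable]: "step_integral (k n) \<in> borel_measurable \<Omega>" "step_integral (h n) \<in> borel_measurable \<Omega>" for n
    by (auto intro: step_integral_measurable sf)
  have [measurable]: "Z \<in> borel_measurable \<Omega>" unfolding Z_def by measurable
  have A\<Omega>[measurable]: "A \<in> sets \<Omega>" using A(1) by (simp add: sets_\<W>)
  define B where "B n = A \<inter> {w \<in> space \<Omega>. \<bar>step_integral (k n) w - Z w\<bar> \<ge> e}" for n
  have B[measurable]: "B n \<in> sets \<Omega>" for n unfolding B_def by measurable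
  have "(\<lambda>n. \<integral>\<^sup>+u. ?\<rho> u * emeasure (bridge_bessel_law P u) (B n) * indicator {0<..} u \<partial>lborel) \<longlonglongrightarrow> 0"
  proof (rule nn_integral_tendsto_zero)
    have sets: "sets (bridge_bessel_law P u) = sets \<Omega>" for u by (simp add: bridge_bessel_law_def)
    show "?\<rho> u * emeasure (bridge_bessel_law P u) (B n) * indicator {0<..} u
      \<le> ?\<rho> u * emeasure (bridge_bessel_law P u) A * indicator {0<..} u" for n u
      by (intro mult_right_mono mult_left_mono emeasure_mono) (auto simp: B_def sets)
    show "(\<integral>\<^sup>+u. ?\<rho> u * emeasure (bridge_bessel_law P u) A * indicator {0<..} u \<partial>lborel) < \<infinity>"
      using A(2) em[OF A\<Omega>] by simp
    show "AE u in lborel. (\<lambda>n. ?\<rho> u * emeasure (bridge_bessel_law P u) (B n) * indicator {0<..} u) \<longlonglongrightarrow> 0"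
      using fast_approx_AE_tendsto[OF P f h k]
    proof eventually_elim
      case (elim u)
      show ?case
      proof (cases "0 < u")
        case True
        interpret prob_space "bridge_bessel_law P u" by (rule bridge_bessel_law_prob_space[OF P True])
        have sp: "space (bridge_bessel_law P u) = space \<Omega>" by (rule sets_eq_imp_space_eq[OF sets])
        note [measurable_cong] = sets
        have "(\<lambda>n. emeasure (bridge_bessel_law P u) (B n)) \<longlonglongrightarrow> 0"
          unfolding B_def sp[symmetric]
        proof (rule AE_tendsto_imp_emeasure_tendsto_0[OF finite_measure_axioms _ _ _ e])
          show "AE w in bridge_bessel_law P u. (\<lambda>n. step_integral (k n) w) \<longlonglongrightarrow> Z w"
            using elim True unfolding Z_def by blast
          show "step_integral (k n) \<in> borel_measurable (bridge_bessel_law P u)" "Z \<in> borel_measurable (bridge_bessel_law P u)" for n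
            unfolding measurable_cong_sets[OF sets refl] by measurable
        qed (simp add: sets)
        then have "(\<lambda>n. ?\<rho> u * emeasure (bridge_bessel_law P u) (B n)) \<longlonglongrightarrow> ?\<rho> u * 0"
          by (intro ennreal_tendsto_cmult) auto
        then show ?thesis using True by simp
      qed simp
    qed
  qed
  then show ?thesis by (simp add: em[OF B] B_def[symmetric] space_\<W>)
qed

lemma ex_fast_approx:
  assumes "\<And>n. step_function (h n)" "L2_tendsto ds h f" "L1_tendsto weighted_ds h f"
    and "\<exists>\<^sub>F n in sequentially. Q n"
  shows "\<exists>r. fast_approx (\<lambda>n. h (r n)) f \<and> (\<forall>n. Q (r n))"
proof -
  have "\<exists>n. Q n \<and> (\<integral>\<^sup>+s. ennreal (\<bar>h n s - f s\<bar>\<^sup>2) \<partial>ds) < ennreal ((1 / 4) ^ i) \<and>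
      (\<integral>\<^sup>+s. ennreal \<bar>h n s - f s\<bar> \<partial>weighted_ds) < ennreal ((1 / 2) ^ i)" for i
  proof -
    have "\<forall>\<^sub>F n in sequentially. (\<integral>\<^sup>+s. ennreal (\<bar>h n s - f s\<bar>\<^sup>2) \<partial>ds) < ennreal ((1 / 4) ^ i)"
      using assms(2) unfolding L2_tendsto_def by (rule order_tendstoD) simp
    moreover have "\<forall>\<^sub>F n in sequentially. (\<integral>\<^sup>+s. ennreal \<bar>h n s - f s\<bar> \<partial>weighted_ds) < ennreal ((1 / 2) ^ i)"
      using assms(3) unfolding L1_tendsto_def by (rule order_tendstoD) simp
    ultimately have "\<exists>\<^sub>F n in sequentially. Q n \<and> (\<integral>\<^sup>+s. ennreal (\<bar>h n s - f s\<bar>\<^sup>2) \<partial>ds) < ennreal ((1 / 4) ^ i) \<and>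
      (\<integral>\<^sup>+s. ennreal \<bar>h n s - f s\<bar> \<partial>weighted_ds) < ennreal ((1 / 2) ^ i)"
      by (rule frequently_rev_mp[OF assms(4) eventually_elim2]) blast
    then show ?thesis by (rule frequently_ex)
  qed
  then have "\<forall>i. \<exists>n. Q n \<and> (\<integral>\<^sup>+s. ennreal (\<bar>h n s - f s\<bar>\<^sup>2) \<partial>ds) < ennreal ((1 / 4) ^ i) \<and>
      (\<integral>\<^sup>+s. ennreal \<bar>h n s - f s\<bar> \<partial>weighted_ds) < ennreal ((1 / 2) ^ i)" by (rule allI)
  from choice[OF this] obtain r where "\<And>i. Q (r i) \<and> (\<integral>\<^sup>+s. ennreal (\<bar>h (r i) s - f s\<bar>\<^sup>2) \<partial>ds) < ennreal ((1 / 4) ^ i) \<and>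
      (\<integral>\<^sup>+s. ennreal \<bar>h (r i) s - f s\<bar> \<partial>weighted_ds) < ennreal ((1 / 2) ^ i)"
    by (elim exE) (rule that, blast)
  then show ?thesis
    using assms(1) by (intro exI[of _ r]) (auto simp: fast_approx_def less_imp_le)
qed

text \<open>Subsequence argument with the limit fixed by \<open>k\<close>: if the measures stayed
  above some \<open>v\<close> infinitely often, a fast approximation could be chosen among those
  indices, contradicting \<open>fast_approx_tendsto_\<W>\<close>.\<close>

lemma fast_approx_converges_locally:
  assumes P: "wiener_measure P" and f: "f \<in> borel_measurable ds" and k: "fast_approx k f"
    and h: "\<And>n. step_function (h n)" "L2_tendsto ds h f" "L1_tendsto weighted_ds h f"
  shows "converges_locally_in_measure (\<W> P) (\<lambda>n. step_integral (h n)) (\<lambda>w. lim (\<lambda>n. step_integral (k n) w))"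
  unfolding converges_locally_in_measure_def
proof (intro conjI allI impI ballI)
  have sf: "step_function (k n)" for n using k by (auto simp: fast_approx_def)
  have [measurable]: "step_integral (h n) \<in> borel_measurable \<Omega>" "step_integral (k n) \<in> borel_measurable \<Omega>" for n
    by (auto intro: step_integral_measurable sf h)
  show "step_integral (h n) \<in> borel_measurable (\<W> P)" for n
    unfolding measurable_cong_sets[OF sets_\<W> refl] by measurable
  show "(\<lambda>w. lim (\<lambda>n. step_integral (k n) w)) \<in> borel_measurable (\<W> P)"
    unfolding measurable_cong_sets[OF sets_\<W> refl] by measurable
  fix e :: real and A
  assume e: "0 < e" and A: "A \<in> sets (\<W> P)" "emeasure (\<W> P) A < \<infinity>"
  define a where "a n = emeasure (\<W> P) (A \<inter> {w \<in> space (\<W> P). \<bar>step_integral (h n) w - lim (\<lambda>n. step_integral (k n) w)\<bar> \<ge> e})" for n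
  have "a \<longlonglongrightarrow> 0"
  proof (rule order_tendstoI)
    fix v :: ennreal assume v: "0 < v"
    show "\<forall>\<^sub>F n in sequentially. a n < v"
    proof (rule ccontr)
      assume "\<not> (\<forall>\<^sub>F n in sequentially. a n < v)"
      then have "\<exists>\<^sub>F n in sequentially. \<not> a n < v" by (simp add: frequently_def)
      from ex_fast_approx[OF h this] obtain r where r: "fast_approx (\<lambda>n. h (r n)) f" "\<And>n. \<not> a (r n) < v" by blast
      have "(\<lambda>n. a (r n)) \<longlonglongrightarrow> 0"
        unfolding a_def by (rule fast_approx_tendsto_\<W>[OF P f k r(1) A e])
      then have "\<forall>\<^sub>F n in sequentially. a (r n) < v" using v by (rule order_tendstoD)
      then show False using r(2) by simp
    qed
  qed simp
  then show "(\<lambda>n. emeasure (\<W> P) (A \<inter> {w \<in> space (\<W> P). \<bar>step_integral (h n) w - lim (\<lambda>n. step_integral (k n) w)\<bar> \<ge> e})) \<longlonglongrightarrow> 0"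
    unfolding a_def .
qed

lemma L1_tendsto_weighted:
  assumes f[measurable]: "f \<in> borel_measurable ds" and h: "\<And>n. step_function (h n)" and lim: "L1_tendsto ds h f"
  shows "L1_tendsto weighted_ds h f"
  unfolding L1_tendsto_def
proof (rule tendsto_sandwich[OF _ _ tendsto_const lim[unfolded L1_tendsto_def]])
  have "(\<integral>\<^sup>+s. ennreal \<bar>h n s - f s\<bar> \<partial>weighted_ds) \<le> (\<integral>\<^sup>+s. ennreal \<bar>h n s - f s\<bar> \<partial>ds)" for n
  proof -
    note [measurable] = step_function_measurable_ds[OF h[of n]]
    have "(\<integral>\<^sup>+s. ennreal \<bar>h n s - f s\<bar> \<partial>weighted_ds) = (\<integral>\<^sup>+s. ennreal (1 / (1 + sqrt s)) * ennreal \<bar>h n s - f s\<bar> \<partial>ds)"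
      by (rule nn_integral_weighted_ds) measurable
    also have "\<dots> \<le> (\<integral>\<^sup>+s. ennreal \<bar>h n s - f s\<bar> \<partial>ds)"
    proof (rule nn_integral_mono)
      fix s assume "s \<in> space ds"
      then have "0 \<le> s" by (simp add: space_restrict_space)
      then have "1 / (1 + sqrt s) \<le> 1" by (simp add: field_simps add_pos_nonneg)
      then have "ennreal (1 / (1 + sqrt s)) \<le> 1" using ennreal_leI[of _ 1] by simp
      from mult_right_mono[OF this] show "ennreal (1 / (1 + sqrt s)) * ennreal \<bar>h n s - f s\<bar> \<le> ennreal \<bar>h n s - f s\<bar>"
        by simp
    qed
    finally show ?thesis .
  qed
  then show "\<forall>\<^sub>F n in sequentially. (\<integral>\<^sup>+s. ennreal \<bar>h n s - f s\<bar> \<partial>weighted_ds) \<le> (\<integral>\<^sup>+s. ennreal \<bar>h n s - f s\<bar> \<partial>ds)"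
    by simp
qed simp

theorem corollary1p2:
  fixes P :: "(real \<Rightarrow> real) measure"
    and f :: "real \<Rightarrow> real" and fn :: "nat \<Rightarrow> real \<Rightarrow> real"
  assumes "wiener_measure P"
    and "f \<in> borel_measurable ds"
    and "integrable ds (\<lambda>s. (f s)\<^sup>2)" and "integrable ds f"
    and "\<And>n. step_function (fn n)"
    and "L2_tendsto ds fn f" and "L1_tendsto ds fn f"
  shows "converges_locally_in_measure (\<W> P)
           (\<lambda>n. step_integral (fn n)) (wiener_integral (\<W> P) f)"
proof -
  note L1 = L1_tendsto_weighted[OF assms(2,5,7)]
  have "\<exists>\<^sub>F n :: nat in sequentially. True" by simp
  \<comment> \<open>With the trivial property as \<open>Q\<close>, the given sequence itself
    supplies the fast approximation that fixes the limit.\<close>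
  from ex_fast_approx[OF assms(5,6) L1 this] obtain r where r: "fast_approx (\<lambda>n. fn (r n)) f" by blast
  let ?Q = "\<lambda>Z. Z \<in> borel_measurable (\<W> P) \<and>
        (\<forall>h. (\<forall>n. step_function (h n)) \<and> L2_tendsto ds h f \<and> L1_tendsto weighted_ds h f \<longrightarrow>
           converges_locally_in_measure (\<W> P) (\<lambda>n. step_integral (h n)) Z)"
  note conv = fast_approx_converges_locally[OF assms(1,2) r]
  \<comment> \<open>A witness for the \<open>SOME\<close> in \<open>wiener_integral\<close>. Being
    universal over approximating sequences, its property transfers to the chosen version and is then
    specialised to \<open>fn\<close>.\<close>
  have "?Q (\<lambda>w. lim (\<lambda>n. step_integral (fn (r n)) w))"
    using conv conv[OF assms(5,6) L1] by (auto simp: converges_locally_in_measure_def)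
  then have "?Q (wiener_integral (\<W> P) f)"
    unfolding wiener_integral_def by (rule someI[of ?Q])
  then show ?thesis using assms(5,6) L1 by blast
qed

end
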